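(* Let $m\ge 1$ be an integer, $a<t<b$, and $f(x)=g(x)/(x-t)^m$ with $g\in C^\infty(a,b)$ and $g$ integrable at $x=a$ and $x=b$. Let $\psi\in C[\alpha,\beta]\cap C^\infty(\alpha,\beta)$ with $\psi(\alpha)=a$, $\psi(\beta)=b$ and $\psi'(\xi)>0$ for $\xi\in(\alpha,\beta)$, and let $F(\xi)=f(\psi(\xi))\psi'(\xi)$, $T=\beta-\alpha$, and let $\tau\in(\alpha,\beta)$ be defined by $\psi(\tau)=t$. Let $q$ be a positive integer such that $$F^{(i)}(\alpha)=0=F^{(i)}(\beta),\qquad i=0,1,\ldots,q-1,$$ and such that, for the $T$-periodic extension $\mathcal F$ of $F$, $\mathcal F^{(q)}$ is absolutely integrable through $\xi=\beta$. Then, for each integer $s$ with $0\le s\le\lfloor (m+2)/2\rfloor$, the quadrature formulas $\widehat T^{(s)}_{m,n}[\mathcal F]$ satisfy $$\lim_{n\to\infty}\widehat T^{(s)}_{m,n}[\mathcal F]=I[F];$$ actually, $$\widehat T^{(s)}_{m,n}[\mathcal F]-I[F]=O(n^{-q})\qquad\text{as } n\to\infty,\quad\text{for each } m \text{ and } s.$$ (Here $q$ depends only on the behavior of $g(x)$ at $x=a$ and $x=b$ and on $\psi$, and is independent of $m$.)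
   Context: All intervals are finite. "$g$ integrable at $x=a$ and $x=b$" means integrable on $(a,a+\delta)$ and $(b-\delta,b)$ for small $\delta>0$; no continuity of $g$ at the endpoints is assumed. Finite part: $I[F]=\mathrm{f.p.}\!\int_\alpha^\beta F(\xi)\,d\xi$ is the Hadamard Finite Part, obtained by expanding $\int_\alpha^{\tau-\epsilon}F(\xi)\,d\xi+\int_{\tau+\epsilon}^{\beta}F(\xi)\,d\xi$ asymptotically as $\epsilon\to0+$, discarding the terms that go to infinity, and taking the limit of the rest. Endpoint conditions: $F^{(i)}(\alpha)=0=F^{(i)}(\beta)$ are understood as one-sided conditions (limits as $\xi\to\alpha+$, $\xi\to\beta-$). The $T$-periodic extension $\mathcal F$ is defined by $\mathcal F(\xi)=F(\xi)$ for $\xi\in(\alpha,\beta)$, $\mathcal F(\xi+kT)=\mathcal F(\xi)$ for all integers $k$, and by continuity (value $0$) at $\xi=\beta+kT$. Thus $\mathcal F$ is of class $C^{q-1}$ in a neighborhood of $\beta$. "$\mathcal F^{(q)}$ absolutely integrable through $\beta$" means that $\mathcal F^{(q-1)}$ is absolutely continuous in a neighborhood of $\beta$ with $\mathcal F^{(q)}$ absolutely integrable there. The function $G$: $G(\xi)=(\xi-\tau)^mF(\xi)$, extended smoothly to $\xi=\tau$, i.e. $G(\xi)=g(\psi(\xi))\psi'(\xi)/(\psi[\xi,\tau])^m$ with $\psi[\xi,\tau]=(\psi(\xi)-\psi(\tau))/(\xi-\tau)$ for $\xi\ne\tau$ and $\psi[\tau,\tau]=\psi'(\tau)$; $G\in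 C^\infty(\alpha,\beta)$. Quadrature formulas: let $h=T/n$, $n=1,2,\ldots$, and let $\zeta$ be the Riemann zeta function. For $m=2r$, $r=1,2,\ldots$: $$\widehat T^{(0)}_{2r,n}[\mathcal F]=h\sum_{j=1}^{n-1}\mathcal F(\tau+jh)-2\sum_{i=0}^{r}\frac{G^{(2i)}(\tau)}{(2i)!}\,\zeta(2r-2i)\,h^{-2r+2i+1}.$$ For $m=2r+1$, $r=0,1,\ldots$: $$\widehat T^{(0)}_{2r+1,n}[\mathcal F]=h\sum_{j=1}^{n-1}\mathcal F(\tau+jh)-2\sum_{i=0}^{r}\frac{G^{(2i+1)}(\tau)}{(2i+1)!}\,\zeta(2r-2i)\,h^{-2r+2i+1}.$$ For $s=1,\ldots,\lfloor (m+2)/2\rfloor$, $\widehat T^{(s)}_{m,n}[\mathcal F]$ is obtained by $s$ steps of a Richardson-like extrapolation on $\{\widehat T^{(0)}_{m,2^kn}[\mathcal F]\}_{k=0}^s$ that eliminates successively the powers $h^{1},h^{-1},h^{-3},\ldots,h^{-2s+3}$; that is, $$\widehat T^{(s)}_{m,n}[\mathcal F]=\frac{2^{2s-3}\,\widehat T^{(s-1)}_{m,n}[\mathcal F]-\widehat T^{(s-1)}_{m,2n}[\mathcal F]}{2^{2s-3}-1}.$$ For instance $\widehat T^{(1)}_{m,n}=2\widehat T^{(0)}_{m,2n}-\widehat T^{(0)}_{m,n}$, $\widehat T^{(2)}_{m,n}=2\widehat T^{(1)}_{m,n}-\widehat T^{(1)}_{m,2n}$, $\widehat T^{(3)}_{m,n}=\tfrac87\widehat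 T^{(2)}_{m,n}-\tfrac17\widehat T^{(2)}_{m,2n}$. *)

theory Defs
  imports "HOL-Analysis.Analysis" "HOL-Library.Landau_Symbols"
begin

definition smooth_on :: "real set \<Rightarrow> (real \<Rightarrow> real) \<Rightarrow> bool" where
  "smooth_on S f \<longleftrightarrow> open S \<and> (\<forall>k. \<forall>x\<in>S. (deriv ^^ k) f differentiable (at x))"

text \<open>The elements of a division are nonempty compact intervals with disjoint interiors, so
  \<open>Inf K\<close> and \<open>Sup K\<close> are the endpoints of \<open>K\<close>.\<close>

definition abs_continuous_on :: "real set \<Rightarrow> (real \<Rightarrow> real) \<Rightarrow> bool" where
  "abs_continuous_on S f \<longleftrightarrow>
     (\<forall>\<epsilon>>0. \<exists>\<delta>>0. \<forall>\<D>. \<D> division_of \<Union>\<D> \<and> \<Union>\<D> \<subseteq> S \<and> (\<Sum>K\<in>\<D>. Sup K - Inf K) < \<delta> \<longrightarrow>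
        (\<Sum>K\<in>\<D>. \<bar>f (Sup K) - f (Inf K)\<bar>) < \<epsilon>)"

text \<open>Hadamard finite part of the integral of \<open>F\<close> over \<open>(\<alpha>, \<beta>)\<close>, singular at \<open>\<tau>\<close>.
  The truncated integrals are expanded in the scale \<open>\<epsilon>\<^sup>p (ln \<epsilon>)\<^sup>k\<close>; the members of the scale that
  are unbounded as \<open>\<epsilon> \<rightarrow> 0+\<close> are those with \<open>p < 0\<close>, or \<open>p = 0\<close> and \<open>k \<ge> 1\<close>. These functions are
  linearly independent modulo convergent ones, so \<open>I\<close> is unique.\<close>

definition has_finite_part :: "(real \<Rightarrow> real) \<Rightarrow> real \<Rightarrow> real \<Rightarrow> real \<Rightarrow> real \<Rightarrow> bool" where
  "has_finite_part F \<alpha> \<beta> \<tau> I \<longleftrightarrow>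
     (\<forall>\<epsilon>>0. F integrable_on {\<alpha>..\<tau> - \<epsilon>} \<and> F integrable_on {\<tau> + \<epsilon>..\<beta>}) \<and>
     (\<exists>(S :: (real \<times> nat) set) c. finite S \<and> (\<forall>(p, k)\<in>S. p < 0 \<or> p = 0 \<and> k \<ge> 1) \<and>
        ((\<lambda>\<epsilon>. integral {\<alpha>..\<tau> - \<epsilon>} F + integral {\<tau> + \<epsilon>..\<beta>} F
               - (\<Sum>(p, k)\<in>S. c (p, k) * (\<epsilon> powr p * ln \<epsilon> ^ k))) \<longlongrightarrow> I) (at_right 0))"

definition finite_part :: "(real \<Rightarrow> real) \<Rightarrow> real \<Rightarrow> real \<Rightarrow> real \<Rightarrow> real" where
  "finite_part F \<alpha> \<beta> \<tau> = (THE I. has_finite_part F \<alpha> \<beta> \<tau> I)"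

text \<open>The value at \<open>s\<close> of the analytic continuation of the Dirichlet series to a half-plane
  containing \<open>s\<close>, punctured at the pole \<open>1\<close>. By the identity theorem the value does not depend on
  the half-plane; at \<open>s = 1\<close> it is unspecified.\<close>

definition riemann_zeta :: "complex \<Rightarrow> complex" where
  "riemann_zeta s = (THE w. \<exists>\<sigma> f. \<sigma> < Re s \<and> f holomorphic_on ({z. Re z > \<sigma>} - {1}) \<and>
     (\<forall>z. Re z > 1 \<longrightarrow> (\<lambda>k. of_nat (Suc k) powr (- z)) sums f z) \<and> w = f s)"

text \<open>\<open>\<zeta>(k)\<close> for a natural number \<open>k \<noteq> 1\<close>, which is a real number.\<close>

definition zeta_nat :: "nat \<Rightarrow> real" where
  "zeta_nat k = Re (riemann_zeta (of_nat k))"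

text \<open>The value of \<open>F\<close> at \<open>\<alpha>\<close> and \<open>\<beta>\<close> is not used: the extension is \<open>0\<close> there.\<close>

definition periodic_ext :: "real \<Rightarrow> real \<Rightarrow> (real \<Rightarrow> real) \<Rightarrow> real \<Rightarrow> real" where
  "periodic_ext \<alpha> \<beta> F \<xi> =
     (let \<eta> = \<xi> - of_int \<lfloor>(\<xi> - \<alpha>) / (\<beta> - \<alpha>)\<rfloor> * (\<beta> - \<alpha>) in if \<eta> = \<alpha> then 0 else F \<eta>)"

definition divided_diff :: "(real \<Rightarrow> real) \<Rightarrow> real \<Rightarrow> real \<Rightarrow> real" where
  "divided_diff \<psi> \<xi> \<tau> = (if \<xi> = \<tau> then deriv \<psi> \<tau> else (\<psi> \<xi> - \<psi> \<tau>) / (\<xi> - \<tau>))"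

text \<open>Here \<open>P\<close> is the period, \<open>\<F>\<close> the periodic integrand with a pole of order \<open>m\<close> at \<open>\<tau>\<close>, and \<open>G\<close>
  the smooth extension of \<open>(\<xi> - \<tau>)\<^sup>m F(\<xi>)\<close> to \<open>\<xi> = \<tau>\<close>.\<close>

definition T_hat0 ::
  "nat \<Rightarrow> real \<Rightarrow> real \<Rightarrow> (real \<Rightarrow> real) \<Rightarrow> (real \<Rightarrow> real) \<Rightarrow> nat \<Rightarrow> real" where
  "T_hat0 m P \<tau> \<F> G n =
     (let h = P / real n; r = m div 2 in
      h * (\<Sum>j=1..n-1. \<F> (\<tau> + real j * h)) -
      (if even m
       then 2 * (\<Sum>i=0..r. (deriv ^^ (2 * i)) G \<tau> / fact (2 * i) * zeta_nat (2 * r - 2 * i)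
                              * h powi (- 2 * int r + 2 * int i + 1))
       else 2 * (\<Sum>i=0..r. (deriv ^^ (2 * i + 1)) G \<tau> / fact (2 * i + 1) * zeta_nat (2 * r - 2 * i)
                              * h powi (- 2 * int r + 2 * int i + 1))))"

text \<open>Step \<open>s\<close> eliminates the power \<open>h\<^bsup>-2s+3\<^esup>\<close>; with \<open>s = Suc s'\<close> the factor is
  \<open>2\<^bsup>2s-3\<^esup>\<close>, which is \<open>1/2\<close> for \<open>s = 1\<close>.\<close>

primrec T_hat ::
  "nat \<Rightarrow> nat \<Rightarrow> real \<Rightarrow> real \<Rightarrow> (real \<Rightarrow> real) \<Rightarrow> (real \<Rightarrow> real) \<Rightarrow> nat \<Rightarrow> real" where
  "T_hat 0 m P \<tau> \<F> G n = T_hat0 m P \<tau> \<F> G n"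
| "T_hat (Suc s) m P \<tau> \<F> G n =
     (2 powi (2 * int (Suc s) - 3) * T_hat s m P \<tau> \<F> G n - T_hat s m P \<tau> \<F> G (2 * n))
       / (2 powi (2 * int (Suc s) - 3) - 1)"

end

theory Submission
  imports Defs "HOL-Complex_Analysis.Complex_Analysis"
begin

text \<open>
  Let \<open>L\<^sub>k(x) = \<Sum>\<^sub>l (x + l)\<^bsup>-k\<^esup>\<close>, summed over all integers \<open>l\<close> (symmetrically if \<open>k = 1\<close>). It has
  period 1, and \<open>\<Sum>\<^sub>j L\<^sub>k(j/n)\<close> over \<open>0 < j < n\<close> is exactly \<open>2 \<zeta>(k) (n\<^sup>k - 1)\<close> for even \<open>k\<close> and \<open>0\<close> for odd
  \<open>k\<close>, while the finite part of its integral over a period vanishes. Subtracting from \<open>\<F>\<close> the combination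
  of the functions \<open>L\<^sub>k((\<xi> - \<tau>)/T)\<close>, \<open>1 \<le> k \<le> m\<close>, with the same principal part at \<open>\<tau>\<close> leaves a periodic
  function \<open>R\<close> whose integral is the finite part and whose rectangle sum, node \<open>\<tau>\<close> included, equals
  the unextrapolated quadrature formula. \<open>R\<close> is as regular at \<open>\<beta>\<close> as \<open>\<F>\<close> and smooth elsewhere, so the rectangle
  rule has error \<open>O(n\<^bsup>-q\<^esup>)\<close>. The extrapolation steps are affine combinations with coefficient sum 1
  and hence preserve this rate.
\<close>

section \<open>Smooth functions on open sets\<close>

text \<open>The window from \<tau> to \<tau> + T is used instead of the original interval: it puts
  the pole at the two ends and \<beta>, the only point of limited regularity, in the interior, where
  the two flat ends of F are glued together. L_1(x) is pi cot(pi x), and the other L_k are multiples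
  of its derivatives. Their grid sums are exact because the numbers j + l n with 0 < j < n are the
  integers not divisible by n: for even k this leaves n^k times 2 zeta(k) minus the share of the
  multiples of n, and for odd k opposite terms cancel. Their finite parts vanish because an
  antiderivative of L_k is a multiple of L_(k-1), or a logarithm symmetric about 1/2 when k = 1, and
  the truncation is symmetric. Near \<beta> only absolute continuity of the derivative of order q -
  1 is available. The Taylor remainder on a cell is therefore kept as a difference of two values of
  that derivative. Each cell carries a factor h^q, and the differences summed over all n cells stay
  bounded; estimating them one by one would lose a power of n.\<close>

definition diff_upto :: "nat \<Rightarrow> real set \<Rightarrow> (real \<Rightarrow> real) \<Rightarrow> bool" where
  "diff_upto k S f \<longleftrightarrow> (\<forall>j<k. \<forall>x\<in>S. (deriv ^^ j) f differentiable (at x))"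

lemma smooth_on_iff_diff_upto: "smooth_on S f \<longleftrightarrow> open S \<and> (\<forall>k. diff_upto k S f)"
  unfolding smooth_on_def diff_upto_def by blast

lemma diff_upto_0 [simp]: "diff_upto 0 S f"
  by (simp add: diff_upto_def)

text \<open>Peeling off the innermost derivative, not the outermost, is what makes induction on the
  order work: the closure rules below apply the induction hypothesis to \<open>deriv f\<close> in
  place of \<open>f\<close>.\<close>

lemma diff_upto_Suc:
  "diff_upto (Suc k) S f \<longleftrightarrow> (\<forall>x\<in>S. f differentiable (at x)) \<and> diff_upto k S (deriv f)"
proof -
  have "(\<forall>j<Suc k. P j) \<longleftrightarrow> P 0 \<and> (\<forall>j<k. P (Suc j))" for P
    using less_Suc_eq_0_disj by auto
  then show ?thesis
    unfolding diff_upto_def by (simp add: funpow_swap1)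
qed

lemma diff_upto_mono: "diff_upto k S f \<Longrightarrow> j \<le> k \<Longrightarrow> U \<subseteq> S \<Longrightarrow> diff_upto j U f"
  unfolding diff_upto_def by (meson order_less_le_trans subsetD)

lemma smooth_on_subset: "smooth_on S f \<Longrightarrow> open U \<Longrightarrow> U \<subseteq> S \<Longrightarrow> smooth_on U f"
  unfolding smooth_on_def by blast

lemma higher_deriv_cong_open:
  assumes "open S" "\<And>x. x \<in> S \<Longrightarrow> f x = g x" "x \<in> S"
  shows "(deriv ^^ n) f x = (deriv ^^ n) (g :: real \<Rightarrow> real) x"
  using assms(3)
proof (induction n arbitrary: x)
  case (Suc n)
  have "eventually (\<lambda>y. y \<in> S) (nhds x)"
    using Suc.prems assms(1) eventually_nhds by blast
  then have "eventually (\<lambda>y. (deriv ^^ n) f y = (deriv ^^ n) g y) (nhds x)"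
    by eventually_elim (use Suc.IH in auto)
  then show ?case
    by (simp add: deriv_cong_ev)
qed (use assms in auto)

lemma differentiable_cong_open:
  assumes "open S" "\<And>x. x \<in> S \<Longrightarrow> f x = g x" "x \<in> S"
  shows "f differentiable (at x) \<longleftrightarrow> (g :: real \<Rightarrow> real) differentiable (at x)"
proof -
  have *: "g differentiable (at x)" if "f differentiable (at x)" "\<And>x. x \<in> S \<Longrightarrow> f x = g x"
    for f g :: "real \<Rightarrow> real"
    using that assms(1,3) unfolding differentiable_def
    by (metis has_derivative_transform_within_open)
  show ?thesis
    using *[of f g] *[of g f] assms(2) by auto
qed

lemma diff_upto_cong:
  assumes "open S" "\<And>x. x \<in> S \<Longrightarrow> f x = g x"
  shows "diff_upto k S f \<longleftrightarrow> diff_upto k S g"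
proof -
  have "(deriv ^^ j) f differentiable (at x) \<longleftrightarrow> (deriv ^^ j) g differentiable (at x)"
    if "x \<in> S" for j x
    using that by (intro differentiable_cong_open[OF assms(1)] higher_deriv_cong_open[OF assms])
  then show ?thesis
    unfolding diff_upto_def by blast
qed

lemma smooth_on_cong:
  assumes "\<And>x. x \<in> S \<Longrightarrow> f x = g x"
  shows "smooth_on S f \<longleftrightarrow> smooth_on S g"
  unfolding smooth_on_iff_diff_upto using diff_upto_cong assms by blast

lemma diff_upto_SucI:
  assumes "open S" "\<And>x. x \<in> S \<Longrightarrow> (f has_real_derivative f' x) (at x)" "diff_upto k S f'"
  shows "diff_upto (Suc k) S f"
  unfolding diff_upto_Suc
  using assms diff_upto_cong[OF assms(1), of "deriv f" f' k] DERIV_imp_deriv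
    real_differentiable_def by blast

lemma diff_upto_SucD:
  assumes "diff_upto (Suc k) S f"
  shows "x \<in> S \<Longrightarrow> (f has_real_derivative deriv f x) (at x)" "diff_upto k S (deriv f)"
    "diff_upto k S f"
  using assms diff_upto_mono[OF assms, of k S]
  by (auto simp: diff_upto_Suc DERIV_deriv_iff_real_differentiable)

lemma smooth_on_has_deriv:
  "smooth_on S f \<Longrightarrow> x \<in> S \<Longrightarrow> ((deriv ^^ k) f has_real_derivative (deriv ^^ Suc k) f x) (at x)"
  by (simp add: smooth_on_def DERIV_deriv_iff_real_differentiable)

lemma smooth_on_deriv: "smooth_on S f \<Longrightarrow> smooth_on S ((deriv ^^ k) f)"
  unfolding smooth_on_def by (metis comp_apply funpow_add)

lemma smooth_on_continuous_on: "smooth_on S f \<Longrightarrow> continuous_on S ((deriv ^^ k) f)"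
  using DERIV_continuous_on smooth_on_has_deriv
  by (metis DERIV_isCont continuous_at_imp_continuous_on)

text \<open>For functions whose derivatives of all orders are known explicitly, such as the
  polygamma functions and parameter integrals. Generalising over the starting index \<open>j\<close>
  of the family closes the induction.\<close>

lemma smooth_onI_family:
  assumes "open S" "\<And>k x. x \<in> S \<Longrightarrow> (D k has_real_derivative D (Suc k) x) (at x)"
  shows "smooth_on S (D 0)" "x \<in> S \<Longrightarrow> (deriv ^^ k) (D 0) x = D k x"
proof -
  have "diff_upto k S (D j)" for k j
    by (induction k arbitrary: j) (auto intro: diff_upto_SucI assms)
  then show "smooth_on S (D 0)"
    using assms by (auto simp: smooth_on_iff_diff_upto)
  show "x \<in> S \<Longrightarrow> (deriv ^^ k) (D 0) x = D k x"
  proof (induction k arbitrary: x)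
    case (Suc k)
    have "eventually (\<lambda>y. y \<in> S) (nhds x)"
      using Suc.prems assms(1) eventually_nhds by blast
    then have "eventually (\<lambda>y. (deriv ^^ k) (D 0) y = D k y) (nhds x)"
      by eventually_elim (use Suc.IH in auto)
    then show ?case
      using assms(2)[OF Suc.prems] by (simp add: deriv_cong_ev DERIV_imp_deriv)
  qed simp
qed

lemma smooth_on_const: "open S \<Longrightarrow> smooth_on S (\<lambda>_. c)"
  by (rule smooth_onI_family(1)[where D = "\<lambda>k _. if k = 0 then c else 0", simplified]) auto

lemma smooth_on_linear: "open S \<Longrightarrow> smooth_on S (\<lambda>x. u * x + v)"
  by (rule smooth_onI_family(1)[where D = "\<lambda>k x. if k = 0 then u * x + v else if k = 1 then u else 0",
        simplified]) (auto intro!: derivative_eq_intros)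

section \<open>Closure under arithmetic and composition\<close>

lemma diff_upto_add:
  assumes "open S" "diff_upto k S f" "diff_upto k S g"
  shows "diff_upto k S (\<lambda>x. f x + g x)"
  using assms(2,3)
proof (induction k arbitrary: f g)
  case (Suc k)
  show ?case
    by (rule diff_upto_SucI[OF assms(1), where f' = "\<lambda>x. deriv f x + deriv g x"])
      (auto intro!: derivative_intros Suc.IH diff_upto_SucD[OF Suc.prems(1)] diff_upto_SucD[OF Suc.prems(2)])
qed simp

lemma diff_upto_mult:
  assumes "open S" "diff_upto k S f" "diff_upto k S g"
  shows "diff_upto k S (\<lambda>x. f x * g x)"
  using assms(2,3)
proof (induction k arbitrary: f g)
  case (Suc k)
  note D = diff_upto_SucD[OF Suc.prems(1)] diff_upto_SucD[OF Suc.prems(2)]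
  show ?case
  proof (rule diff_upto_SucI[OF assms(1), where f' = "\<lambda>x. f x * deriv g x + deriv f x * g x"])
    show "((\<lambda>x. f x * g x) has_real_derivative f x * deriv g x + deriv f x * g x) (at x)"
      if "x \<in> S" for x
      using D(1,4)[OF that] by (auto intro!: derivative_eq_intros)
  qed (intro diff_upto_add assms(1) Suc.IH D)
qed simp

lemma diff_upto_inverse:
  assumes "open S" "diff_upto k S f" "\<And>x. x \<in> S \<Longrightarrow> f x \<noteq> 0"
  shows "diff_upto k S (\<lambda>x. inverse (f x))"
  using assms(2)
proof (induction k)
  case (Suc k)
  note D = diff_upto_SucD[OF Suc.prems(1)]
  have m: "diff_upto k S (\<lambda>x. - 1)"
    using smooth_on_const[OF assms(1)] smooth_on_iff_diff_upto by blast
  \<comment> \<open>The derivative is written as a product with factors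
    \<open>inverse (f x)\<close>, so that the induction hypothesis and the product rule cover
    it.\<close>
  show ?case
  proof (rule diff_upto_SucI[OF assms(1), where f' = "\<lambda>x. (- 1) * (deriv f x * (inverse (f x) * inverse (f x)))"])
    show "((\<lambda>x. inverse (f x)) has_real_derivative
        (- 1) * (deriv f x * (inverse (f x) * inverse (f x)))) (at x)" if "x \<in> S" for x
      using D(1)[OF that] assms(3)[OF that] by (auto intro!: derivative_eq_intros)
  qed (intro diff_upto_mult assms(1) Suc.IH D m)
qed simp

lemma diff_upto_compose:
  assumes "open S" "open U" "diff_upto k S f" "diff_upto k U g" "\<And>x. x \<in> S \<Longrightarrow> f x \<in> U"
  shows "diff_upto k S (\<lambda>x. g (f x))"
  using assms(3,4)
proof (induction k arbitrary: g)
  case (Suc k)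
  note D = diff_upto_SucD[OF Suc.prems(1)] diff_upto_SucD[OF Suc.prems(2)]
  show ?case
  proof (rule diff_upto_SucI[OF assms(1), where f' = "\<lambda>x. deriv g (f x) * deriv f x"])
    show "((\<lambda>x. g (f x)) has_real_derivative deriv g (f x) * deriv f x) (at x)" if "x \<in> S" for x
      using DERIV_chain2[of g, OF D(4)[OF assms(5)[OF that]] D(1)[OF that]] .
  qed (rule diff_upto_mult[OF assms(1) Suc.IH[OF D(3,5)] D(2)])
qed simp

lemma smooth_on_add: "smooth_on S f \<Longrightarrow> smooth_on S g \<Longrightarrow> smooth_on S (\<lambda>x. f x + g x)"
  unfolding smooth_on_iff_diff_upto using diff_upto_add by blast

lemma smooth_on_mult: "smooth_on S f \<Longrightarrow> smooth_on S g \<Longrightarrow> smooth_on S (\<lambda>x. f x * g x)"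
  unfolding smooth_on_iff_diff_upto using diff_upto_mult by blast

lemma smooth_on_cmult: "smooth_on S f \<Longrightarrow> smooth_on S (\<lambda>x. c * f x)"
  by (intro smooth_on_mult smooth_on_const) (auto simp: smooth_on_def)

lemma smooth_on_diff: "smooth_on S f \<Longrightarrow> smooth_on S g \<Longrightarrow> smooth_on S (\<lambda>x. f x - g x)"
  using smooth_on_add[OF _ smooth_on_cmult[of S g "-1"]] by simp

lemma smooth_on_sum:
  assumes "open S" "\<And>i. i \<in> A \<Longrightarrow> smooth_on S (f i)"
  shows "smooth_on S (\<lambda>x. \<Sum>i\<in>A. f i x)"
  using assms(2)
  by (induction A rule: infinite_finite_induct) (auto intro: smooth_on_add smooth_on_const assms(1))

lemma smooth_on_power: "smooth_on S f \<Longrightarrow> smooth_on S (\<lambda>x. f x ^ n)"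
proof (induction n)
  case 0
  then show ?case
    using smooth_on_const[of S 1] by (simp add: smooth_on_def)
qed (simp add: smooth_on_mult)

lemma smooth_on_divide:
  "smooth_on S f \<Longrightarrow> smooth_on S g \<Longrightarrow> (\<And>x. x \<in> S \<Longrightarrow> g x \<noteq> 0) \<Longrightarrow> smooth_on S (\<lambda>x. f x / g x)"
  unfolding divide_inverse smooth_on_iff_diff_upto
  using diff_upto_mult diff_upto_inverse by blast

lemma smooth_on_compose:
  "smooth_on S f \<Longrightarrow> smooth_on U g \<Longrightarrow> (\<And>x. x \<in> S \<Longrightarrow> f x \<in> U) \<Longrightarrow> smooth_on S (\<lambda>x. g (f x))"
  unfolding smooth_on_iff_diff_upto using diff_upto_compose by blast

lemma higher_real_deriv_diff:
  assumes "open S" "diff_upto k S f" "diff_upto k S g" "x \<in> S"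
  shows "(deriv ^^ k) (\<lambda>x. f x - g x) x = (deriv ^^ k) f x - (deriv ^^ k) g x"
  using assms(2-4)
proof (induction k arbitrary: f g x)
  case (Suc k)
  note D = diff_upto_SucD[OF Suc.prems(1)] diff_upto_SucD[OF Suc.prems(2)]
  have "deriv (\<lambda>x. f x - g x) y = deriv f y - deriv g y" if "y \<in> S" for y
    using D(1,4)[OF that] by (intro DERIV_imp_deriv derivative_intros)
  then have "(deriv ^^ k) (deriv (\<lambda>x. f x - g x)) x = (deriv ^^ k) (\<lambda>x. deriv f x - deriv g x) x"
    by (intro higher_deriv_cong_open[OF assms(1) _ Suc.prems(3)])
  with Suc.IH[OF D(2,5) Suc.prems(3)] show ?case
    by (simp add: funpow_swap1)
qed simp

lemma deriv_shift: "deriv f (x + c) = deriv (\<lambda>x. f (x + c)) (x :: real)"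
  unfolding deriv_def DERIV_shift ..

lemma higher_deriv_shift: "(deriv ^^ n) (\<lambda>x. f (x + c)) x = (deriv ^^ n) f (x + (c :: real))"
proof (induction n arbitrary: x)
  case (Suc n)
  then have "(deriv ^^ n) (\<lambda>x. f (x + c)) = (\<lambda>x. (deriv ^^ n) f (x + c))"
    by blast
  then show ?case
    by (simp add: deriv_shift)
qed simp

text \<open>Hadamard's formula: the divided difference is the integral over s in [0,1] of u'(\<tau>
  + s (x - \<tau>)). Differentiating under the integral sign gives smoothness across \<tau>, and at
  x = \<tau> the k-th derivative is \<open>(deriv ^^ Suc k) u \<tau>\<close> times the integral of
  s^k.\<close>

lemma smooth_on_divided_diff:
  assumes u: "smooth_on {\<alpha><..<\<beta>} u" and \<tau>: "\<tau> \<in> {\<alpha><..<\<beta>}"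
  shows "smooth_on {\<alpha><..<\<beta>} (\<lambda>x. divided_diff u x \<tau>)"
    "(deriv ^^ k) (\<lambda>x. divided_diff u x \<tau>) \<tau> = (deriv ^^ Suc k) u \<tau> / real (Suc k)"
proof -
  let ?S = "{\<alpha><..<\<beta>}"
  \<comment> \<open>\<open>f k\<close> is the k-th x-derivative of Hadamard's integrand and
    \<open>w k\<close> its integral, so \<open>w\<close> is the derivative family for
    \<open>smooth_onI_family\<close>.\<close>
  define f where "f k x s = s ^ k * (deriv ^^ Suc k) u (\<tau> + s * (x - \<tau>))" for k and x s :: real
  define w where "w k x = integral (cbox 0 1) (f k x)" for k x
  have mem: "\<tau> + s * (x - \<tau>) \<in> ?S" if "x \<in> ?S" "s \<in> cbox 0 1" for x s
  proof -
    have "(1 - s) *\<^sub>R \<tau> + s *\<^sub>R x \<in> ?S"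
      using that \<tau> by (intro convexD_alt) (auto simp: convex_real_interval)
    then show ?thesis
      by (simp add: algebra_simps)
  qed
  have cont: "continuous_on (?S \<times> cbox 0 1) (\<lambda>(x, s). f k x s)" for k
    unfolding f_def split_beta
    by (intro continuous_intros continuous_on_compose2[OF smooth_on_continuous_on[OF u]])
      (auto simp: mem[simplified])
  have d: "((\<lambda>x. f k x s) has_real_derivative f (Suc k) x s) (at x)" if "x \<in> ?S" "s \<in> cbox 0 1" for k x s
  proof -
    have "((\<lambda>x. \<tau> + s * (x - \<tau>)) has_real_derivative s) (at x)"
      by (auto intro!: derivative_eq_intros)
    from DERIV_chain2[OF smooth_on_has_deriv[OF u mem[OF that], of "Suc k"] this]
    have "((\<lambda>x. (deriv ^^ Suc k) u (\<tau> + s * (x - \<tau>))) has_real_derivative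
        (deriv ^^ Suc (Suc k)) u (\<tau> + s * (x - \<tau>)) * s) (at x)" .
    from DERIV_cmult[OF this, of "s ^ k"] show ?thesis
      unfolding f_def by (simp add: mult_ac)
  qed
  have int: "f k x integrable_on cbox 0 1" if "x \<in> ?S" for k x
  proof (rule integrable_continuous)
    show "continuous_on (cbox 0 1) (f k x)"
      unfolding f_def using that
      by (intro continuous_intros continuous_on_compose2[OF smooth_on_continuous_on[OF u]])
        (auto simp: mem[simplified])
  qed
  have "(w k has_real_derivative w (Suc k) x) (at x within ?S)" if "x \<in> ?S" for k x
    unfolding w_def
    by (rule leibniz_rule_field_derivative[where fx = "f (Suc k)"])
      (use int that cont d convex_real_interval in \<open>auto intro: has_field_derivative_at_within\<close>)
  then have dw: "(w k has_real_derivative w (Suc k) x) (at x)" if "x \<in> ?S" for k x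
    using that at_within_open[OF that open_greaterThanLessThan] by metis
  have "w 0 x = divided_diff u x \<tau>" if "x \<in> ?S" for x
  proof (cases "x = \<tau>")
    case False
    have "((\<lambda>s. deriv u (\<tau> + s * (x - \<tau>))) has_integral
        (u (\<tau> + 1 * (x - \<tau>)) / (x - \<tau>) - u (\<tau> + 0 * (x - \<tau>)) / (x - \<tau>))) {0..1}"
    proof (rule fundamental_theorem_of_calculus)
      fix s :: real assume "s \<in> {0..1}"
      then have "((\<lambda>s. u (\<tau> + s * (x - \<tau>))) has_real_derivative
        deriv u (\<tau> + s * (x - \<tau>)) * (x - \<tau>)) (at s)"
        using smooth_on_has_deriv[OF u mem[OF that], of s 0]
        by (intro DERIV_chain2[where f = u]) (auto intro!: derivative_eq_intros)
      from DERIV_cdivide[OF this, of "x - \<tau>"] False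
      show "((\<lambda>s. u (\<tau> + s * (x - \<tau>)) / (x - \<tau>)) has_vector_derivative
          deriv u (\<tau> + s * (x - \<tau>))) (at s within {0..1})"
        by (simp add: has_real_derivative_iff_has_vector_derivative[symmetric]
            has_field_derivative_at_within)
    qed simp
    with False show ?thesis
      by (simp add: w_def f_def[abs_def] divided_diff_def integral_unique diff_divide_distrib)
  qed (simp add: w_def f_def[abs_def] divided_diff_def)
  note cong = this
  have fam: "smooth_on ?S (w 0)" "(deriv ^^ k) (w 0) \<tau> = w k \<tau>"
    by (rule smooth_onI_family[of ?S w]; use dw \<tau> in simp)+
  have "smooth_on ?S (w 0) \<longleftrightarrow> smooth_on ?S (\<lambda>x. divided_diff u x \<tau>)"
    by (rule smooth_on_cong) (rule cong)
  then show "smooth_on ?S (\<lambda>x. divided_diff u x \<tau>)"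
    using fam(1) by blast
  have "(deriv ^^ k) (w 0) \<tau> = (deriv ^^ k) (\<lambda>x. divided_diff u x \<tau>) \<tau>"
    by (rule higher_deriv_cong_open[OF open_greaterThanLessThan cong \<tau>])
  then have "(deriv ^^ k) (\<lambda>x. divided_diff u x \<tau>) \<tau> = w k \<tau>"
    using fam(2) by simp
  also have "\<dots> = integral {0..1} (\<lambda>s. s ^ k) * (deriv ^^ Suc k) u \<tau>"
    by (simp add: w_def f_def[abs_def])
  also have "integral {0..1} (\<lambda>s. s ^ k) = 1 / real (Suc k)"
  proof -
    have "((\<lambda>s. s ^ k) has_integral (1 ^ Suc k / real (Suc k) - 0 ^ Suc k / real (Suc k))) {0..1}"
    proof (rule fundamental_theorem_of_calculus)
      fix s :: real
      show "((\<lambda>s. s ^ Suc k / real (Suc k)) has_vector_derivative s ^ k) (at s within {0..1})"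
        using DERIV_cdivide[OF DERIV_pow[of "Suc k" s], of "real (Suc k)"]
        by (simp add: has_real_derivative_iff_has_vector_derivative[symmetric]
            has_field_derivative_at_within del: of_nat_Suc power_Suc)
    qed simp
    then show ?thesis
      by (simp add: integral_unique)
  qed
  finally show "(deriv ^^ k) (\<lambda>x. divided_diff u x \<tau>) \<tau> = (deriv ^^ Suc k) u \<tau> / real (Suc k)"
    by simp
qed

section \<open>The Riemann zeta function at the natural numbers\<close>

text \<open>The error of the trapezoidal rule for \<open>x\<^bsup>-z\<^esup>\<close> on \<open>[k + 1, k + 2]\<close> is \<open>O(k\<^bsup>- Re z - 2\<^esup>)\<close>, so the
  series of these errors continues \<open>\<zeta>\<close> to \<open>Re z > -1\<close>, which includes \<open>0\<close>.\<close>

definition zeta_trapezoid_term :: "nat \<Rightarrow> complex \<Rightarrow> complex" where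
  "zeta_trapezoid_term k z =
     (of_nat (Suc k) powr (- z) + of_nat (Suc (Suc k)) powr (- z)) / 2
     - (of_nat (Suc k) powr (1 - z) - of_nat (Suc (Suc k)) powr (1 - z)) / (z - 1)"

text \<open>Averaging neighbouring terms counts the first term of the Dirichlet series only by half,
  which \<open>1 / 2\<close> repairs; \<open>1 / (z - 1)\<close> is the integral of
  \<open>x powr (- z)\<close> over x \<ge> 1 when Re z > 1.\<close>

definition zeta_cont :: "complex \<Rightarrow> complex" where
  "zeta_cont z = (\<Sum>k. zeta_trapezoid_term k z) + 1 / 2 + 1 / (z - 1)"

text \<open>\<open>D u\<close> is the trapezoidal error on [K, K + u], with first and second
  derivatives \<open>D1\<close> and \<open>D2\<close>. Both \<open>D\<close> and \<open>D1\<close>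
  vanish at 0, so the explicit bound on \<open>D2\<close> is carried back to \<open>D 1\<close> by
  applying the mean value inequality twice.\<close>

lemma norm_zeta_trapezoid_term_le:
  assumes z: "Re z > -1" "z \<noteq> 1"
  shows "norm (zeta_trapezoid_term k z) \<le> norm z * norm (z + 1) * real (Suc k) powr (- Re z - 2)"
proof -
  define K :: complex where "K = of_nat (Suc k)"
  define B where "B = norm z * norm (z + 1) / 2 * real (Suc k) powr (- Re z - 2)"
  define D where "D u = u * (K powr (-z) + (K + u) powr (-z)) / 2
      - ((K + u) powr (1 - z) - K powr (1 - z)) / (1 - z)" for u
  define D1 where "D1 u = (K powr (-z) - (K + u) powr (-z)) / 2
      - z * u * (K + u) powr (-z - 1) / 2" for u
  define D2 where "D2 u = z * (z + 1) * u * (K + u) powr (-z - 2) / 2" for u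
  \<comment> \<open>The real unit interval as a complex segment: the values are complex, so a norm
    bound over a convex set takes the place of the mean value theorem.\<close>
  define S where "S = closed_segment 0 (1::complex)"
  have S: "\<exists>v\<in>{0..1}. u = of_real v" if "u \<in> S" for u
    using that by (auto simp: S_def closed_segment_def scaleR_conv_of_real)
  have in_S: "0 \<in> S" "1 \<in> S" "convex S"
    by (auto simp: S_def)
  have nz: "K + u \<notin> \<real>\<^sub>\<le>\<^sub>0" if "u \<in> S" for u
    using S[OF that] unfolding K_def
    by (auto simp: complex_nonpos_Reals_iff)
  have pw: "((\<lambda>u. (K + u) powr s) has_field_derivative s * (K + u) powr s') (at u within S)"
    if "u \<in> S" "s' = s - 1" for u s s'
  proof -
    have "((\<lambda>u. K + u) has_field_derivative 1) (at u within S)"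
      by (auto intro!: derivative_eq_intros)
    from DERIV_chain2[OF has_field_derivative_powr[OF nz[OF that(1)], of s] this] that(2)
    show ?thesis
      by simp
  qed
  have dD: "(D has_field_derivative D1 u) (at u within S)" if "u \<in> S" for u
  proof -
    note a = pw[OF that, of "-z - 1" "-z"] and b = pw[OF that, of "-z" "1 - z"]
    have "(D has_field_derivative (1 * (K powr (-z) + (K + u) powr (-z))
        + (0 + - z * (K + u) powr (-z - 1)) * u) / 2
        - ((1 - z) * (K + u) powr (-z) - 0) / (1 - z)) (at u within S)"
      unfolding D_def
      by (intro DERIV_diff DERIV_cdivide DERIV_mult DERIV_add DERIV_ident DERIV_const a b) auto
    moreover have "((1 - z) * (K + u) powr (-z) - 0) / (1 - z) = (K + u) powr (-z)"
      using z by simp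
    ultimately show ?thesis
      by (elim DERIV_cong) (simp add: D1_def field_simps)
  qed
  have dD1: "(D1 has_field_derivative D2 u) (at u within S)" if "u \<in> S" for u
  proof -
    note a = pw[OF that, of "-z - 1" "-z"] and b = pw[OF that, of "-z - 2" "-z - 1"]
    have "(D1 has_field_derivative (0 - (- z * (K + u) powr (-z - 1))) / 2
        - (z * 1 * (K + u) powr (-z - 1) + ((-z - 1) * (K + u) powr (-z - 2)) * (z * u)) / 2)
        (at u within S)"
      unfolding D1_def
      by (intro DERIV_diff DERIV_cdivide DERIV_mult DERIV_cmult DERIV_ident DERIV_const a b) auto
    then show ?thesis
      by (elim DERIV_cong) (simp add: D2_def field_simps)
  qed
  have D2: "norm (D2 u) \<le> B" if uS: "u \<in> S" for u
  proof -
    obtain v where v: "v \<in> {0..1}" "u = of_real v"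
      using S[OF uS] by blast
    have "K + u = of_real (real (Suc k) + v)"
      by (simp add: K_def v)
    then have "norm ((K + u) powr (- z - 2)) = (real (Suc k) + v) powr (- Re z - 2)"
      using v by (subst norm_powr_real_powr) auto
    also have "\<dots> \<le> real (Suc k) powr (- Re z - 2)"
      using v z by (intro powr_mono2') auto
    finally have *: "norm ((K + u) powr (- z - 2)) \<le> real (Suc k) powr (- Re z - 2)" .
    have "norm u * norm ((K + u) powr (- z - 2)) \<le> 1 * real (Suc k) powr (- Re z - 2)"
      using v by (intro mult_mono *) auto
    then have "norm z * norm (z + 1) / 2 * (norm u * norm ((K + u) powr (- z - 2)))
        \<le> norm z * norm (z + 1) / 2 * (1 * real (Suc k) powr (- Re z - 2))"
      by (intro mult_left_mono) auto
    then show ?thesis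
      by (simp add: D2_def B_def norm_mult norm_divide mult_ac)
  qed
  have B0: "0 \<le> B"
    by (simp add: B_def)
  have D1: "norm (D1 u) \<le> B" if "u \<in> S" for u
  proof -
    have "norm (D1 u - D1 0) \<le> B * norm (u - 0)"
      by (rule field_differentiable_bound[OF in_S(3) dD1 D2 that in_S(1)])
    also have "\<dots> \<le> B * 1"
      using S[OF that] B0 by (intro mult_left_mono) auto
    finally show ?thesis
      by (simp add: D1_def)
  qed
  have "norm (D 1 - D 0) \<le> B * norm (1 - 0 :: complex)"
    by (rule field_differentiable_bound[OF in_S(3) dD D1 in_S(2,1)])
  moreover have "D 1 = zeta_trapezoid_term k z" "D 0 = 0"
    using z by (auto simp: D_def zeta_trapezoid_term_def K_def field_simps)
  moreover have "B \<le> 2 * B"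
    using B0 by simp
  ultimately have "norm (zeta_trapezoid_term k z) \<le> 2 * B"
    by simp
  then show ?thesis
    by (simp add: B_def)
qed

text \<open>On a closed disc that keeps a distance from the line Re z = -1, the exponent - Re z - 2
  stays below a constant less than -1 and the factors in z stay bounded, so the Weierstrass test
  applies.\<close>

lemma zeta_trapezoid_uniform_limit:
  assumes "Re x > -1" "x \<noteq> 1"
  shows "\<exists>d>0. cball x d \<subseteq> {z. Re z > -1} - {1} \<and>
    uniform_limit (cball x d) (\<lambda>n z. \<Sum>k<n. zeta_trapezoid_term k z)
      (\<lambda>z. \<Sum>k. zeta_trapezoid_term k z) sequentially"
proof -
  define d where "d = min ((Re x + 1) / 2) (dist x 1 / 2)"
  have d: "d > 0" "d < Re x + 1" "d < dist x 1"
  proof -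
    have "Re x + 1 > 0" "dist x 1 > 0"
      using assms by auto
    then show "d > 0" "d < Re x + 1" "d < dist x 1"
      unfolding d_def by (auto simp: min_less_iff_disj min_def not_le)
  qed
  have ball: "Re z \<ge> Re x - d" "z \<noteq> 1" "norm z \<le> norm x + d" if "z \<in> cball x d" for z
  proof -
    have *: "norm (x - z) \<le> d"
      using that by (simp add: dist_norm)
    show "Re z \<ge> Re x - d"
      using abs_Re_le_cmod[of "x - z"] * by simp
    show "z \<noteq> 1"
      using that d(3) by auto
    show "norm z \<le> norm x + d"
      using norm_triangle_ineq2[of z x] * by (simp add: norm_minus_commute)
  qed
  define C where "C = (norm x + d) * (norm x + d + 1)"
  have "uniform_limit (cball x d) (\<lambda>n z. \<Sum>k<n. zeta_trapezoid_term k z)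
      (\<lambda>z. \<Sum>k. zeta_trapezoid_term k z) sequentially"
  proof (rule Weierstrass_m_test)
    fix k z assume z: "z \<in> cball x d"
    have "norm (zeta_trapezoid_term k z) \<le> norm z * norm (z + 1) * real (Suc k) powr (- Re z - 2)"
      using ball[OF z] d by (intro norm_zeta_trapezoid_term_le) auto
    also have "\<dots> \<le> C * real (Suc k) powr (- (Re x - d) - 2)"
    proof (intro mult_mono)
      show "norm z * norm (z + 1) \<le> C"
        unfolding C_def using ball(3)[OF z] norm_triangle_ineq[of z 1] d(1)
        by (intro mult_mono) auto
      show "real (Suc k) powr (- Re z - 2) \<le> real (Suc k) powr (- (Re x - d) - 2)"
        using ball(1)[OF z] by (intro powr_mono) auto
    qed (use d in \<open>auto simp: C_def\<close>)
    finally show "norm (zeta_trapezoid_term k z) \<le> C * real (Suc k) powr (- (Re x - d) - 2)" .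
  next
    have "summable (\<lambda>k. real k powr (- (Re x - d) - 2))"
      using d by (subst summable_real_powr_iff) auto
    then have "summable (\<lambda>k. real (Suc k) powr (- (Re x - d) - 2))"
      by (subst summable_Suc_iff)
    then show "summable (\<lambda>k. C * real (Suc k) powr (- (Re x - d) - 2))"
      by (rule summable_mult)
  qed
  moreover have "cball x d \<subseteq> {z. Re z > -1} - {1}"
    using ball d by force
  ultimately show ?thesis
    using d(1) by blast
qed

lemma holomorphic_zeta_cont: "zeta_cont holomorphic_on ({z. Re z > -1} - {1})"
proof -
  have "(\<lambda>z. \<Sum>k. zeta_trapezoid_term k z) holomorphic_on ({z. Re z > -1} - {1})"
  proof (rule holomorphic_uniform_sequence)
    show "open ({z. Re z > -1} - {1})"
      by (intro open_Diff open_halfspace_Re_gt) auto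
    show "(\<lambda>z. \<Sum>k<n. zeta_trapezoid_term k z) holomorphic_on ({z. Re z > -1} - {1})" for n
      unfolding zeta_trapezoid_term_def by (intro holomorphic_intros) auto
  qed (use zeta_trapezoid_uniform_limit in auto)
  then show ?thesis
    unfolding zeta_cont_def[abs_def] by (intro holomorphic_intros) auto
qed

lemma sums_zeta_cont:
  assumes z: "Re z > 1"
  shows "(\<lambda>k. of_nat (Suc k) powr (- z)) sums zeta_cont z"
proof -
  have z1: "z \<noteq> 1" "Re z > -1"
    using z by auto
  obtain d where "d > 0" "uniform_limit (cball z d) (\<lambda>n z. \<Sum>k<n. zeta_trapezoid_term k z)
      (\<lambda>z. \<Sum>k. zeta_trapezoid_term k z) sequentially"
    using zeta_trapezoid_uniform_limit[OF z1(2,1)] by blast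
  then have lim: "(\<lambda>n. \<Sum>k<n. zeta_trapezoid_term k z) \<longlonglongrightarrow> (\<Sum>k. zeta_trapezoid_term k z)"
    by (intro tendsto_uniform_limitI[where x = z]) auto
  \<comment> \<open>The averages and the integrals both telescope. The two boundary terms tend to 0
    because Re z > 1.\<close>
  have partial: "(\<Sum>k<n. of_nat (Suc k) powr (- z)) = (\<Sum>k<n. zeta_trapezoid_term k z) + 1 / 2 + 1 / (z - 1)
      - of_nat (Suc n) powr (- z) / 2 - of_nat (Suc n) powr (1 - z) / (z - 1)" for n
  proof (induction n)
    case (Suc n)
    then show ?case
      by (simp add: zeta_trapezoid_term_def diff_divide_distrib add_divide_distrib del: of_nat_Suc)
  qed simp
  have f: "filterlim (\<lambda>n. Suc n) at_top sequentially"
    by (rule filterlim_Suc)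
  have "(\<lambda>n. of_nat (Suc n) powr (- z)) \<longlonglongrightarrow> (0 :: complex)"
    "(\<lambda>n. of_nat (Suc n) powr (1 - z)) \<longlonglongrightarrow> (0 :: complex)"
    using z by (auto intro!: tendsto_neg_powr_complex_of_nat f simp del: of_nat_Suc)
  then have "(\<lambda>n. (\<Sum>k<n. zeta_trapezoid_term k z) + 1 / 2 + 1 / (z - 1)
      - of_nat (Suc n) powr (- z) / 2 - of_nat (Suc n) powr (1 - z) / (z - 1))
      \<longlonglongrightarrow> (\<Sum>k. zeta_trapezoid_term k z) + 1 / 2 + 1 / (z - 1) - 0 / 2 - 0 / (z - 1)"
    using z1 by (intro tendsto_intros lim) auto
  then show ?thesis
    unfolding sums_def partial by (simp add: zeta_cont_def)
qed

lemma riemann_zeta_eq_zeta_cont: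
  assumes "Re s > -1" "s \<noteq> 1"
  shows "riemann_zeta s = zeta_cont s"
  unfolding riemann_zeta_def
proof (rule the_equality)
  show "\<exists>\<sigma> f. \<sigma> < Re s \<and> f holomorphic_on {z. \<sigma> < Re z} - {1} \<and>
      (\<forall>z. 1 < Re z \<longrightarrow> (\<lambda>k. of_nat (Suc k) powr - z) sums f z) \<and> zeta_cont s = f s"
    using assms holomorphic_zeta_cont sums_zeta_cont by blast
next
  fix w
  assume "\<exists>\<sigma> f. \<sigma> < Re s \<and> f holomorphic_on {z. \<sigma> < Re z} - {1} \<and>
      (\<forall>z. 1 < Re z \<longrightarrow> (\<lambda>k. of_nat (Suc k) powr - z) sums f z) \<and> w = f s"
  then obtain \<sigma> f where f: "\<sigma> < Re s" "f holomorphic_on {z. \<sigma> < Re z} - {1}"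
    "\<And>z. 1 < Re z \<Longrightarrow> (\<lambda>k. of_nat (Suc k) powr - z) sums f z" "w = f s"
    by blast
  \<comment> \<open>A half-plane on which both continuations are defined. It stays connected after
    removal of the pole and contains s, so the identity theorem compares them there.\<close>
  define \<rho> where "\<rho> = max \<sigma> (-1)"
  have "f s = zeta_cont s"
  proof (rule analytic_continuation_open[where f = f and g = zeta_cont and z = s and s = "{z. Re z > max \<rho> 1}" and s' = "{z. Re z > \<rho>} - {1}"])
    show "connected ({z. Re z > \<rho>} - {1})"
      by (intro connected_open_delete open_halfspace_Re_gt convex_connected convex_halfspace_Re_gt) auto
    show "{z. max \<rho> 1 < Re z} \<noteq> {}"
    proof -
      have "complex_of_real (\<bar>\<rho>\<bar> + 2) \<in> {z. max \<rho> 1 < Re z}"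
        by auto
      then show ?thesis
        by blast
    qed
    show "f holomorphic_on {z. \<rho> < Re z} - {1}"
      using f(2) by (rule holomorphic_on_subset) (auto simp: \<rho>_def)
    show "zeta_cont holomorphic_on {z. \<rho> < Re z} - {1}"
      using holomorphic_zeta_cont by (rule holomorphic_on_subset) (auto simp: \<rho>_def)
    show "f z = zeta_cont z" if "z \<in> {z. max \<rho> 1 < Re z}" for z
      using that f(3)[of z] sums_zeta_cont[of z] sums_unique2 by auto
  qed (use f(1) assms in \<open>auto simp: \<rho>_def intro!: open_Diff open_Collect_less open_Collect_conj continuous_intros\<close>)
  then show "w = zeta_cont s"
    using f(4) by simp
qed

text \<open>The trapezoidal rule is exact for the constant function, so every error term vanishes at
  z = 0 and only 1/2 + 1/(0 - 1) remains.\<close>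

lemma zeta_nat_0: "zeta_nat 0 = - 1 / 2"
proof -
  have "zeta_trapezoid_term k 0 = 0" for k
    using of_nat_eq_0_iff[of "Suc k", where 'a = complex] of_nat_eq_0_iff[of "Suc (Suc k)", where 'a = complex]
    by (simp add: zeta_trapezoid_term_def del: of_nat_eq_0_iff)
  then show ?thesis
    by (simp add: zeta_nat_def riemann_zeta_eq_zeta_cont zeta_cont_def)
qed

lemma sums_zeta_nat:
  assumes "k \<ge> 2"
  shows "(\<lambda>j. 1 / real (Suc j) ^ k) sums zeta_nat k"
proof -
  have "(\<lambda>j. of_nat (Suc j) powr (- of_nat k)) sums zeta_cont (of_nat k)"
    using assms by (intro sums_zeta_cont) auto
  then have "(\<lambda>j. Re (of_nat (Suc j) powr (- of_nat k))) sums Re (zeta_cont (of_nat k))"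
    by (rule sums_Re)
  moreover have "Re (of_nat (Suc j) powr (- of_nat k)) = 1 / real (Suc j) ^ k" for j
  proof -
    have "(of_nat (Suc j) :: complex) powr (- of_nat k) = of_real (1 / real (Suc j) ^ k)"
      by (simp add: powr_minus powr_nat' divide_inverse del: of_nat_Suc)
    then show ?thesis
      by (simp only: Re_complex_of_real)
  qed
  moreover have "(of_nat k :: complex) \<noteq> 1"
    using assms of_nat_eq_iff[of k 1, where 'a = complex] by simp
  ultimately show ?thesis
    by (simp add: zeta_nat_def riemann_zeta_eq_zeta_cont del: of_nat_Suc)
qed

section \<open>The rectangle rule for periodic functions\<close>

text \<open>Cells with the same index modulo a fixed \<open>M \<approx> 2T/\<delta>\<close> have total length below \<open>\<delta>\<close>, so
  absolute continuity bounds each of the \<open>M\<close> partial sums by 1, uniformly in \<open>n\<close>.\<close>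

lemma abs_continuous_on_sum_cells_le:
  assumes f: "abs_continuous_on {c..d} f" and T: "T > 0"
  obtains V :: real where "V \<ge> 0"
    "\<forall>\<^sub>F n in sequentially. \<forall>J y. J \<subseteq> {..<n} \<longrightarrow>
      (\<forall>j\<in>J. c \<le> \<tau> + real j * (T / real n) \<and> y j \<le> d \<and>
         y j \<in> {\<tau> + real j * (T / real n)..\<tau> + real (Suc j) * (T / real n)}) \<longrightarrow>
      (\<Sum>j\<in>J. \<bar>f (y j) - f (\<tau> + real j * (T / real n))\<bar>) \<le> V"
proof -
  obtain \<delta> where \<delta>: "\<delta> > 0"
    and ac: "\<And>\<D>. \<D> division_of \<Union>\<D> \<Longrightarrow> \<Union>\<D> \<subseteq> {c..d} \<Longrightarrow> (\<Sum>K\<in>\<D>. Sup K - Inf K) < \<delta> \<Longrightarrow>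
        (\<Sum>K\<in>\<D>. \<bar>f (Sup K) - f (Inf K)\<bar>) < 1"
  proof -
    have "\<exists>\<delta>>0. \<forall>\<D>. \<D> division_of \<Union>\<D> \<and> \<Union>\<D> \<subseteq> {c..d} \<and> (\<Sum>K\<in>\<D>. Sup K - Inf K) < \<delta> \<longrightarrow>
        (\<Sum>K\<in>\<D>. \<bar>f (Sup K) - f (Inf K)\<bar>) < 1"
      using f unfolding abs_continuous_on_def by (rule allE[of _ 1]) simp
    then show thesis
      using that by blast
  qed
  \<comment> \<open>One half of \<delta> pays for the average share T / M of a residue class, the
    other half for the one extra cell that a class may contain; the latter is why n must exceed T /
    (\<delta> / 2).\<close>
  obtain M :: nat where M: "T / (\<delta> / 2) < real M"
    using reals_Archimedean2 by blast
  have M0: "M > 0"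
    using M T \<delta> by (cases M) (auto simp: field_simps)
  have MT: "T / real M < \<delta> / 2"
    using M M0 \<delta> by (simp add: field_simps)
  show thesis
  proof (rule that[of "real M"])
    have "\<forall>\<^sub>F n in sequentially. real n > T / (\<delta> / 2)"
      by (rule eventually_compose_filterlim[OF eventually_gt_at_top filterlim_real_sequentially])
    then show "\<forall>\<^sub>F n in sequentially. \<forall>J y. J \<subseteq> {..<n} \<longrightarrow>
      (\<forall>j\<in>J. c \<le> \<tau> + real j * (T / real n) \<and> y j \<le> d \<and>
         y j \<in> {\<tau> + real j * (T / real n)..\<tau> + real (Suc j) * (T / real n)}) \<longrightarrow>
      (\<Sum>j\<in>J. \<bar>f (y j) - f (\<tau> + real j * (T / real n))\<bar>) \<le> real M"
      using eventually_gt_at_top[of 0]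
    proof (eventually_elim, intro allI impI)
      fix n :: nat and J and y :: "nat \<Rightarrow> real"
      assume n: "real n > T / (\<delta> / 2)" "n > 0" and J: "J \<subseteq> {..<n}"
      define h where "h = T / real n"
      define x where "x j = \<tau> + real j * h" for j
      assume "\<forall>j\<in>J. c \<le> \<tau> + real j * (T / real n) \<and> y j \<le> d \<and>
         y j \<in> {\<tau> + real j * (T / real n)..\<tau> + real (Suc j) * (T / real n)}"
      then have xy: "c \<le> x j" "y j \<le> d" "x j \<le> y j" "y j \<le> x (Suc j)" if "j \<in> J" for j
        using that by (auto simp: x_def h_def)
      have h: "h > 0" "h < \<delta> / 2"
        using n T \<delta> by (auto simp: h_def field_simps)
      have x_mono: "x i \<le> x j" if "i \<le> j" for i j
        using that h by (simp add: x_def)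
      have x_inj: "x i = x j \<Longrightarrow> i = j" for i j
        using h by (simp add: x_def)
      have residue: "(\<Sum>j | j \<in> J \<and> j mod M = r. \<bar>f (y j) - f (x j)\<bar>) \<le> 1" for r
      proof -
        define A where "A = {j \<in> J. j mod M = r}"
        have finA: "finite A"
          using J finite_subset unfolding A_def by fastforce
        let ?I = "\<lambda>j. {x j..y j}"
        have AJ: "j \<in> J" if "j \<in> A" for j
          using that by (simp add: A_def)
        have ne: "Inf (?I j) = x j" "Sup (?I j) = y j" if "j \<in> A" for j
          using xy(3)[OF AJ[OF that]] by auto
        \<comment> \<open>Intervals may shrink to points when \<open>y j = x j\<close>; distinct
          left endpoints still tell them apart.\<close>
        have inj: "inj_on ?I A"
          by (rule inj_onI) (metis ne(1) x_inj)
        have disj: "interior (?I i) \<inter> interior (?I j) = {}" if "i \<in> A" "j \<in> A" "i < j" for i j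
          using xy(4)[OF AJ[OF that(1)]] x_mono[of "Suc i" j] that(3) by auto
        have "?I ` A division_of \<Union>(?I ` A)"
          unfolding division_of_def
        proof (intro conjI ballI impI)
          fix K assume "K \<in> ?I ` A"
          then show "K \<noteq> {}" "\<exists>a b. K = cbox a b"
            using xy(3) AJ by (fastforce, auto)
        next
          fix K1 K2 assume "K1 \<in> ?I ` A" "K2 \<in> ?I ` A" "K1 \<noteq> K2"
          then obtain i j where ij: "i \<in> A" "j \<in> A" "i \<noteq> j" "K1 = ?I i" "K2 = ?I j"
            by blast
          then show "interior K1 \<inter> interior K2 = {}"
            using disj[of i j] disj[of j i] by (metis inf_commute linorder_neqE_nat)
        qed (use finA in auto)
        moreover have "\<Union>(?I ` A) \<subseteq> {c..d}"
          using xy AJ by fastforce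
        moreover have "(\<Sum>K\<in>?I ` A. Sup K - Inf K) < \<delta>"
        proof -
          have "(\<Sum>K\<in>?I ` A. Sup K - Inf K) = (\<Sum>j\<in>A. y j - x j)"
            by (subst sum.reindex[OF inj]) (auto intro!: sum.cong simp: xy AJ)
          also have "\<dots> \<le> (\<Sum>j\<in>A. h)"
            using xy(4)[OF AJ] by (intro sum_mono) (simp add: x_def algebra_simps)
          also have "\<dots> = real (card A) * h"
            by simp
          \<comment> \<open>Within a residue class modulo M an index is determined by its quotient,
            and quotients of indices below n are at most n div M.\<close>
          also have "card A \<le> card {..n div M}"
          proof (rule card_inj_on_le[of "\<lambda>j. j div M"])
            show "inj_on (\<lambda>j. j div M) A"
              by (rule inj_onI) (metis (mono_tags, lifting) A_def mem_Collect_eq mult_div_mod_eq)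
            show "(\<lambda>j. j div M) ` A \<subseteq> {..n div M}"
              using J by (auto simp: A_def intro!: div_le_mono)
          qed simp
          then have "real (card A) * h \<le> (real (n div M) + 1) * h"
            using h by (intro mult_right_mono) auto
          also have "\<dots> \<le> (real n / real M + 1) * h"
            using h by (intro mult_right_mono add_right_mono of_nat_div_le_of_nat) auto
          also have "\<dots> = T / real M + h"
            using n by (simp add: h_def field_simps)
          also have "\<dots> < \<delta>"
            using MT h by linarith
          finally show ?thesis .
        qed
        ultimately have "(\<Sum>K\<in>?I ` A. \<bar>f (Sup K) - f (Inf K)\<bar>) < 1"
          by (rule ac)
        also have "(\<Sum>K\<in>?I ` A. \<bar>f (Sup K) - f (Inf K)\<bar>) = (\<Sum>j\<in>A. \<bar>f (y j) - f (x j)\<bar>)"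
          by (subst sum.reindex[OF inj]) (auto intro!: sum.cong simp: xy AJ)
        finally show ?thesis
          by (simp add: A_def)
      qed
      have "(\<Sum>j\<in>J. \<bar>f (y j) - f (x j)\<bar>) = (\<Sum>r<M. \<Sum>j | j \<in> J \<and> j mod M = r. \<bar>f (y j) - f (x j)\<bar>)"
        using J M0 by (intro sum.group[symmetric]) (auto intro: finite_subset)
      also have "\<dots> \<le> (\<Sum>r<M. 1)"
        by (intro sum_mono residue)
      finally show "(\<Sum>j\<in>J. \<bar>f (y j) - f (\<tau> + real j * (T / real n))\<bar>) \<le> real M"
        by (simp add: x_def h_def)
    qed
  qed simp
qed

text \<open>Each short cell either falls under a Lipschitz bound or lies in the window [c, d], where
  f varies like the absolutely continuous g up to a Lipschitz error. The Lipschitz parts add up to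
  at most L T, whatever n is, and the rest is bounded by absolute continuity of g.\<close>

lemma bounded_cell_variation:
  fixes f g :: "real \<Rightarrow> real"
  assumes T: "T > 0" and \<eta>: "\<eta> > 0" and L: "L \<ge> 0"
    and g: "abs_continuous_on {c..d} g"
    and f: "\<And>x y. \<tau> \<le> x \<Longrightarrow> x \<le> y \<Longrightarrow> y \<le> \<tau> + T \<Longrightarrow> y - x < \<eta> \<Longrightarrow>
      \<bar>f y - f x\<bar> \<le> L * (y - x) \<or>
      c \<le> x \<and> y \<le> d \<and> \<bar>f y - f x\<bar> \<le> \<bar>g y - g x\<bar> + L * (y - x)"
  obtains V :: real where
    "\<forall>\<^sub>F n in sequentially. \<forall>y. (\<forall>j<n. y j \<in> {\<tau> + real j * (T / real n)..\<tau> + real (Suc j) * (T / real n)}) \<longrightarrow>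
      (\<Sum>j<n. \<bar>f (y j) - f (\<tau> + real j * (T / real n))\<bar>) \<le> V"
proof -
  obtain V where V: "V \<ge> 0" and ev: "\<forall>\<^sub>F n in sequentially. \<forall>J y. J \<subseteq> {..<n} \<longrightarrow>
      (\<forall>j\<in>J. c \<le> \<tau> + real j * (T / real n) \<and> y j \<le> d \<and>
         y j \<in> {\<tau> + real j * (T / real n)..\<tau> + real (Suc j) * (T / real n)}) \<longrightarrow>
      (\<Sum>j\<in>J. \<bar>g (y j) - g (\<tau> + real j * (T / real n))\<bar>) \<le> V"
    using abs_continuous_on_sum_cells_le[OF g T] .
  have "\<forall>\<^sub>F n in sequentially. real n > T / \<eta>"
    by (rule eventually_compose_filterlim[OF eventually_gt_at_top filterlim_real_sequentially])
  with ev eventually_gt_at_top[of 0]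
  have "\<forall>\<^sub>F n in sequentially. \<forall>y. (\<forall>j<n. y j \<in> {\<tau> + real j * (T / real n)..\<tau> + real (Suc j) * (T / real n)}) \<longrightarrow>
      (\<Sum>j<n. \<bar>f (y j) - f (\<tau> + real j * (T / real n))\<bar>) \<le> V + L * T"
  proof (eventually_elim, intro allI impI)
    fix n :: nat and y :: "nat \<Rightarrow> real"
    define h where "h = T / real n"
    define x where "x j = \<tau> + real j * h" for j
    assume n: "0 < n" "T / \<eta> < real n"
    assume V': "\<forall>J y. J \<subseteq> {..<n} \<longrightarrow>
      (\<forall>j\<in>J. c \<le> \<tau> + real j * (T / real n) \<and> y j \<le> d \<and>
         y j \<in> {\<tau> + real j * (T / real n)..\<tau> + real (Suc j) * (T / real n)}) \<longrightarrow>
      (\<Sum>j\<in>J. \<bar>g (y j) - g (\<tau> + real j * (T / real n))\<bar>) \<le> V"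
    assume y': "\<forall>j<n. y j \<in> {\<tau> + real j * (T / real n)..\<tau> + real (Suc j) * (T / real n)}"
    have h: "0 < h" "h < \<eta>" "h * real n = T"
      using n T \<eta> by (auto simp: h_def field_simps)
    have y: "x j \<le> y j" "y j \<le> x j + h" if "j < n" for j
      using y' that by (auto simp: x_def h_def algebra_simps add_divide_distrib)
    define J where "J = {j. j < n \<and> c \<le> x j \<and> y j \<le> d}"
    have le: "\<bar>f (y j) - f (x j)\<bar> \<le> (if j \<in> J then \<bar>g (y j) - g (x j)\<bar> else 0) + L * h" if j: "j < n" for j
    proof -
      have "(real j + 1) * h \<le> real n * h"
        using j h by (intro mult_right_mono) auto
      then have "x j + h \<le> \<tau> + T"
        using h(3) by (simp add: x_def algebra_simps)
      then have "\<bar>f (y j) - f (x j)\<bar> \<le> L * (y j - x j) \<or>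
        c \<le> x j \<and> y j \<le> d \<and> \<bar>f (y j) - f (x j)\<bar> \<le> \<bar>g (y j) - g (x j)\<bar> + L * (y j - x j)"
        using y[OF j] h by (intro f) (auto simp: x_def)
      moreover have "L * (y j - x j) \<le> L * h"
        using y[OF j] L by (intro mult_left_mono) auto
      ultimately show ?thesis
        using j by (auto simp: J_def)
    qed
    have "(\<Sum>j<n. \<bar>f (y j) - f (x j)\<bar>)
        \<le> (\<Sum>j<n. (if j \<in> J then \<bar>g (y j) - g (x j)\<bar> else 0) + L * h)"
      by (intro sum_mono le) auto
    also have "\<dots> = (\<Sum>j\<in>J. \<bar>g (y j) - g (x j)\<bar>) + L * T"
    proof -
      have "{..<n} \<inter> J = J"
        by (auto simp: J_def)
      moreover have "real n * (L * h) = L * T"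
        using h(3) by (simp add: mult_ac)
      ultimately show ?thesis
        by (simp add: sum.distrib sum.inter_restrict[symmetric])
    qed
    also have "(\<Sum>j\<in>J. \<bar>g (y j) - g (x j)\<bar>) \<le> V"
      using V' y' unfolding x_def h_def by (intro V'[rule_format]) (auto simp: J_def x_def h_def)
    finally show "(\<Sum>j<n. \<bar>f (y j) - f (\<tau> + real j * (T / real n))\<bar>) \<le> V + L * T"
      by (simp add: x_def h_def)
  qed
  then show thesis
    by (rule that)
qed

text \<open>Taylor's formula with Lagrange remainder, in which the remainder value
  \<open>D p y\<close> is split as \<open>D p c\<close> plus a difference. \<open>D p\<close> is
  thus never differentiated.\<close>

lemma rectangle_rule_cell:
  fixes D :: "nat \<Rightarrow> real \<Rightarrow> real"
  assumes "\<And>x. c \<le> x \<Longrightarrow> x \<le> b \<Longrightarrow> (\<Phi> has_real_derivative D 0 x) (at x)"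
    and "\<And>i x. i < p \<Longrightarrow> c \<le> x \<Longrightarrow> x \<le> b \<Longrightarrow> (D i has_real_derivative D (Suc i) x) (at x)"
    and "c < b"
  shows "\<exists>y\<in>{c..b}. \<Phi> b - \<Phi> c = (\<Sum>i<Suc p. D i c * (b - c) ^ Suc i / fact (Suc i))
    + (D p y - D p c) * (b - c) ^ Suc p / fact (Suc p)"
proof -
  \<comment> \<open>The derivative sequence of \<Phi> itself: \<Phi>, \<open>D 0\<close>,
    \<open>D 1\<close>, and so on, hence the index shift by one.\<close>
  define diff where "diff m = (case m of 0 \<Rightarrow> \<Phi> | Suc i \<Rightarrow> D i)" for m
  have "\<exists>y>c. y < b \<and> \<Phi> b = (\<Sum>m<Suc p. diff m c / fact m * (b - c) ^ m)
      + diff (Suc p) y / fact (Suc p) * (b - c) ^ Suc p"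
    by (rule Taylor_up[where a = c]) (use assms in \<open>auto simp: diff_def split: nat.split\<close>)
  then obtain y where y: "c < y" "y < b" "\<Phi> b = (\<Sum>m<Suc p. diff m c / fact m * (b - c) ^ m)
      + diff (Suc p) y / fact (Suc p) * (b - c) ^ Suc p"
    by blast
  have "(\<Sum>m<Suc p. diff m c / fact m * (b - c) ^ m)
      = \<Phi> c + (\<Sum>i<p. D i c * (b - c) ^ Suc i / fact (Suc i))"
    by (simp add: sum.lessThan_Suc_shift diff_def del: sum.lessThan_Suc fact_Suc power_Suc)
  then have "\<Phi> b - \<Phi> c = (\<Sum>i<Suc p. D i c * (b - c) ^ Suc i / fact (Suc i))
    + (D p y - D p c) * (b - c) ^ Suc p / fact (Suc p)"
    using y(3) by (simp add: diff_def left_diff_distrib diff_divide_distrib del: fact_Suc power_Suc)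
  with y show ?thesis
    by (intro bexI[of _ y]) auto
qed

text \<open>Summing the Taylor expansion of an antiderivative over the cells expresses the error in terms
  of the rectangle sums of the derivatives, whose integrals over the period vanish.\<close>

lemma rectangle_rule_periodic:
  fixes D :: "nat \<Rightarrow> real \<Rightarrow> real"
  assumes T: "T > 0" and q: "q \<ge> 1" and lu: "l < \<tau>" "\<tau> + T < u"
    and deriv: "\<And>i x. Suc i < q \<Longrightarrow> x \<in> {l<..<u} \<Longrightarrow> (D i has_real_derivative D (Suc i) x) (at x)"
    and cont: "continuous_on {l<..<u} (D (q - 1))"
    and per: "\<And>i. Suc i < q \<Longrightarrow> D i (\<tau> + T) = D i \<tau>"
    and var: "\<forall>\<^sub>F n in sequentially. \<forall>y.
      (\<forall>j<n. y j \<in> {\<tau> + real j * (T / real n)..\<tau> + real (Suc j) * (T / real n)}) \<longrightarrow>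
      (\<Sum>j<n. \<bar>D (q - 1) (y j) - D (q - 1) (\<tau> + real j * (T / real n))\<bar>) \<le> V"
  shows "(\<lambda>n. T / real n * (\<Sum>j<n. D 0 (\<tau> + real j * (T / real n))) - integral {\<tau>..\<tau> + T} (D 0))
    \<in> O(\<lambda>n. 1 / real n ^ q)"
  using q deriv cont per var
proof (induction q arbitrary: D rule: less_induct)
  case (less q D)
  define p where "p = q - 1"
  have q: "q = Suc p"
    using less.prems(1) by (simp add: p_def)
  note deriv = less.prems(2) and cont = less.prems(3) and per = less.prems(4) and var = less.prems(5)
  define S where "S i n = T / real n * (\<Sum>j<n. D i (\<tau> + real j * (T / real n)))" for i n
  \<comment> \<open>The shifted family \<open>D (k + i)\<close> has the same top member but order q
    - i, so the induction hypothesis gives only that rate. The factor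
    \<open>(T / real n) ^ i\<close> in front of \<open>S i\<close> supplies the missing i
    powers.\<close>
  have S_O: "S i \<in> O(\<lambda>n. 1 / real n ^ (q - i))" if i: "0 < i" "i < q" for i
  proof -
    have *: "q - i + i = q" "q - i - 1 + i = q - 1"
      using i by auto
    have "(\<lambda>n. T / real n * (\<Sum>j<n. D (0 + i) (\<tau> + real j * (T / real n)))
        - integral {\<tau>..\<tau> + T} (D (0 + i))) \<in> O(\<lambda>n. 1 / real n ^ (q - i))"
    proof (rule less.IH[of "q - i" "\<lambda>k. D (k + i)"], goal_cases)
      case (3 k x)
      then show ?case
        using deriv[of "k + i" x] by (simp add: less_diff_conv)
    next
      case (5 k)
      then show ?case
        using per[of "k + i"] by (simp add: less_diff_conv)
    qed (use i cont var * in simp_all)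
    moreover have "integral {\<tau>..\<tau> + T} (D i) = 0"
    proof -
      obtain k where k: "i = Suc k"
        using i(1) gr0_implies_Suc by blast
      have "(D i has_integral (D k (\<tau> + T) - D k \<tau>)) {\<tau>..\<tau> + T}"
      proof (rule fundamental_theorem_of_calculus)
        fix x assume "x \<in> {\<tau>..\<tau> + T}"
        then have "(D k has_real_derivative D i x) (at x)"
          using lu i(2) unfolding k by (intro deriv) auto
        then show "(D k has_vector_derivative D i x) (at x within {\<tau>..\<tau> + T})"
          unfolding has_real_derivative_iff_has_vector_derivative[symmetric]
          by (rule has_field_derivative_at_within)
      qed (use T in simp)
      then show ?thesis
        using per[of k] i(2) k by (simp add: integral_unique)
    qed
    ultimately show ?thesis
      by (simp add: S_def[abs_def])
  qed
  have cont0: "continuous_on {l<..<u} (D 0)"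
  proof (cases "p = 0")
    case False
    then have "(D 0 has_real_derivative D (Suc 0) x) (at x within {l<..<u})" if "x \<in> {l<..<u}" for x
      using q by (intro has_field_derivative_at_within[OF deriv[OF _ that]]) auto
    then show ?thesis
      by (rule DERIV_continuous_on)
  qed (use cont q in simp)
  \<comment> \<open>The antiderivative starts left of \<tau> and is defined beyond \<tau> + T, so
    that it has two-sided derivatives at both ends of the period.\<close>
  define l' where "l' = (l + \<tau>) / 2"
  define u' where "u' = (\<tau> + T + u) / 2"
  have lu': "l < l'" "l' < \<tau>" "\<tau> + T < u'" "u' < u"
    using lu by (auto simp: l'_def u'_def field_simps)
  define \<Phi> where "\<Phi> x = integral {l'..x} (D 0)" for x
  have cont': "continuous_on {l'..u'} (D 0)"
    by (rule continuous_on_subset[OF cont0]) (use lu' in auto)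
  have \<Phi>: "(\<Phi> has_real_derivative D 0 x) (at x)" if "\<tau> \<le> x" "x \<le> \<tau> + T" for x
  proof -
    have "(\<Phi> has_real_derivative D 0 x) (at x within {l'..u'})"
      unfolding \<Phi>_def using that lu' by (intro integral_has_real_derivative cont') auto
    then show ?thesis
      using that lu' at_within_Icc_at[of l' x u'] by simp
  qed
  have int: "integral {\<tau>..\<tau> + T} (D 0) = \<Phi> (\<tau> + T) - \<Phi> \<tau>"
  proof (intro integral_unique fundamental_theorem_of_calculus)
    fix x assume "x \<in> {\<tau>..\<tau> + T}"
    then have "(\<Phi> has_real_derivative D 0 x) (at x)"
      by (intro \<Phi>) auto
    then show "(\<Phi> has_vector_derivative D 0 x) (at x within {\<tau>..\<tau> + T})"
      unfolding has_real_derivative_iff_has_vector_derivative[symmetric]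
      by (rule has_field_derivative_at_within)
  qed (use T in simp)
  \<comment> \<open>The accumulated Taylor remainders. \<open>S i\<close> already contains one
    factor h, which is why its weight is h^i / (i + 1)! and not h^(i+1) / (i + 1)!.\<close>
  define \<Theta> where "\<Theta> n = (integral {\<tau>..\<tau> + T} (D 0) - (\<Sum>i<q. (T / real n) ^ i / fact (Suc i) * S i n))" for n
  have \<Theta>: "\<Theta> \<in> O(\<lambda>n. 1 / real n ^ q)"
  proof (rule bigoI[of _ "V * T ^ q / fact q"])
    show "\<forall>\<^sub>F n in sequentially. norm (\<Theta> n) \<le> V * T ^ q / fact q * norm (1 / real n ^ q)"
      using var eventually_gt_at_top[of 0]
    proof eventually_elim
      fix n :: nat
      define h where "h = T / real n"
      define x where "x j = \<tau> + real j * h" for j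
      assume n: "0 < n"
      assume V: "\<forall>y. (\<forall>j<n. y j \<in> {\<tau> + real j * (T / real n)..\<tau> + real (Suc j) * (T / real n)}) \<longrightarrow>
      (\<Sum>j<n. \<bar>D (q - 1) (y j) - D (q - 1) (\<tau> + real j * (T / real n))\<bar>) \<le> V"
      have h: "h > 0" "real n * h = T"
        using n T by (auto simp: h_def)
      have range: "x j \<ge> \<tau>" "x (Suc j) \<le> \<tau> + T" "x j < x (Suc j)" "x (Suc j) - x j = h" if "j < n" for j
      proof -
        have "real (Suc j) * h \<le> real n * h"
          using that h by (intro mult_right_mono) auto
        then show "x (Suc j) \<le> \<tau> + T"
          using h by (simp add: x_def)
        show "x j \<ge> \<tau>" "x j < x (Suc j)" "x (Suc j) - x j = h"
          using h by (auto simp: x_def algebra_simps)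
      qed
      have cell: "\<exists>y\<in>{x j..x (Suc j)}. \<Phi> (x (Suc j)) - \<Phi> (x j) =
        (\<Sum>i<Suc p. D i (x j) * (x (Suc j) - x j) ^ Suc i / fact (Suc i))
        + (D p y - D p (x j)) * (x (Suc j) - x j) ^ Suc p / fact (Suc p)" if "j < n" for j
        using range[OF that] q lu by (intro rectangle_rule_cell \<Phi> deriv) auto
      have "\<forall>j\<in>{..<n}. \<exists>y. y \<in> {x j..x (Suc j)} \<and> \<Phi> (x (Suc j)) - \<Phi> (x j) =
        (\<Sum>i<q. D i (x j) * h ^ Suc i / fact (Suc i)) + (D p y - D p (x j)) * h ^ q / fact q"
      proof
        fix j assume "j \<in> {..<n}"
        then have "j < n"
          by simp
        from cell[OF this] show "\<exists>y. y \<in> {x j..x (Suc j)} \<and> \<Phi> (x (Suc j)) - \<Phi> (x j) =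
          (\<Sum>i<q. D i (x j) * h ^ Suc i / fact (Suc i)) + (D p y - D p (x j)) * h ^ q / fact q"
          unfolding range(4)[OF \<open>j < n\<close>] q by blast
      qed
      from bchoice[OF this] obtain y where "\<forall>j\<in>{..<n}. y j \<in> {x j..x (Suc j)} \<and> \<Phi> (x (Suc j)) - \<Phi> (x j) =
        (\<Sum>i<q. D i (x j) * h ^ Suc i / fact (Suc i)) + (D p (y j) - D p (x j)) * h ^ q / fact q"
        by blast
      then have y: "\<And>j. j < n \<Longrightarrow> y j \<in> {x j..x (Suc j)}"
        "\<And>j. j < n \<Longrightarrow> \<Phi> (x (Suc j)) - \<Phi> (x j) =
        (\<Sum>i<q. D i (x j) * h ^ Suc i / fact (Suc i)) + (D p (y j) - D p (x j)) * h ^ q / fact q"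
        by blast+
      have "integral {\<tau>..\<tau> + T} (D 0) = \<Phi> (x n) - \<Phi> (x 0)"
        using h by (simp add: int x_def)
      also have "\<dots> = (\<Sum>j<n. \<Phi> (x (Suc j)) - \<Phi> (x j))"
        by (rule sum_lessThan_telescope[symmetric])
      also have "\<dots> = (\<Sum>j<n. \<Sum>i<q. D i (x j) * h ^ Suc i / fact (Suc i))
          + (\<Sum>j<n. (D p (y j) - D p (x j)) * h ^ q / fact q)"
        using y(2) by (simp add: sum.distrib)
      also have "(\<Sum>j<n. \<Sum>i<q. D i (x j) * h ^ Suc i / fact (Suc i)) = (\<Sum>i<q. h ^ i / fact (Suc i) * S i n)"
        unfolding S_def
        by (subst sum.swap, intro sum.cong refl)
          (simp add: sum_distrib_left sum_distrib_right x_def h_def mult_ac)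
      also have "(\<Sum>j<n. (D p (y j) - D p (x j)) * h ^ q / fact q)
          = h ^ q / fact q * (\<Sum>j<n. D p (y j) - D p (x j))"
        by (simp add: sum_distrib_left mult_ac)
      finally have "\<Theta> n = h ^ q / fact q * (\<Sum>j<n. D p (y j) - D p (x j))"
        by (simp add: \<Theta>_def h_def)
      then have "norm (\<Theta> n) = h ^ q / fact q * \<bar>\<Sum>j<n. D p (y j) - D p (x j)\<bar>"
        using h by (simp add: abs_mult)
      also have "\<dots> \<le> h ^ q / fact q * (\<Sum>j<n. \<bar>D p (y j) - D p (x j)\<bar>)"
        using h by (intro mult_left_mono sum_abs) auto
      also have "\<dots> \<le> h ^ q / fact q * V"
        using V[rule_format, of y] y(1) h
        by (intro mult_left_mono) (auto simp: x_def h_def p_def)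
      also have "\<dots> = V * T ^ q / fact q * norm (1 / real n ^ q)"
        by (simp add: h_def power_divide mult_ac)
      finally show "norm (\<Theta> n) \<le> V * T ^ q / fact q * norm (1 / real n ^ q)" .
    qed
  qed
  have terms: "(\<lambda>n. (T / real n) ^ i / fact (Suc i) * S i n) \<in> O(\<lambda>n. 1 / real n ^ q)" if i: "i \<in> {1..<q}" for i
  proof -
    have "(\<lambda>n. (T / real n) ^ i / fact (Suc i)) \<in> O(\<lambda>n. 1 / real n ^ i)"
      by (rule bigoI[of _ "\<bar>T ^ i / fact (Suc i)\<bar>"])
        (auto simp: power_divide abs_mult abs_divide mult_ac simp del: fact_Suc)
    from landau_o.big.mult[OF this S_O[of i]] i
    have "(\<lambda>n. (T / real n) ^ i / fact (Suc i) * S i n) \<in> O(\<lambda>n. 1 / real n ^ i * (1 / real n ^ (q - i)))"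
      by auto
    moreover have "1 / real n ^ i * (1 / real n ^ (q - i)) = 1 / real n ^ q" for n
      using i by (simp flip: power_add)
    ultimately show ?thesis
      by simp
  qed
  have "(\<lambda>n. \<Sum>i\<in>{1..<q}. (T / real n) ^ i / fact (Suc i) * S i n) \<in> O(\<lambda>n. 1 / real n ^ q)"
    by (intro big_sum_in_bigo terms)
  from sum_in_bigo(1)[OF \<Theta> this]
  have "(\<lambda>n. - (\<Theta> n + (\<Sum>i\<in>{1..<q}. (T / real n) ^ i / fact (Suc i) * S i n))) \<in> O(\<lambda>n. 1 / real n ^ q)"
    unfolding landau_o.big.uminus_in_iff .
  moreover have "- (\<Theta> n + (\<Sum>i\<in>{1..<q}. (T / real n) ^ i / fact (Suc i) * S i n))
      = S 0 n - integral {\<tau>..\<tau> + T} (D 0)" for n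
  proof -
    have "(\<Sum>i<q. (T / real n) ^ i / fact (Suc i) * S i n)
        = S 0 n + (\<Sum>i\<in>{1..<q}. (T / real n) ^ i / fact (Suc i) * S i n)"
      unfolding lessThan_atLeast0 using q by (subst sum.atLeast_Suc_lessThan) auto
    then show ?thesis
      by (simp add: \<Theta>_def)
  qed
  ultimately show ?case
    by (simp add: S_def)
qed

section \<open>Uniqueness of the finite part\<close>

lemma eventually_at_right_0_less_1: "\<forall>\<^sub>F \<epsilon>::real in at_right 0. \<epsilon> < 1"
  by (rule eventually_at_right_real[THEN eventually_mono, of 0 1]) auto

lemma inverse_ln_power_tendsto_0:
  assumes "k \<ge> 1"
  shows "((\<lambda>\<epsilon>::real. 1 / ln \<epsilon> ^ k) \<longlongrightarrow> 0) (at_right 0)"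
proof -
  have "filterlim (\<lambda>\<epsilon>::real. ln \<epsilon>) at_infinity (at_right 0)"
    using ln_at_0 filterlim_at_bot_imp_at_infinity by blast
  then have "((\<lambda>\<epsilon>::real. 1 / ln \<epsilon>) \<longlongrightarrow> 0) (at_right 0)"
    by (rule tendsto_divide_0[OF tendsto_const])
  then have "((\<lambda>\<epsilon>::real. (1 / ln \<epsilon>) ^ k) \<longlongrightarrow> 0 ^ k) (at_right 0)"
    by (rule tendsto_power)
  then show ?thesis
    using assms by (simp add: power_one_over zero_power)
qed

text \<open>The substitution x = - ln \<epsilon> turns this into the decay of a polynomial divided
  by an exponential.\<close>

lemma powr_ln_power_at_right_0:
  assumes "p > 0"
  shows "((\<lambda>\<epsilon>::real. \<epsilon> powr p * ln \<epsilon> ^ k) \<longlongrightarrow> 0) (at_right 0)"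
proof -
  have "((\<lambda>x::real. (p * x) ^ k / exp (p * x)) \<longlongrightarrow> 0) at_top"
    using assms by (intro filterlim_compose[OF tendsto_power_div_exp_0])
      (intro filterlim_tendsto_pos_mult_at_top[OF tendsto_const] filterlim_ident)
  then have "((\<lambda>x::real. (- 1 / p) ^ k * ((p * x) ^ k / exp (p * x))) \<longlongrightarrow> (- 1 / p) ^ k * 0) at_top"
    by (intro tendsto_mult tendsto_const)
  moreover have "filterlim (\<lambda>\<epsilon>::real. - ln \<epsilon>) at_top (at_right 0)"
    using ln_at_0 by (simp add: filterlim_uminus_at_top)
  ultimately have "((\<lambda>\<epsilon>::real. (- 1 / p) ^ k * ((p * (- ln \<epsilon>)) ^ k / exp (p * (- ln \<epsilon>)))) \<longlongrightarrow> (- 1 / p) ^ k * 0)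
      (at_right 0)"
    by (rule filterlim_compose)
  moreover have "\<forall>\<^sub>F \<epsilon>::real in at_right 0. (- 1 / p) ^ k * ((p * (- ln \<epsilon>)) ^ k / exp (p * (- ln \<epsilon>)))
      = \<epsilon> powr p * ln \<epsilon> ^ k"
    using eventually_at_right_less[of 0]
  proof eventually_elim
    case (elim \<epsilon>)
    have "(- 1 / p) ^ k * (p * (- ln \<epsilon>)) ^ k = ln \<epsilon> ^ k"
      using assms by (simp flip: power_mult_distrib)
    then show ?case
      using elim by (simp add: powr_def exp_minus divide_inverse mult_ac)
  qed
  ultimately show ?thesis
    by (simp add: tendsto_cong)
qed

text \<open>Orders the scale by growth at 0+: a smaller exponent wins, and for equal exponents the
  higher power of the logarithm.\<close>

lemma powr_ln_scale_dominance:
  fixes p p' :: real and k k' :: nat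
  assumes "p < p' \<or> p = p' \<and> k' < k"
  shows "((\<lambda>\<epsilon>. (\<epsilon> powr p' * ln \<epsilon> ^ k') / (\<epsilon> powr p * ln \<epsilon> ^ k)) \<longlongrightarrow> 0) (at_right 0)"
proof -
  have lim: "((\<lambda>\<epsilon>. \<epsilon> powr (p' - p) * ln \<epsilon> ^ k' / ln \<epsilon> ^ k) \<longlongrightarrow> 0) (at_right 0)"
  proof (cases "p < p'")
    case True
    have "((\<lambda>\<epsilon>::real. \<epsilon> powr (p' - p) * ln \<epsilon> ^ k') \<longlongrightarrow> 0) (at_right 0)"
      using True by (intro powr_ln_power_at_right_0) auto
    moreover obtain l where "((\<lambda>\<epsilon>::real. 1 / ln \<epsilon> ^ k) \<longlongrightarrow> l) (at_right 0)"
      using inverse_ln_power_tendsto_0[of k] by (cases k) auto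
    ultimately have "((\<lambda>\<epsilon>::real. (\<epsilon> powr (p' - p) * ln \<epsilon> ^ k') * (1 / ln \<epsilon> ^ k)) \<longlongrightarrow> 0 * l) (at_right 0)"
      by (rule tendsto_mult)
    then show ?thesis
      by simp
  next
    case False
    with assms have eq: "p' = p" "k = k' + (k - k')" "k - k' \<ge> 1"
      by auto
    have "\<forall>\<^sub>F \<epsilon>::real in at_right 0. 1 / ln \<epsilon> ^ (k - k') = \<epsilon> powr (p' - p) * ln \<epsilon> ^ k' / ln \<epsilon> ^ k"
      using eventually_at_right_less[of 0] eventually_at_right_0_less_1
    proof eventually_elim
      case (elim \<epsilon>)
      have "ln \<epsilon> ^ k = ln \<epsilon> ^ k' * ln \<epsilon> ^ (k - k')"
        using eq(2) by (metis power_add)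
      then show ?case
        using elim eq(1) by simp
    qed
    then show ?thesis
      using inverse_ln_power_tendsto_0[OF eq(3)] by (simp add: tendsto_cong)
  qed
  have "\<forall>\<^sub>F \<epsilon>::real in at_right 0. \<epsilon> powr (p' - p) * ln \<epsilon> ^ k' / ln \<epsilon> ^ k
      = (\<epsilon> powr p' * ln \<epsilon> ^ k') / (\<epsilon> powr p * ln \<epsilon> ^ k)"
    using eventually_at_right_less[of 0] by eventually_elim (simp add: powr_diff)
  then show ?thesis
    using lim by (simp add: tendsto_cong)
qed

text \<open>Dividing by the dominant member of the scale shows that its coefficient vanishes.\<close>

lemma unbounded_scale_tendsto_imp_0:
  fixes S :: "(real \<times> nat) set"
  assumes S: "finite S" "\<forall>(p, k)\<in>S. p < 0 \<or> p = 0 \<and> k \<ge> 1"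
    and lim: "((\<lambda>\<epsilon>. \<Sum>(p, k)\<in>S. c (p, k) * (\<epsilon> powr p * ln \<epsilon> ^ k)) \<longlongrightarrow> L) (at_right 0)"
  shows "L = 0"
proof -
  define \<phi> where "\<phi> s \<epsilon> = \<epsilon> powr fst s * ln \<epsilon> ^ snd s" for s :: "real \<times> nat" and \<epsilon> :: real
  \<comment> \<open>With zero coefficients removed, a vanishing leading coefficient is a
    contradiction, so only the case of an empty sum survives.\<close>
  define S' where "S' = {s \<in> S. c s \<noteq> 0}"
  have finS': "finite S'"
    using S by (simp add: S'_def)
  have "(\<Sum>(p, k)\<in>S. c (p, k) * (\<epsilon> powr p * ln \<epsilon> ^ k)) = (\<Sum>s\<in>S'. c s * \<phi> s \<epsilon>)" for \<epsilon>
    unfolding S'_def \<phi>_def using S(1)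
    by (intro sum.mono_neutral_cong_right) (auto simp: split_beta)
  with lim have lim': "((\<lambda>\<epsilon>. \<Sum>s\<in>S'. c s * \<phi> s \<epsilon>) \<longlongrightarrow> L) (at_right 0)"
    by simp
  show ?thesis
  proof (cases "S' = {}")
    case True
    then show ?thesis
      using lim' by (simp add: tendsto_const_iff)
  next
    case False
    \<comment> \<open>The dominant member of the scale: least exponent, then largest power of the
      logarithm for that exponent.\<close>
    define p where "p = Min (fst ` S')"
    define K where "K = {k. (p, k) \<in> S'}"
    define k where "k = Max K"
    have "p \<in> fst ` S'"
      unfolding p_def using finS' False by (intro Min_in) auto
    then have "K \<noteq> {}"
      by (auto simp: K_def)
    moreover have "K \<subseteq> snd ` S'"
      by (force simp: K_def)
    then have "finite K"
      using finS' finite_subset by blast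
    ultimately have "k \<in> K"
      unfolding k_def by (intro Max_in)
    then have s0: "(p, k) \<in> S'"
      by (simp add: K_def)
    have dom: "p < fst s \<or> p = fst s \<and> snd s < k" if "s \<in> S'" "s \<noteq> (p, k)" for s
    proof -
      have "p \<le> fst s"
        unfolding p_def using finS' that(1) by (intro Min_le) auto
      moreover have "snd s \<le> k" if "p = fst s"
        unfolding k_def using \<open>finite K\<close> that \<open>s \<in> S'\<close> by (intro Max_ge) (auto simp: K_def)
      ultimately show ?thesis
        using that(2) by (metis nat_less_le order_le_less prod.collapse)
    qed
    have \<phi>0: "\<forall>\<^sub>F \<epsilon> in at_right 0. \<phi> (p, k) \<epsilon> \<noteq> 0"
      using eventually_at_right_less[of 0] eventually_at_right_0_less_1
      by eventually_elim (auto simp: \<phi>_def)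
    have ratio: "((\<lambda>\<epsilon>. c s * (\<phi> s \<epsilon> / \<phi> (p, k) \<epsilon>)) \<longlongrightarrow> (if s = (p, k) then c s else 0)) (at_right 0)"
      if "s \<in> S'" for s
    proof (cases "s = (p, k)")
      case True
      have "\<forall>\<^sub>F \<epsilon> in at_right 0. c s = c s * (\<phi> s \<epsilon> / \<phi> (p, k) \<epsilon>)"
        using \<phi>0 by eventually_elim (simp add: True)
      from Lim_transform_eventually[OF tendsto_const this] show ?thesis
        using True by simp
    next
      case False
      have "((\<lambda>\<epsilon>. \<phi> s \<epsilon> / \<phi> (p, k) \<epsilon>) \<longlongrightarrow> 0) (at_right 0)"
        unfolding \<phi>_def fst_conv snd_conv by (rule powr_ln_scale_dominance) (use dom that False in auto)
      from tendsto_mult[OF tendsto_const[of "c s"] this] show ?thesis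
        using False by simp
    qed
    have "((\<lambda>\<epsilon>. \<Sum>s\<in>S'. c s * (\<phi> s \<epsilon> / \<phi> (p, k) \<epsilon>)) \<longlongrightarrow> (\<Sum>s\<in>S'. if s = (p, k) then c s else 0)) (at_right 0)"
      by (intro tendsto_sum ratio)
    then have lim1: "((\<lambda>\<epsilon>. (\<Sum>s\<in>S'. c s * \<phi> s \<epsilon>) * (1 / \<phi> (p, k) \<epsilon>)) \<longlongrightarrow> c (p, k)) (at_right 0)"
      using finS' s0 by (simp add: sum_divide_distrib)
    \<comment> \<open>The constant 1 is the member (0, 0) of the scale and is dominated too. Hence
      the convergent sum divided by \<open>\<phi> (p, k)\<close> tends to 0, while by
      \<open>lim1\<close> it tends to the leading coefficient.\<close>
    have "p < 0 \<or> p = 0 \<and> 0 < k"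
      using s0 S(2) by (auto simp: S'_def)
    from powr_ln_scale_dominance[OF this]
    have "((\<lambda>\<epsilon>. \<epsilon> powr 0 * ln \<epsilon> ^ 0 / \<phi> (p, k) \<epsilon>) \<longlongrightarrow> 0) (at_right 0)"
      by (simp add: \<phi>_def)
    moreover have "\<forall>\<^sub>F \<epsilon>::real in at_right 0. \<epsilon> powr 0 * ln \<epsilon> ^ 0 / \<phi> (p, k) \<epsilon> = 1 / \<phi> (p, k) \<epsilon>"
      using eventually_at_right_less[of 0] by eventually_elim auto
    ultimately have "((\<lambda>\<epsilon>. 1 / \<phi> (p, k) \<epsilon>) \<longlongrightarrow> 0) (at_right 0)"
      by (rule Lim_transform_eventually)
    from tendsto_mult[OF lim' this] have "c (p, k) = 0"
      using tendsto_unique[OF _ lim1] by fastforce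
    with s0 show ?thesis
      by (simp add: S'_def)
  qed
qed

lemma has_finite_part_unique:
  assumes "has_finite_part F \<alpha> \<beta> \<tau> I" "has_finite_part F \<alpha> \<beta> \<tau> J"
  shows "I = J"
proof -
  define X where "X \<epsilon> = integral {\<alpha>..\<tau> - \<epsilon>} F + integral {\<tau> + \<epsilon>..\<beta>} F" for \<epsilon>
  obtain S1 c1 where 1: "finite S1" "\<forall>(p, k)\<in>S1. p < 0 \<or> p = 0 \<and> k \<ge> 1"
    "((\<lambda>\<epsilon>. X \<epsilon> - (\<Sum>(p, k)\<in>S1. c1 (p, k) * (\<epsilon> powr p * ln \<epsilon> ^ k))) \<longlongrightarrow> I) (at_right 0)"
    using assms(1) unfolding has_finite_part_def X_def by blast
  obtain S2 c2 where 2: "finite S2" "\<forall>(p, k)\<in>S2. p < 0 \<or> p = 0 \<and> k \<ge> 1"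
    "((\<lambda>\<epsilon>. X \<epsilon> - (\<Sum>(p, k)\<in>S2. c2 (p, k) * (\<epsilon> powr p * ln \<epsilon> ^ k))) \<longlongrightarrow> J) (at_right 0)"
    using assms(2) unfolding has_finite_part_def X_def by blast
  \<comment> \<open>The two expansions may use different members of the scale, so their difference
    is taken over the union with missing coefficients set to 0.\<close>
  define c where "c s = (if s \<in> S1 then c1 s else 0) - (if s \<in> S2 then c2 s else 0)" for s
  have *: "(\<Sum>(p, k)\<in>S1 \<union> S2. c (p, k) * (\<epsilon> powr p * ln \<epsilon> ^ k)) =
    (\<Sum>(p, k)\<in>S1. c1 (p, k) * (\<epsilon> powr p * ln \<epsilon> ^ k)) - (\<Sum>(p, k)\<in>S2. c2 (p, k) * (\<epsilon> powr p * ln \<epsilon> ^ k))" for \<epsilon>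
  proof -
    have a: "(\<Sum>(p, k)\<in>S1. c1 (p, k) * (\<epsilon> powr p * ln \<epsilon> ^ k))
      = (\<Sum>s\<in>S1 \<union> S2. (if s \<in> S1 then c1 s else 0) * (\<epsilon> powr fst s * ln \<epsilon> ^ snd s))"
      using 1(1) 2(1) by (intro sum.mono_neutral_cong_left) (auto simp: split_beta)
    have b: "(\<Sum>(p, k)\<in>S2. c2 (p, k) * (\<epsilon> powr p * ln \<epsilon> ^ k))
      = (\<Sum>s\<in>S1 \<union> S2. (if s \<in> S2 then c2 s else 0) * (\<epsilon> powr fst s * ln \<epsilon> ^ snd s))"
      using 1(1) 2(1) by (intro sum.mono_neutral_cong_left) (auto simp: split_beta)
    show ?thesis
      unfolding a b c_def split_beta sum_subtractf[symmetric] left_diff_distrib by (simp cong: if_cong)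
  qed
  have "((\<lambda>\<epsilon>. \<Sum>(p, k)\<in>S1 \<union> S2. c (p, k) * (\<epsilon> powr p * ln \<epsilon> ^ k)) \<longlongrightarrow> J - I) (at_right 0)"
    using tendsto_diff[OF 2(3) 1(3)] unfolding * by simp
  then have "J - I = 0"
    using 1(1,2) 2(1,2) by (intro unbounded_scale_tendsto_imp_0[where S = "S1 \<union> S2" and c = c]) auto
  then show ?thesis
    by simp
qed

lemma finite_part_eq: "has_finite_part F \<alpha> \<beta> \<tau> I \<Longrightarrow> finite_part F \<alpha> \<beta> \<tau> = I"
  unfolding finite_part_def using has_finite_part_unique by blast

section \<open>Periodic lattice sums with a single pole\<close>

text \<open>\<open>lattice_pole k x = \<Sum>\<^sub>l (x + l)\<^bsup>-k\<^esup>\<close> and \<open>lattice_pole_reg k x\<close> is the same sum without \<open>l = 0\<close>; the two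
  polygamma terms are the halves over \<open>l \<ge> 0\<close> (respectively \<open>l \<ge> 1\<close>) and \<open>l < 0\<close>, the divergent constants for
  \<open>k = 1\<close> having cancelled.\<close>

definition lattice_pole :: "nat \<Rightarrow> real \<Rightarrow> real" where
  "lattice_pole k x =
     ((-1) ^ k * Polygamma (k - 1) x + Polygamma (k - 1) (1 - x)) / fact (k - 1)"

definition lattice_pole_reg :: "nat \<Rightarrow> real \<Rightarrow> real" where
  "lattice_pole_reg k x =
     ((-1) ^ k * Polygamma (k - 1) (1 + x) + Polygamma (k - 1) (1 - x)) / fact (k - 1)"

lemma minus_one_power_mult_self [simp]: "(-1) ^ n * ((-1) ^ n * x) = (x :: real)"
  by (simp flip: mult.assoc power_add mult_2)

lemma lattice_pole_eq:
  assumes "k \<ge> 1" "x \<noteq> 0"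
  shows "lattice_pole k x = 1 / x ^ k + lattice_pole_reg k x"
proof -
  obtain n where k: "k = Suc n"
    using assms(1) by (cases k) auto
  have "(-1) ^ k * Polygamma n (x + 1) = (-1) ^ k * Polygamma n x - fact n / x ^ k"
    by (simp add: Polygamma_plus1[OF assms(2)] k distrib_left)
  then show ?thesis
    by (simp add: lattice_pole_def lattice_pole_reg_def k add.commute[of 1 x] add_divide_distrib diff_divide_distrib
        del: power_Suc)
qed

lemma lattice_pole_plus1:
  assumes "k \<ge> 1" "x \<noteq> 0"
  shows "lattice_pole k (x + 1) = lattice_pole k x"
proof -
  obtain n where k: "k = Suc n"
    using assms(1) by (cases k) auto
  have "(-1) ^ k * Polygamma n (x + 1) = (-1) ^ k * Polygamma n x - fact n / x ^ k"
    by (simp add: Polygamma_plus1[OF assms(2)] k distrib_left)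
  moreover have "Polygamma n (1 - x) = Polygamma n (- x) - fact n / x ^ k"
  proof -
    have "Polygamma n (1 - x) = Polygamma n (- x + 1)"
      by simp
    also have "\<dots> = Polygamma n (- x) + (-1) ^ n * fact n / (- x) ^ k"
      using Polygamma_plus1[of "- x" n] assms(2) k by simp
    also have "(- x) ^ k = - ((-1) ^ n * x ^ k)"
      by (simp add: k power_minus[of x n])
    also have "(-1) ^ n * fact n / - ((-1) ^ n * x ^ k) = - (fact n / x ^ k)"
      by simp
    finally show ?thesis
      by simp
  qed
  ultimately show ?thesis
    by (simp add: lattice_pole_def k del: power_Suc)
qed

lemma lattice_pole_reflect: "lattice_pole k (1 - x) = (-1) ^ k * lattice_pole k x"
  by (simp add: lattice_pole_def algebra_simps add_divide_distrib)

lemma lattice_pole_reg_0: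
  assumes "odd k"
  shows "lattice_pole_reg k 0 = 0"
  using assms by (simp add: lattice_pole_reg_def)

lemma smooth_on_Polygamma: "smooth_on {0<..} (Polygamma n)"
proof -
  have "smooth_on {0<..} ((\<lambda>k. Polygamma (n + k)) 0)"
  proof (rule smooth_onI_family(1))
    fix k and x :: real assume "x \<in> {0<..}"
    then have "x \<notin> \<int>\<^sub>\<le>\<^sub>0"
      by (auto elim!: nonpos_Ints_cases)
    then show "(Polygamma (n + k) has_real_derivative Polygamma (n + Suc k) x) (at x)"
      by (simp add: has_field_derivative_Polygamma)
  qed simp
  then show ?thesis
    by simp
qed

lemma smooth_on_Polygamma_affine:
  assumes "open S" "\<And>x. x \<in> S \<Longrightarrow> u * x + v > 0"
  shows "smooth_on S (\<lambda>x. Polygamma n (u * x + v))"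
  by (rule smooth_on_compose[OF smooth_on_linear[OF assms(1)] smooth_on_Polygamma])
    (use assms(2) in auto)

lemma smooth_on_lattice_pole: "smooth_on {0<..<1} (lattice_pole k)"
proof -
  have "smooth_on {0<..<1} (\<lambda>x. (1 / fact (k - 1)) *
      ((-1) ^ k * Polygamma (k - 1) (1 * x + 0) + Polygamma (k - 1) ((-1) * x + 1)))"
    by (intro smooth_on_cmult smooth_on_add smooth_on_Polygamma_affine) auto
  then show ?thesis
    by (simp add: lattice_pole_def[abs_def] add.commute)
qed

lemma smooth_on_lattice_pole_reg: "smooth_on {-1<..<1} (lattice_pole_reg k)"
proof -
  have "smooth_on {-1<..<1} (\<lambda>x. (1 / fact (k - 1)) *
      ((-1) ^ k * Polygamma (k - 1) (1 * x + 1) + Polygamma (k - 1) ((-1) * x + 1)))"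
    by (intro smooth_on_cmult smooth_on_add smooth_on_Polygamma_affine) auto
  then show ?thesis
    by (simp add: lattice_pole_reg_def[abs_def] add.commute)
qed

lemma lattice_pole_has_deriv:
  assumes "k \<ge> 1" "x \<in> {0<..<1}"
  shows "(lattice_pole k has_real_derivative - real k * lattice_pole (Suc k) x) (at x)"
proof -
  obtain n where k: "k = Suc n"
    using assms(1) by (cases k) auto
  have nz: "x \<notin> \<int>\<^sub>\<le>\<^sub>0" "1 - x \<notin> \<int>\<^sub>\<le>\<^sub>0"
    using assms(2) by (auto elim!: nonpos_Ints_cases)
  have "((\<lambda>x. 1 - x) has_real_derivative - 1) (at x)"
    by (auto intro!: derivative_eq_intros)
  from DERIV_chain2[OF has_field_derivative_Polygamma[OF nz(2), of n] this]
  have 1: "((\<lambda>x. Polygamma n (1 - x)) has_real_derivative Polygamma k (1 - x) * - 1) (at x)"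
    by (simp add: k)
  have 2: "(Polygamma n has_real_derivative Polygamma k x) (at x)"
    using has_field_derivative_Polygamma[OF nz(1), of n] by (simp add: k)
  have "(lattice_pole k has_real_derivative
      ((-1) ^ k * Polygamma k x + Polygamma k (1 - x) * - 1) / fact n) (at x)"
    unfolding lattice_pole_def[abs_def] k diff_Suc_1
    by (intro DERIV_cdivide DERIV_add DERIV_cmult 1[unfolded k] 2[unfolded k])
  moreover have "((-1) ^ k * Polygamma k x + Polygamma k (1 - x) * - 1) / fact n
      = - real k * lattice_pole (Suc k) x"
    unfolding lattice_pole_def k diff_Suc_1 fact_Suc
    by (simp add: divide_simps del: of_nat_Suc)
  ultimately show ?thesis
    by simp
qed

text \<open>For k \<ge> 2 the antiderivative is a multiple of \<open>lattice_pole (k - 1)\<close>,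
  whose reflection law has sign (-1)^(k-1): the increment between x and 1 - x cancels for odd k and
  doubles for even k.\<close>

lemma lattice_pole_antideriv:
  assumes k: "k \<ge> 1"
  obtains A where "\<And>x. x \<in> {0<..<1} \<Longrightarrow> (A has_real_derivative lattice_pole k x) (at x)"
    "\<And>x. A (1 - x) - A x = (if even k then 2 * lattice_pole (k - 1) x / (real k - 1) else 0)"
proof (cases "k = 1")
  case True
  show thesis
  proof (rule that)
    fix x :: real assume x: "x \<in> {0<..<1}"
    have "((\<lambda>x. 1 - x) has_real_derivative - 1) (at x)"
      by (auto intro!: derivative_eq_intros)
    from DERIV_chain2[OF has_field_derivative_ln_Gamma_real this] x
    have "((\<lambda>x. ln_Gamma (1 - x)) has_real_derivative Digamma (1 - x) * - 1) (at x)"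
      by simp
    \<comment> \<open>By the reflection formula of the Gamma function this antiderivative equals ln
      (sin (pi x) / pi) on (0, 1); it is visibly invariant under x to 1 - x.\<close>
    from DERIV_minus[OF DERIV_add[OF has_field_derivative_ln_Gamma_real this]] x
    show "((\<lambda>x. - (ln_Gamma x + ln_Gamma (1 - x))) has_real_derivative lattice_pole k x) (at x)"
      by (simp add: lattice_pole_def True)
  qed (simp add: True)
next
  case False
  then obtain n where n: "k = Suc n" "n \<ge> 1"
    using k by (cases k) auto
  show thesis
  proof (rule that)
    fix x :: real assume "x \<in> {0<..<1}"
    from DERIV_cdivide[OF lattice_pole_has_deriv[OF n(2) this], of "- real n"] n
    show "((\<lambda>x. lattice_pole n x / - real n) has_real_derivative lattice_pole k x) (at x)"
      by simp
  next
    show "lattice_pole n (1 - x) / - real n - lattice_pole n x / - real n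
        = (if even k then 2 * lattice_pole (k - 1) x / (real k - 1) else 0)" for x
      using n by (simp add: lattice_pole_reflect)
  qed
qed

text \<open>Since j / N + i = (j + i N) / N, and every positive integer is j + i N for exactly one j
  in 1..N and i \<ge> 0, the N polygamma series together rearrange to the zeta series, with N^k as a
  common factor.\<close>

lemma sum_Polygamma_rational:
  assumes k: "k \<ge> 2" and N: "N > 0"
  shows "(\<Sum>j=1..N. (-1) ^ k * Polygamma (k - 1) (real j / real N) / fact (k - 1)) = real N ^ k * zeta_nat k"
proof -
  have series: "(\<lambda>i. inverse ((real j / real N + of_nat i) ^ k)) sums
      ((-1) ^ k * Polygamma (k - 1) (real j / real N) / fact (k - 1))" if "j \<in> {1..N}" for j
    using Polygamma_LIMSEQ[of "real j / real N" "k - 1"] that k N by (simp del: power_Suc)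
  have "(\<lambda>i. \<Sum>j=1..N. inverse ((real j / real N + of_nat i) ^ k)) sums
      (\<Sum>j=1..N. (-1) ^ k * Polygamma (k - 1) (real j / real N) / fact (k - 1))"
    by (intro sums_sum series)
  moreover have "(\<lambda>i. \<Sum>j=1..N. inverse ((real j / real N + of_nat i) ^ k)) sums (real N ^ k * zeta_nat k)"
  proof -
    \<comment> \<open>The i-th block of N consecutive terms of the zeta series collects the i-th
      terms of the N polygamma series.\<close>
    have eq: "(\<Sum>M\<in>{i * N..<i * N + N}. 1 / real (Suc M) ^ k) * real N ^ k =
        (\<Sum>j=1..N. inverse ((real j / real N + of_nat i) ^ k))" for i
    proof -
      have "(\<Sum>M\<in>{i * N..<i * N + N}. 1 / real (Suc M) ^ k) = (\<Sum>M\<in>{0..<N}. 1 / real (Suc (M + i * N)) ^ k)"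
        using sum.shift_bounds_nat_ivl[of "\<lambda>M. 1 / real (Suc M) ^ k" 0 "i * N" N] by (simp add: add.commute)
      also have "\<dots> = (\<Sum>j\<in>{1..N}. 1 / real (j + i * N) ^ k)"
        by (rule sum.reindex_bij_witness[of _ "\<lambda>j. j - 1" Suc]) auto
      finally have "(\<Sum>M\<in>{i * N..<i * N + N}. 1 / real (Suc M) ^ k) * real N ^ k
          = (\<Sum>j\<in>{1..N}. real N ^ k / real (j + i * N) ^ k)"
        by (simp add: sum_distrib_right)
      also have "\<dots> = (\<Sum>j=1..N. inverse ((real j / real N + of_nat i) ^ k))"
      proof (intro sum.cong refl)
        fix j
        have "real j / real N + of_nat i = real (j + i * N) / real N"
          using N by (simp add: field_simps)
        then show "real N ^ k / real (j + i * N) ^ k = inverse ((real j / real N + of_nat i) ^ k)"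
          by (simp add: power_divide)
      qed
      finally show ?thesis .
    qed
    have "(\<lambda>i. (\<Sum>M\<in>{i * N..<i * N + N}. 1 / real (Suc M) ^ k) * real N ^ k) sums (zeta_nat k * real N ^ k)"
      by (intro sums_mult2 sums_group sums_zeta_nat k N)
    then show ?thesis
      unfolding eq by (simp add: mult.commute)
  qed
  ultimately show ?thesis
    by (rule sums_unique2)
qed

lemma lattice_pole_reg_0_even:
  assumes "k \<ge> 2" "even k"
  shows "lattice_pole_reg k 0 = 2 * zeta_nat k"
  using sum_Polygamma_rational[OF assms(1), of 1] assms(2)
  by (simp add: lattice_pole_reg_def)

text \<open>The reflection j to N - j cancels the sum for odd k. For even k it shows that the two
  halves of \<open>lattice_pole\<close> contribute equally; the -1 is the node j = N, present in the
  polygamma sum but not on the grid.\<close>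

lemma sum_lattice_pole:
  assumes k: "k \<ge> 1" and N: "N > 0"
  shows "(\<Sum>j=1..N-1. lattice_pole k (real j / real N)) = (if even k then 2 * zeta_nat k * (real N ^ k - 1) else 0)"
proof -
  have reflect: "(\<Sum>j=1..N-1. f (real j / real N)) = (\<Sum>j=1..N-1. f (1 - real j / real N))" for f :: "real \<Rightarrow> real"
  proof (rule sum.reindex_bij_witness[of _ "\<lambda>j. N - j" "\<lambda>j. N - j"])
    fix j assume "j \<in> {1..N-1}"
    then have "real (N - j) = real N - real j"
      by (auto intro!: of_nat_diff)
    then show "f (1 - real (N - j) / real N) = f (real j / real N)"
      using N by (simp add: field_simps)
  qed auto
  show ?thesis
  proof (cases "even k")
    case False
    have "(\<Sum>j=1..N-1. lattice_pole k (real j / real N)) = - (\<Sum>j=1..N-1. lattice_pole k (real j / real N))"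
      by (subst reflect) (use False in \<open>simp add: lattice_pole_reflect sum_negf\<close>)
    then show ?thesis
      using False by simp
  next
    case True
    with k have k2: "k \<ge> 2"
      by (cases "k = 1") auto
    define p where "p x = Polygamma (k - 1) x / fact (k - 1)" for x :: real
    have "(\<Sum>j=1..N. p (real j / real N)) = real N ^ k * zeta_nat k"
      using sum_Polygamma_rational[OF k2 N] True by (simp add: p_def)
    moreover have "(\<Sum>j=1..N. p (real j / real N)) = (\<Sum>j=1..N-1. p (real j / real N)) + p 1"
      using N by (cases N) auto
    moreover have "p 1 = zeta_nat k"
      using sum_Polygamma_rational[OF k2, of 1] True by (simp add: p_def)
    moreover have "(\<Sum>j=1..N-1. lattice_pole k (real j / real N)) = 2 * (\<Sum>j=1..N-1. p (real j / real N))"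
      using reflect[of p] True
      by (simp add: lattice_pole_def p_def add_divide_distrib sum.distrib)
    ultimately show ?thesis
      using True by (simp add: algebra_simps)
  qed
qed

section \<open>Splitting off the poles\<close>

text \<open>L'Hospital's rule for the difference quotient. It is applied at \<beta>, where the
  hypotheses give limits of derivatives but no derivatives.\<close>

lemma has_real_derivative_limit:
  fixes f :: "real \<Rightarrow> real"
  assumes "isCont f a" "\<forall>\<^sub>F x in at a. (f has_real_derivative f' x) (at x)" "(f' \<longlongrightarrow> l) (at a)"
  shows "(f has_real_derivative l) (at a)"
proof -
  have "((\<lambda>x. (f x - f a) / (x - a)) \<longlongrightarrow> l) (at a)"
  proof (rule lhopital[where f' = f' and g' = "\<lambda>_. 1"])
    show "((\<lambda>x. f x - f a) \<longlongrightarrow> 0) (at a)"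
      using assms(1) by (simp add: isCont_def LIM_zero_iff)
    show "((\<lambda>x. x - a) \<longlongrightarrow> 0) (at a)"
      by (simp add: LIM_zero_iff)
    show "\<forall>\<^sub>F x in at a. ((\<lambda>x. f x - f a) has_real_derivative f' x) (at x)"
      using assms(2) by eventually_elim (auto intro!: derivative_eq_intros)
    show "\<forall>\<^sub>F x in at a. ((\<lambda>x. x - a) has_real_derivative 1) (at x)"
      by (intro always_eventually allI) (auto intro!: derivative_eq_intros)
    show "\<forall>\<^sub>F x in at a. x - a \<noteq> 0"
      by (simp add: eventually_at_filter)
  qed (use assms(3) in auto)
  then show ?thesis
    by (simp add: has_field_derivative_iff)
qed

lemma smooth_on_Lipschitz:
  assumes f: "smooth_on {a<..<b} f" and "a < c" "d < b"
  obtains L where "L \<ge> 0"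
    "\<And>x y. c \<le> x \<Longrightarrow> x \<le> y \<Longrightarrow> y \<le> d \<Longrightarrow> \<bar>(deriv ^^ k) f y - (deriv ^^ k) f x\<bar> \<le> L * (y - x)"
proof -
  have "continuous_on {c..d} ((deriv ^^ Suc k) f)"
    by (rule continuous_on_subset[OF smooth_on_continuous_on[OF f]]) (use assms in auto)
  then have "bounded ((deriv ^^ Suc k) f ` {c..d})"
    using compact_continuous_image compact_imp_bounded by blast
  then obtain L where "\<forall>z\<in>(deriv ^^ Suc k) f ` {c..d}. norm z \<le> L"
    unfolding bounded_iff by (rule exE)
  then have L: "norm ((deriv ^^ Suc k) f x) \<le> L" if "x \<in> {c..d}" for x
    using imageI[OF that, of "(deriv ^^ Suc k) f"] by (rule bspec)
  show thesis
  proof (rule that[of "max L 0"])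
    fix x y assume xy: "c \<le> x" "x \<le> y" "y \<le> d"
    have "norm ((deriv ^^ k) f y - (deriv ^^ k) f x) \<le> max L 0 * norm (y - x)"
    proof (rule field_differentiable_bound[where S = "{c..d}" and f = "(deriv ^^ k) f"
          and f' = "(deriv ^^ Suc k) f"])
      fix z assume z: "z \<in> {c..d}"
      then have "z \<in> {a<..<b}"
        using assms(2,3) by auto
      from smooth_on_has_deriv[OF f this]
      show "((deriv ^^ k) f has_real_derivative (deriv ^^ Suc k) f z) (at z within {c..d})"
        by (rule has_field_derivative_at_within)
      show "norm ((deriv ^^ Suc k) f z) \<le> max L 0"
        using L[OF z] by linarith
    qed (use xy in auto)
    then show "\<bar>(deriv ^^ k) f y - (deriv ^^ k) f x\<bar> \<le> max L 0 * (y - x)"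
      using xy by simp
  qed simp
qed

lemma periodic_ext_plus:
  assumes "\<alpha> < \<beta>"
  shows "periodic_ext \<alpha> \<beta> F (\<xi> + (\<beta> - \<alpha>)) = periodic_ext \<alpha> \<beta> F \<xi>"
proof -
  have "(\<xi> + (\<beta> - \<alpha>) - \<alpha>) / (\<beta> - \<alpha>) = (\<xi> - \<alpha>) / (\<beta> - \<alpha>) + 1"
    using assms by (simp add: field_simps)
  then have "\<lfloor>(\<xi> + (\<beta> - \<alpha>) - \<alpha>) / (\<beta> - \<alpha>)\<rfloor> = \<lfloor>(\<xi> - \<alpha>) / (\<beta> - \<alpha>)\<rfloor> + 1"
    by simp
  then have "\<xi> + (\<beta> - \<alpha>) - of_int \<lfloor>(\<xi> + (\<beta> - \<alpha>) - \<alpha>) / (\<beta> - \<alpha>)\<rfloor> * (\<beta> - \<alpha>)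
      = \<xi> - of_int \<lfloor>(\<xi> - \<alpha>) / (\<beta> - \<alpha>)\<rfloor> * (\<beta> - \<alpha>)"
    by (simp add: algebra_simps)
  then show ?thesis
    unfolding periodic_ext_def by (simp only:)
qed

lemma periodic_ext_inside:
  assumes "\<xi> \<in> {\<alpha><..<\<beta>}"
  shows "periodic_ext \<alpha> \<beta> F \<xi> = F \<xi>"
proof -
  have "\<lfloor>(\<xi> - \<alpha>) / (\<beta> - \<alpha>)\<rfloor> = 0"
    using assms by (simp add: floor_eq_iff)
  then show ?thesis
    using assms by (simp add: periodic_ext_def)
qed

lemma periodic_ext_right_end:
  assumes "\<alpha> < \<beta>"
  shows "periodic_ext \<alpha> \<beta> F \<beta> = 0"
  using assms by (simp add: periodic_ext_def)

text \<open>The situation after the change of variable: a smooth numerator over a pole of order m,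
  flat ends, and absolute continuity across the seam \<beta>.\<close>

locale pole_integrand =
  fixes m q :: nat and \<alpha> \<beta> \<tau> T :: real and F G :: "real \<Rightarrow> real"
  assumes m: "m \<ge> 1" and q: "q \<ge> 1"
    and \<tau>: "\<alpha> < \<tau>" "\<tau> < \<beta>"
    and T_def: "T = \<beta> - \<alpha>"
    and G: "smooth_on {\<alpha><..<\<beta>} G"
    and F: "\<And>\<xi>. \<xi> \<in> {\<alpha><..<\<beta>} \<Longrightarrow> \<xi> \<noteq> \<tau> \<Longrightarrow> F \<xi> = G \<xi> / (\<xi> - \<tau>) ^ m"
    and F_ends: "\<And>i. i < q \<Longrightarrow> ((deriv ^^ i) F \<longlongrightarrow> 0) (at_right \<alpha>) \<and> ((deriv ^^ i) F \<longlongrightarrow> 0) (at_left \<beta>)"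
    and F_q: "\<exists>\<delta>>0. abs_continuous_on {\<beta> - \<delta>..\<beta> + \<delta>} ((deriv ^^ (q - 1)) (periodic_ext \<alpha> \<beta> F))"
begin

section \<open>Principal part at \<tau> and the regular remainder\<close>

abbreviation \<F> :: "real \<Rightarrow> real" where
  "\<F> \<equiv> periodic_ext \<alpha> \<beta> F"

text \<open>Iterated divided differences with the fixed node \<tau>: the value at \<tau> is the i-th
  Taylor coefficient of G, and the function is the quotient of the i-th Taylor remainder by (\<xi> -
  \<tau>)^i, continued smoothly to \<tau>.\<close>

definition Taylor_quot :: "nat \<Rightarrow> real \<Rightarrow> real" where
  "Taylor_quot i = ((\<lambda>u \<xi>. divided_diff u \<xi> \<tau>) ^^ i) G"

text \<open>The Laurent coefficient of F at (\<xi> - \<tau>)^(-k). The index k = 0 is included, as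
  the constant term enters through the node \<tau>.\<close>

definition pole_coeff :: "nat \<Rightarrow> real" where
  "pole_coeff k = Taylor_quot (m - k) \<tau>"

text \<open>Dividing by T^k cancels the scaling of the argument, so each summand has the pole
  \<open>pole_coeff k / (\<xi> - \<tau>) ^ k\<close> at \<tau>.\<close>

definition pole_part :: "real \<Rightarrow> real" where
  "pole_part \<xi> = (\<Sum>k=1..m. pole_coeff k * (lattice_pole k ((\<xi> - \<tau>) / T) / T ^ k))"

text \<open>The difference of F and \<open>pole_part\<close> with the singular powers already
  cancelled, which makes sense at \<tau> itself.\<close>

definition reg_center :: "real \<Rightarrow> real" where
  "reg_center \<xi> = Taylor_quot m \<xi> - (\<Sum>k=1..m. pole_coeff k * (lattice_pole_reg k ((\<xi> - \<tau>) / T) / T ^ k))"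

text \<open>At the poles \<tau> + l T the difference has only default values, so the removable
  singularity is filled in explicitly, with the same value in every period.\<close>

definition reg_part :: "real \<Rightarrow> real" where
  "reg_part \<xi> = (if (\<xi> - \<tau>) / T \<in> \<int> then reg_center \<tau> else \<F> \<xi> - pole_part \<xi>)"

lemma T_pos: "T > 0"
  using \<tau> by (simp add: T_def)

lemma \<beta>_eq: "\<beta> = \<alpha> + T"
  by (simp add: T_def)

lemma smooth_Taylor_quot: "smooth_on {\<alpha><..<\<beta>} (Taylor_quot i)"
  by (induction i) (use \<tau> in \<open>auto simp: Taylor_quot_def G intro!: smooth_on_divided_diff(1)\<close>)

text \<open>Each divided difference trades one order of differentiation for a factor 1 / (k + 1);
  over i steps these factors telescope to a quotient of factorials.\<close>

lemma higher_deriv_Taylor_quot: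
  "(deriv ^^ k) (Taylor_quot i) \<tau> = fact k / fact (k + i) * (deriv ^^ (k + i)) G \<tau>"
proof (induction i arbitrary: k)
  case (Suc i)
  have "(deriv ^^ k) (Taylor_quot (Suc i)) \<tau> = (deriv ^^ Suc k) (Taylor_quot i) \<tau> / real (Suc k)"
    using smooth_on_divided_diff(2)[OF smooth_Taylor_quot[of i], of \<tau> k] \<tau>
    by (simp add: Taylor_quot_def)
  also have "\<dots> = fact k / fact (k + Suc i) * (deriv ^^ (k + Suc i)) G \<tau>"
    unfolding Suc by (simp add: divide_simps del: of_nat_Suc)
  finally show ?case .
qed (simp add: Taylor_quot_def)

lemma pole_coeff_eq: "pole_coeff k = (deriv ^^ (m - k)) G \<tau> / fact (m - k)"
  using higher_deriv_Taylor_quot[of 0] by (simp add: pole_coeff_def)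

text \<open>Repeated use of u(\<xi>) = u(\<tau>) + (\<xi> - \<tau>) u[\<xi>, \<tau>], an exact
  identity that is trivial at \<xi> = \<tau>.\<close>

lemma Taylor_expansion: "G \<xi> = (\<Sum>i<N. Taylor_quot i \<tau> * (\<xi> - \<tau>) ^ i) + (\<xi> - \<tau>) ^ N * Taylor_quot N \<xi>"
proof (induction N)
  case (Suc N)
  have "Taylor_quot N \<xi> = Taylor_quot N \<tau> + (\<xi> - \<tau>) * Taylor_quot (Suc N) \<xi>"
    by (simp add: Taylor_quot_def divided_diff_def)
  with Suc show ?case
    by (simp add: algebra_simps)
qed (simp add: Taylor_quot_def)

lemma F_eq_principal_part:
  assumes "\<xi> \<in> {\<alpha><..<\<beta>}" "\<xi> \<noteq> \<tau>"
  shows "F \<xi> = Taylor_quot m \<xi> + (\<Sum>k=1..m. pole_coeff k / (\<xi> - \<tau>) ^ k)"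
proof -
  have "(\<Sum>i<m. Taylor_quot i \<tau> * (\<xi> - \<tau>) ^ i) / (\<xi> - \<tau>) ^ m
      = (\<Sum>i<m. Taylor_quot i \<tau> / (\<xi> - \<tau>) ^ (m - i))"
    unfolding sum_divide_distrib
    using assms(2) by (intro sum.cong refl) (simp add: field_simps flip: power_add)
  also have "\<dots> = (\<Sum>k=1..m. pole_coeff k / (\<xi> - \<tau>) ^ k)"
    by (rule sum.reindex_bij_witness[of _ "\<lambda>k. m - k" "\<lambda>i. m - i"]) (auto simp: pole_coeff_def)
  finally show ?thesis
    using assms by (subst F[OF assms], subst Taylor_expansion[where N = m]) (simp add: add_divide_distrib)
qed

lemma F_minus_pole_part:
  assumes "\<xi> \<in> {\<alpha><..<\<beta>}" "\<xi> \<noteq> \<tau>"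
  shows "F \<xi> - pole_part \<xi> = reg_center \<xi>"
proof -
  have "pole_part \<xi> = (\<Sum>k=1..m. pole_coeff k / (\<xi> - \<tau>) ^ k)
      + (\<Sum>k=1..m. pole_coeff k * (lattice_pole_reg k ((\<xi> - \<tau>) / T) / T ^ k))"
    unfolding pole_part_def sum.distrib[symmetric]
  proof (intro sum.cong refl)
    fix k assume "k \<in> {1..m}"
    then show "pole_coeff k * (lattice_pole k ((\<xi> - \<tau>) / T) / T ^ k) =
      pole_coeff k / (\<xi> - \<tau>) ^ k + pole_coeff k * (lattice_pole_reg k ((\<xi> - \<tau>) / T) / T ^ k)"
      using assms(2) T_pos by (subst lattice_pole_eq) (auto simp: field_simps)
  qed
  then show ?thesis
    using F_eq_principal_part[OF assms] by (simp add: reg_center_def)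
qed

lemma \<F>_plus_T: "\<F> (\<xi> + T) = \<F> \<xi>"
  using periodic_ext_plus[of \<alpha> \<beta> F \<xi>] \<tau> by (simp add: T_def)

lemma \<F>_inside: "\<xi> \<in> {\<alpha><..<\<beta>} \<Longrightarrow> \<F> \<xi> = F \<xi>"
  by (rule periodic_ext_inside)

lemma \<F>_right: "\<xi> \<in> {\<beta><..<\<beta> + T} \<Longrightarrow> \<F> \<xi> = F (\<xi> - T)"
  using \<F>_plus_T[of "\<xi> - T"] \<F>_inside[of "\<xi> - T"] by (simp add: \<beta>_eq)

lemma pole_part_plus_T:
  assumes "(\<xi> - \<tau>) / T \<notin> \<int>"
  shows "pole_part (\<xi> + T) = pole_part \<xi>"
proof -
  have "(\<xi> + T - \<tau>) / T = (\<xi> - \<tau>) / T + 1"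
    using T_pos by (simp add: field_simps)
  moreover have "(\<xi> - \<tau>) / T \<noteq> 0"
    using assms by (metis Ints_0)
  ultimately show ?thesis
    unfolding pole_part_def by (intro sum.cong refl) (simp add: lattice_pole_plus1)
qed

lemma reg_part_plus_T: "reg_part (\<xi> + T) = reg_part \<xi>"
proof -
  have "(\<xi> + T - \<tau>) / T = (\<xi> - \<tau>) / T + 1"
    using T_pos by (simp add: field_simps)
  then have "(\<xi> + T - \<tau>) / T \<in> \<int> \<longleftrightarrow> (\<xi> - \<tau>) / T \<in> \<int>"
    by (metis Ints_1 Ints_add Ints_diff add_diff_cancel_right')
  then show ?thesis
    by (auto simp: reg_part_def pole_part_plus_T \<F>_plus_T)
qed

lemma frac_not_Int:
  assumes "\<bar>\<xi> - \<tau>\<bar> < T" "\<xi> \<noteq> \<tau>"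
  shows "(\<xi> - \<tau>) / T \<notin> \<int>"
proof
  assume "(\<xi> - \<tau>) / T \<in> \<int>"
  moreover have "\<bar>(\<xi> - \<tau>) / T\<bar> < 1" "(\<xi> - \<tau>) / T \<noteq> 0"
    using assms T_pos by (auto simp: field_simps abs_divide)
  ultimately show False
    using Ints_nonzero_abs_ge1 by fastforce
qed

lemma reg_part_eq: "\<xi> \<in> {\<tau><..<\<tau> + T} \<Longrightarrow> reg_part \<xi> = \<F> \<xi> - pole_part \<xi>"
  using frac_not_Int[of \<xi>] by (auto simp: reg_part_def)

lemma reg_part_center:
  assumes "\<xi> \<in> {\<alpha><..<\<beta>}"
  shows "reg_part \<xi> = reg_center \<xi>"
proof (cases "\<xi> = \<tau>")
  case False
  have "(\<xi> - \<tau>) / T \<notin> \<int>"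
    using assms False \<tau> by (intro frac_not_Int) (auto simp: T_def abs_if)
  then show ?thesis
    using F_minus_pole_part[OF assms False] by (simp add: reg_part_def \<F>_inside[OF assms])
qed (simp add: reg_part_def)

section \<open>Smoothness away from the seam\<close>

lemma smooth_scaled:
  assumes "smooth_on {l<..<u} f"
  shows "smooth_on {\<tau> + T * l<..<\<tau> + T * u} (\<lambda>\<xi>. f ((\<xi> - \<tau>) / T))"
proof -
  have "smooth_on {\<tau> + T * l<..<\<tau> + T * u} (\<lambda>\<xi>. f ((1 / T) * \<xi> + (- \<tau> / T)))"
    by (rule smooth_on_compose[OF smooth_on_linear assms]) (use T_pos in \<open>auto simp: field_simps\<close>)
  then show ?thesis
    by (simp add: diff_divide_distrib)
qed

lemma smooth_pole_part: "smooth_on {\<tau><..<\<tau> + T} pole_part"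
proof -
  have "smooth_on {\<tau><..<\<tau> + T} (\<lambda>\<xi>. \<Sum>k=1..m. (pole_coeff k / T ^ k) * lattice_pole k ((\<xi> - \<tau>) / T))"
    by (intro smooth_on_sum smooth_on_cmult)
      (use smooth_scaled[OF smooth_on_lattice_pole] in auto)
  then show ?thesis
    by (simp add: pole_part_def[abs_def])
qed

lemma smooth_reg_part: "smooth_on {\<alpha><..<\<beta>} reg_part"
proof -
  have "smooth_on {\<alpha><..<\<beta>} (\<lambda>\<xi>. lattice_pole_reg k ((\<xi> - \<tau>) / T))" for k
    by (rule smooth_on_subset[OF smooth_scaled[OF smooth_on_lattice_pole_reg]])
      (use \<tau> in \<open>auto simp: T_def\<close>)
  then have "smooth_on {\<alpha><..<\<beta>} (\<lambda>\<xi>. Taylor_quot m \<xi>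
      - (\<Sum>k=1..m. (pole_coeff k / T ^ k) * lattice_pole_reg k ((\<xi> - \<tau>) / T)))"
    by (intro smooth_on_diff smooth_Taylor_quot smooth_on_sum smooth_on_cmult) auto
  moreover have "reg_part \<xi> = Taylor_quot m \<xi>
      - (\<Sum>k=1..m. (pole_coeff k / T ^ k) * lattice_pole_reg k ((\<xi> - \<tau>) / T))" if "\<xi> \<in> {\<alpha><..<\<beta>}" for \<xi>
    by (simp add: reg_part_center[OF that] reg_center_def)
  ultimately show ?thesis
    by (subst smooth_on_cong)
qed

lemma smooth_shift:
  assumes "smooth_on {a<..<b} f"
  shows "smooth_on {a + T<..<b + T} (\<lambda>\<xi>. f (\<xi> - T))"
proof -
  have "smooth_on {a + T<..<b + T} (\<lambda>\<xi>. f (1 * \<xi> + (- T)))"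
    by (rule smooth_on_compose[OF smooth_on_linear assms]) auto
  then show ?thesis
    by simp
qed

lemma smooth_reg_part_right: "smooth_on {\<beta><..<\<beta> + T} reg_part"
proof -
  have "reg_part = (\<lambda>\<xi>. reg_part (\<xi> - T))"
    using reg_part_plus_T[of "\<xi> - T" for \<xi>] by auto
  then show ?thesis
    using smooth_shift[OF smooth_reg_part] by (simp add: T_def)
qed

lemma smooth_F: "smooth_on {\<alpha><..<\<tau>} F" "smooth_on {\<tau><..<\<beta>} F"
proof -
  have "smooth_on S F" if "open S" "S \<subseteq> {\<alpha><..<\<beta>}" "\<tau> \<notin> S" for S
  proof -
    have "smooth_on S (\<lambda>\<xi>. G \<xi> / (1 * \<xi> + (- \<tau>)) ^ m)"
      using that by (intro smooth_on_divide smooth_on_power smooth_on_linear smooth_on_subset[OF G]) auto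
    moreover have "F \<xi> = G \<xi> / (1 * \<xi> + (- \<tau>)) ^ m" if "\<xi> \<in> S" for \<xi>
    proof -
      have "\<xi> \<in> {\<alpha><..<\<beta>}" "\<xi> \<noteq> \<tau>"
        using that \<open>S \<subseteq> _\<close> \<open>\<tau> \<notin> S\<close> by auto
      then show ?thesis
        using F by simp
    qed
    ultimately show ?thesis
      by (subst smooth_on_cong)
  qed
  moreover have "{\<alpha><..<\<tau>} \<subseteq> {\<alpha><..<\<beta>}" "{\<tau><..<\<beta>} \<subseteq> {\<alpha><..<\<beta>}"
    using \<tau> by auto
  ultimately show "smooth_on {\<alpha><..<\<tau>} F" "smooth_on {\<tau><..<\<beta>} F"
    by simp_all
qed

lemma smooth_\<F>: "smooth_on {\<tau><..<\<beta>} \<F>" "smooth_on {\<beta><..<\<tau> + T} \<F>"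
proof -
  have "\<F> \<xi> = F \<xi>" if "\<xi> \<in> {\<tau><..<\<beta>}" for \<xi>
    using that \<tau> by (intro \<F>_inside) auto
  then show "smooth_on {\<tau><..<\<beta>} \<F>"
    using smooth_F(2) by (subst smooth_on_cong)
  have "smooth_on {\<beta><..<\<tau> + T} (\<lambda>\<xi>. F (\<xi> - T))"
    using smooth_shift[OF smooth_F(1)] by (simp add: \<beta>_eq)
  moreover have "\<F> \<xi> = F (\<xi> - T)" if "\<xi> \<in> {\<beta><..<\<tau> + T}" for \<xi>
    using that \<tau> by (intro \<F>_right) auto
  ultimately show "smooth_on {\<beta><..<\<tau> + T} \<F>"
    by (subst smooth_on_cong)
qed

section \<open>Regularity at the seam \<beta>\<close>

lemma higher_deriv_\<F>_tendsto:
  assumes "i < q"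
  shows "((deriv ^^ i) \<F> \<longlongrightarrow> 0) (at \<beta>)"
  unfolding filterlim_at_split
proof
  have "\<forall>\<^sub>F \<xi> in at_left \<beta>. (deriv ^^ i) F \<xi> = (deriv ^^ i) \<F> \<xi>"
  proof (rule eventually_mono[OF eventually_at_left_real[of \<tau> \<beta>]])
    fix \<xi> assume "\<xi> \<in> {\<tau><..<\<beta>}"
    then show "(deriv ^^ i) F \<xi> = (deriv ^^ i) \<F> \<xi>"
      using \<tau> by (intro higher_deriv_cong_open[of "{\<tau><..<\<beta>}"] \<F>_inside[symmetric]) auto
  qed (rule \<tau>)
  then show "((deriv ^^ i) \<F> \<longlongrightarrow> 0) (at_left \<beta>)"
    using F_ends[OF assms] Lim_transform_eventually by blast
next
  \<comment> \<open>Right of \<beta> the extension repeats F from the right of \<alpha>, so the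
    limit at \<alpha> is pulled back along the shift by T.\<close>
  have "filterlim (\<lambda>\<xi>. \<xi> - T) (at_right \<alpha>) (at_right \<beta>)"
    unfolding filterlim_at_right_to_0[of _ _ \<beta>] filterlim_at
  proof
    show "((\<lambda>x. x + \<beta> - T) \<longlongrightarrow> \<alpha>) (at_right 0)"
      by (auto intro!: tendsto_eq_intros simp: \<beta>_eq)
    show "\<forall>\<^sub>F x in at_right 0. x + \<beta> - T \<in> {\<alpha><..} \<and> x + \<beta> - T \<noteq> \<alpha>"
      using eventually_at_right_less[of 0] by eventually_elim (auto simp: \<beta>_eq)
  qed
  then have "((\<lambda>\<xi>. (deriv ^^ i) F (\<xi> - T)) \<longlongrightarrow> 0) (at_right \<beta>)"
    using F_ends[OF assms] filterlim_compose by blast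
  moreover have "\<forall>\<^sub>F \<xi> in at_right \<beta>. (deriv ^^ i) F (\<xi> - T) = (deriv ^^ i) \<F> \<xi>"
  proof (rule eventually_mono[OF eventually_at_right_real[of \<beta> "\<tau> + T"]])
    fix \<xi> assume \<xi>: "\<xi> \<in> {\<beta><..<\<tau> + T}"
    have "(deriv ^^ i) F (\<xi> - T) = (deriv ^^ i) (\<lambda>\<xi>. F (\<xi> + - T)) \<xi>"
      by (subst higher_deriv_shift) simp
    also have "\<dots> = (deriv ^^ i) \<F> \<xi>"
      using \<xi> \<tau> by (intro higher_deriv_cong_open[of "{\<beta><..<\<tau> + T}"]) (auto simp: \<F>_right)
    finally show "(deriv ^^ i) F (\<xi> - T) = (deriv ^^ i) \<F> \<xi>" .
  qed (use \<tau> in \<open>simp add: \<beta>_eq\<close>)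
  ultimately show "((deriv ^^ i) \<F> \<longlongrightarrow> 0) (at_right \<beta>)"
    using Lim_transform_eventually by blast
qed

text \<open>Bootstrapping on the order: the extension is 0 at \<beta> by definition; once a
  derivative has the value 0 there, its limit makes it continuous, and the limit 0 of the next
  derivative makes it differentiable with derivative 0, which is the next value.\<close>

lemma higher_deriv_\<F>_at_\<beta>:
  assumes "i < q"
  shows "(deriv ^^ i) \<F> \<beta> = 0" "isCont ((deriv ^^ i) \<F>) \<beta>"
    "Suc i < q \<Longrightarrow> ((deriv ^^ i) \<F> has_real_derivative 0) (at \<beta>)"
proof -
  have cont: "isCont ((deriv ^^ i) \<F>) \<beta>" if "(deriv ^^ i) \<F> \<beta> = 0" "i < q" for i
    using higher_deriv_\<F>_tendsto[OF that(2)] that(1) by (simp add: isCont_def)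
  have d: "((deriv ^^ i) \<F> has_real_derivative 0) (at \<beta>)" if "(deriv ^^ i) \<F> \<beta> = 0" "Suc i < q" for i
  proof (rule has_real_derivative_limit[where f' = "(deriv ^^ Suc i) \<F>"])
    have "\<forall>\<^sub>F \<xi> in at_left \<beta>. ((deriv ^^ i) \<F> has_real_derivative (deriv ^^ Suc i) \<F> \<xi>) (at \<xi>)"
      using eventually_at_left_real[OF \<tau>(2)]
      by (rule eventually_mono) (rule smooth_on_has_deriv[OF smooth_\<F>(1)])
    moreover have "\<forall>\<^sub>F \<xi> in at_right \<beta>. ((deriv ^^ i) \<F> has_real_derivative (deriv ^^ Suc i) \<F> \<xi>) (at \<xi>)"
    proof (rule eventually_mono)
      show "\<forall>\<^sub>F \<xi> in at_right \<beta>. \<xi> \<in> {\<beta><..<\<tau> + T}"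
        using \<tau> by (intro eventually_at_right_real) (simp add: \<beta>_eq)
    qed (rule smooth_on_has_deriv[OF smooth_\<F>(2)])
    ultimately show "\<forall>\<^sub>F \<xi> in at \<beta>. ((deriv ^^ i) \<F> has_real_derivative (deriv ^^ Suc i) \<F> \<xi>) (at \<xi>)"
      by (simp add: eventually_at_split)
  qed (use cont[OF that(1)] that(2) higher_deriv_\<F>_tendsto[OF that(2)] in auto)
  have zero: "(deriv ^^ i) \<F> \<beta> = 0" if "i < q" for i
    using that
  proof (induction i)
    case 0
    then show ?case
      using periodic_ext_right_end \<tau> by simp
  next
    case (Suc i)
    then show ?case
      using DERIV_imp_deriv[OF d[of i]] by simp
  qed
  show "(deriv ^^ i) \<F> \<beta> = 0" "isCont ((deriv ^^ i) \<F>) \<beta>"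
    "Suc i < q \<Longrightarrow> ((deriv ^^ i) \<F> has_real_derivative 0) (at \<beta>)"
    using zero[OF assms] cont d assms by auto
qed

lemma \<F>_interval_cases:
  assumes "\<xi> \<in> {\<tau><..<\<tau> + T}"
  obtains "\<xi> \<in> {\<tau><..<\<beta>}" | "\<xi> = \<beta>" | "\<xi> \<in> {\<beta><..<\<tau> + T}"
  using assms by (cases "\<xi> < \<beta>"; cases "\<xi> = \<beta>") auto

lemma diff_upto_\<F>: "diff_upto (q - 1) {\<tau><..<\<tau> + T} \<F>"
  unfolding diff_upto_def
proof (intro allI impI ballI)
  fix i \<xi> assume i: "i < q - 1" and \<xi>: "\<xi> \<in> {\<tau><..<\<tau> + T}"
  from \<xi> show "(deriv ^^ i) \<F> differentiable (at \<xi>)"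
  proof (cases rule: \<F>_interval_cases)
    case 2
    then show ?thesis
      using higher_deriv_\<F>_at_\<beta>(3)[of i] i DERIV_deriv_iff_real_differentiable[of "(deriv ^^ i) \<F>" \<beta>]
        DERIV_imp_deriv[of "(deriv ^^ i) \<F>" 0 \<beta>] by simp
  qed (use smooth_\<F> in \<open>auto simp: smooth_on_def\<close>)
qed

lemma continuous_on_\<F>: "continuous_on {\<tau><..<\<tau> + T} \<F>"
proof (rule continuous_at_imp_continuous_on, rule ballI)
  fix \<xi> assume "\<xi> \<in> {\<tau><..<\<tau> + T}"
  then show "isCont \<F> \<xi>"
  proof (cases rule: \<F>_interval_cases)
    case 1
    then show ?thesis
      using DERIV_isCont smooth_on_has_deriv[OF smooth_\<F>(1), of \<xi> 0] by fastforce
  next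
    case 2
    then show ?thesis
      using higher_deriv_\<F>_at_\<beta>(2)[of 0] q by simp
  next
    case 3
    then show ?thesis
      using DERIV_isCont smooth_on_has_deriv[OF smooth_\<F>(2), of \<xi> 0] by fastforce
  qed
qed

lemma \<beta>_mem: "\<beta> \<in> {\<tau><..<\<tau> + T}"
  using \<tau> by (simp add: \<beta>_eq)

lemma higher_deriv_reg_part:
  assumes "i < q" "\<xi> \<in> {\<tau><..<\<tau> + T}"
  shows "(deriv ^^ i) reg_part \<xi> = (deriv ^^ i) \<F> \<xi> - (deriv ^^ i) pole_part \<xi>"
proof -
  have "(deriv ^^ i) reg_part \<xi> = (deriv ^^ i) (\<lambda>\<xi>. \<F> \<xi> - pole_part \<xi>) \<xi>"
    by (rule higher_deriv_cong_open[OF open_greaterThanLessThan reg_part_eq assms(2)])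
  also have "\<dots> = (deriv ^^ i) \<F> \<xi> - (deriv ^^ i) pole_part \<xi>"
  proof (rule higher_real_deriv_diff[OF open_greaterThanLessThan _ _ assms(2)])
    show "diff_upto i {\<tau><..<\<tau> + T} \<F>"
      using assms(1) by (intro diff_upto_mono[OF diff_upto_\<F>]) auto
    show "diff_upto i {\<tau><..<\<tau> + T} pole_part"
      using smooth_pole_part smooth_on_iff_diff_upto by blast
  qed
  finally show ?thesis .
qed

lemma reg_part_interval_cases:
  assumes "\<xi> \<in> {\<alpha><..<\<beta> + T}"
  obtains "\<xi> \<in> {\<alpha><..<\<beta>}" | "\<xi> = \<beta>" | "\<xi> \<in> {\<beta><..<\<beta> + T}"
  using assms by (cases "\<xi> < \<beta>"; cases "\<xi> = \<beta>") auto

text \<open>The open interval contains the whole period from \<tau> to \<tau> + T with room on both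
  sides, as the rectangle rule requires. The removed pole and its translate are covered by the two
  smooth pieces; only \<beta> limits the order.\<close>

lemma reg_part_has_deriv:
  assumes "Suc i < q" "\<xi> \<in> {\<alpha><..<\<beta> + T}"
  shows "((deriv ^^ i) reg_part has_real_derivative (deriv ^^ Suc i) reg_part \<xi>) (at \<xi>)"
  using assms(2)
proof (cases rule: reg_part_interval_cases)
  case 1
  then show ?thesis
    by (rule smooth_on_has_deriv[OF smooth_reg_part])
next
  case 2
  have \<xi>: "\<xi> \<in> {\<tau><..<\<tau> + T}"
    using \<beta>_mem 2 by simp
  have "diff_upto (q - 1) {\<tau><..<\<tau> + T} (\<lambda>\<xi>. \<F> \<xi> + (- 1) * pole_part \<xi>)"
    using smooth_on_cmult[OF smooth_pole_part] smooth_on_iff_diff_upto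
    by (intro diff_upto_add diff_upto_\<F>) blast+
  then have "diff_upto (q - 1) {\<tau><..<\<tau> + T} reg_part"
    using diff_upto_cong[OF open_greaterThanLessThan, of \<tau> "\<tau> + T" reg_part "\<lambda>\<xi>. \<F> \<xi> + (- 1) * pole_part \<xi>"]
      reg_part_eq by simp
  then have "(deriv ^^ i) reg_part differentiable (at \<xi>)"
    using assms(1) \<xi> by (auto simp: diff_upto_def)
  then show ?thesis
    by (simp add: DERIV_deriv_iff_real_differentiable)
next
  case 3
  then show ?thesis
    by (rule smooth_on_has_deriv[OF smooth_reg_part_right])
qed

lemma continuous_on_reg_part:
  assumes "i < q"
  shows "continuous_on {\<alpha><..<\<beta> + T} ((deriv ^^ i) reg_part)"
proof (rule continuous_at_imp_continuous_on, rule ballI)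
  fix \<xi> assume "\<xi> \<in> {\<alpha><..<\<beta> + T}"
  then show "isCont ((deriv ^^ i) reg_part) \<xi>"
  proof (cases rule: reg_part_interval_cases)
    case 1
    then show ?thesis
      by (rule DERIV_isCont[OF smooth_on_has_deriv[OF smooth_reg_part]])
  next
    case 2
    have "isCont ((deriv ^^ i) pole_part) \<beta>"
      by (rule DERIV_isCont[OF smooth_on_has_deriv[OF smooth_pole_part \<beta>_mem]])
    then have "isCont (\<lambda>\<xi>. (deriv ^^ i) \<F> \<xi> - (deriv ^^ i) pole_part \<xi>) \<beta>"
      by (intro isCont_diff higher_deriv_\<F>_at_\<beta>(2) assms)
    moreover have ev: "\<forall>\<^sub>F \<xi> in nhds \<beta>. (deriv ^^ i) reg_part \<xi> = (deriv ^^ i) \<F> \<xi> - (deriv ^^ i) pole_part \<xi>"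
      using eventually_nhds_in_open[OF open_greaterThanLessThan \<beta>_mem]
      by (rule eventually_mono) (rule higher_deriv_reg_part[OF assms])
    ultimately show ?thesis
      unfolding 2 by (subst isCont_cong[OF ev])
  next
    case 3
    then show ?thesis
      by (rule DERIV_isCont[OF smooth_on_has_deriv[OF smooth_reg_part_right]])
  qed
qed

section \<open>The rectangle rule for the regular remainder\<close>

lemma higher_deriv_reg_part_plus_T: "(deriv ^^ i) reg_part (\<xi> + T) = (deriv ^^ i) reg_part \<xi>"
  using higher_deriv_shift[of i reg_part T \<xi>] by (simp add: reg_part_plus_T)

lemma reg_part_variation:
  obtains V :: real where
    "\<forall>\<^sub>F n in sequentially. \<forall>y. (\<forall>j<n. y j \<in> {\<tau> + real j * (T / real n)..\<tau> + real (Suc j) * (T / real n)}) \<longrightarrow>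
      (\<Sum>j<n. \<bar>(deriv ^^ (q - 1)) reg_part (y j) - (deriv ^^ (q - 1)) reg_part (\<tau> + real j * (T / real n))\<bar>) \<le> V"
proof -
  let ?f = "(deriv ^^ (q - 1)) reg_part" and ?g = "(deriv ^^ (q - 1)) \<F>" and ?p = "(deriv ^^ (q - 1)) pole_part"
  obtain \<delta>0 where \<delta>0: "\<delta>0 > 0" "abs_continuous_on {\<beta> - \<delta>0..\<beta> + \<delta>0} ?g"
    using F_q by blast
  \<comment> \<open>The window of absolute continuity is shrunk into the interior of the period,
    where \<open>reg_part\<close> is the extension minus \<open>pole_part\<close> and the latter is
    smooth.\<close>
  define \<delta> where "\<delta> = min \<delta>0 (min ((\<beta> - \<tau>) / 2) ((\<tau> + T - \<beta>) / 2))"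
  have \<delta>: "\<delta> > 0" "\<delta> \<le> \<delta>0" "\<tau> < \<beta> - \<delta>" "\<beta> + \<delta> < \<tau> + T"
  proof -
    have "\<beta> - \<tau> > 0" "\<tau> + T - \<beta> > 0"
      using \<beta>_mem by auto
    then show "\<delta> > 0" "\<delta> \<le> \<delta>0" "\<tau> < \<beta> - \<delta>" "\<beta> + \<delta> < \<tau> + T"
      using \<delta>0 by (auto simp: \<delta>_def min_def field_simps)
  qed
  have "{\<beta> - \<delta>..\<beta> + \<delta>} \<subseteq> {\<beta> - \<delta>0..\<beta> + \<delta>0}"
    using \<delta>(2) by auto
  with \<delta>0(2) have ac: "abs_continuous_on {\<beta> - \<delta>..\<beta> + \<delta>} ?g"
    unfolding abs_continuous_on_def by (meson order_trans)
  obtain L1 where L1: "L1 \<ge> 0"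
    "\<And>x y. \<tau> \<le> x \<Longrightarrow> x \<le> y \<Longrightarrow> y \<le> \<beta> - \<delta> / 2 \<Longrightarrow> \<bar>?f y - ?f x\<bar> \<le> L1 * (y - x)"
    using smooth_on_Lipschitz[OF smooth_reg_part, of \<tau> "\<beta> - \<delta> / 2" "q - 1"] \<tau> \<delta> by auto
  obtain L2 where L2: "L2 \<ge> 0"
    "\<And>x y. \<beta> + \<delta> / 2 \<le> x \<Longrightarrow> x \<le> y \<Longrightarrow> y \<le> \<tau> + T \<Longrightarrow> \<bar>?f y - ?f x\<bar> \<le> L2 * (y - x)"
    using smooth_on_Lipschitz[OF smooth_reg_part_right, of "\<beta> + \<delta> / 2" "\<tau> + T" "q - 1"] \<tau> \<delta> by auto
  obtain L3 where L3: "L3 \<ge> 0"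
    "\<And>x y. \<beta> - \<delta> \<le> x \<Longrightarrow> x \<le> y \<Longrightarrow> y \<le> \<beta> + \<delta> \<Longrightarrow> \<bar>?p y - ?p x\<bar> \<le> L3 * (y - x)"
    using smooth_on_Lipschitz[OF smooth_pole_part, of "\<beta> - \<delta>" "\<beta> + \<delta>" "q - 1"] \<delta> by auto
  define L where "L = L1 + L2 + L3"
  have Lx: "L1 * z \<le> L * z" "L2 * z \<le> L * z" "L3 * z \<le> L * z" if "z \<ge> 0" for z
    using that L1(1) L2(1) L3(1) by (auto simp: L_def intro!: mult_right_mono)
  \<comment> \<open>The Lipschitz regions reach to within \<delta> / 2 of \<beta> and the window
    extends to \<delta>. The overlap has width \<delta> / 2, so a shorter cell leaving both
    Lipschitz regions lies entirely in the window.\<close>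
  have main: "\<bar>?f y - ?f x\<bar> \<le> L * (y - x) \<or>
      \<beta> - \<delta> \<le> x \<and> y \<le> \<beta> + \<delta> \<and> \<bar>?f y - ?f x\<bar> \<le> \<bar>?g y - ?g x\<bar> + L * (y - x)"
    if xy: "\<tau> \<le> x" "x \<le> y" "y \<le> \<tau> + T" "y - x < \<delta> / 2" for x y
  proof (cases "y \<le> \<beta> - \<delta> / 2")
    case True
    then show ?thesis
      using L1(2)[OF xy(1,2) True] Lx(1)[of "y - x"] xy(2) by linarith
  next
    case y: False
    show ?thesis
    proof (cases "\<beta> + \<delta> / 2 \<le> x")
      case True
      then show ?thesis
        using L2(2)[OF True xy(2,3)] Lx(2)[of "y - x"] xy(2) by linarith
    next
      case False
      have r: "\<beta> - \<delta> \<le> x" "y \<le> \<beta> + \<delta>"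
        using y False xy(4) by auto
      have "?f x = ?g x - ?p x" "?f y = ?g y - ?p y"
        using r xy(2) \<delta> q by (auto intro!: higher_deriv_reg_part)
      then show ?thesis
        using L3(2)[OF r(1) xy(2) r(2)] Lx(3)[of "y - x"] xy(2) r by (intro disjI2) linarith
    qed
  qed
  show thesis
    by (rule bounded_cell_variation[where \<tau> = \<tau> and \<eta> = "\<delta> / 2" and L = L, OF T_pos _ _ ac main that])
      (use \<delta>(1) L1(1) L2(1) L3(1) in \<open>auto simp: L_def\<close>)
qed

lemma reg_part_rectangle_rule:
  "(\<lambda>n. T / real n * (\<Sum>j<n. reg_part (\<tau> + real j * (T / real n))) - integral {\<tau>..\<tau> + T} reg_part)
    \<in> O(\<lambda>n. 1 / real n ^ q)"
proof -
  obtain V where "\<forall>\<^sub>F n in sequentially. \<forall>y. (\<forall>j<n. y j \<in> {\<tau> + real j * (T / real n)..\<tau> + real (Suc j) * (T / real n)}) \<longrightarrow>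
      (\<Sum>j<n. \<bar>(deriv ^^ (q - 1)) reg_part (y j) - (deriv ^^ (q - 1)) reg_part (\<tau> + real j * (T / real n))\<bar>) \<le> V"
    using reg_part_variation .
  from rectangle_rule_periodic[where D = "\<lambda>i. (deriv ^^ i) reg_part" and l = \<alpha> and u = "\<beta> + T",
      OF T_pos q _ _ reg_part_has_deriv continuous_on_reg_part higher_deriv_reg_part_plus_T this]
  show ?thesis
    using \<tau> q by simp
qed

end

section \<open>Quadrature and finite part\<close>

text \<open>The scaled endpoints are \<epsilon> / T and 1 - \<epsilon> / T, exactly the reflected
  pair for which the increment of the antiderivative is known. The division by
  \<open>real k - 1\<close> concerns only even k, hence never k = 1.\<close>

lemma lattice_pole_scaled_has_integral:
  assumes k: "k \<ge> 1" and T: "T > 0" and \<epsilon>: "0 < \<epsilon>" "\<epsilon> < T / 2"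
  shows "((\<lambda>\<xi>. lattice_pole k ((\<xi> - \<tau>) / T) / T ^ k) has_integral
    (if even k then 2 * (lattice_pole (k - 1) (\<epsilon> / T) / T ^ (k - 1)) / (real k - 1) else 0))
    {\<tau> + \<epsilon>..\<tau> + T - \<epsilon>}"
proof -
  obtain A where A: "\<And>x. x \<in> {0<..<1} \<Longrightarrow> (A has_real_derivative lattice_pole k x) (at x)"
    "\<And>x. A (1 - x) - A x = (if even k then 2 * lattice_pole (k - 1) x / (real k - 1) else 0)"
    by (rule lattice_pole_antideriv[OF k]) (rule that)
  have "((\<lambda>\<xi>. lattice_pole k ((\<xi> - \<tau>) / T) / T ^ k) has_integral
    (A ((\<tau> + T - \<epsilon> - \<tau>) / T) / T ^ (k - 1) - A ((\<tau> + \<epsilon> - \<tau>) / T) / T ^ (k - 1))) {\<tau> + \<epsilon>..\<tau> + T - \<epsilon>}"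
  proof (rule fundamental_theorem_of_calculus)
    fix \<xi> assume "\<xi> \<in> {\<tau> + \<epsilon>..\<tau> + T - \<epsilon>}"
    then have mem: "(\<xi> - \<tau>) / T \<in> {0<..<1}"
      using T \<epsilon> by (auto simp: field_simps)
    have "((\<lambda>\<xi>. (\<xi> - \<tau>) / T) has_real_derivative 1 / T) (at \<xi>)"
      using T by (auto intro!: derivative_eq_intros)
    from DERIV_cdivide[OF DERIV_chain2[OF A(1)[OF mem] this], of "T ^ (k - 1)"]
    have "((\<lambda>\<xi>. A ((\<xi> - \<tau>) / T) / T ^ (k - 1)) has_real_derivative
        lattice_pole k ((\<xi> - \<tau>) / T) * (1 / T) / T ^ (k - 1)) (at \<xi>)" .
    moreover have "lattice_pole k ((\<xi> - \<tau>) / T) * (1 / T) / T ^ (k - 1) = lattice_pole k ((\<xi> - \<tau>) / T) / T ^ k"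
      using k T by (cases k) auto
    ultimately have "((\<lambda>\<xi>. A ((\<xi> - \<tau>) / T) / T ^ (k - 1)) has_real_derivative
        lattice_pole k ((\<xi> - \<tau>) / T) / T ^ k) (at \<xi>)"
      by (rule DERIV_cong)
    then show "((\<lambda>\<xi>. A ((\<xi> - \<tau>) / T) / T ^ (k - 1)) has_vector_derivative
        lattice_pole k ((\<xi> - \<tau>) / T) / T ^ k) (at \<xi> within {\<tau> + \<epsilon>..\<tau> + T - \<epsilon>})"
      unfolding has_real_derivative_iff_has_vector_derivative[symmetric]
      by (rule has_field_derivative_at_within)
  qed (use \<epsilon> in auto)
  moreover have "A ((\<tau> + T - \<epsilon> - \<tau>) / T) / T ^ (k - 1) - A ((\<tau> + \<epsilon> - \<tau>) / T) / T ^ (k - 1)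
      = (A (1 - \<epsilon> / T) - A (\<epsilon> / T)) / T ^ (k - 1)"
    using T by (simp add: diff_divide_distrib)
  ultimately show ?thesis
    unfolding A(2) by (simp add: mult.commute split: if_splits)
qed

lemma T_hat_bigo:
  assumes "(\<lambda>n. T_hat0 m P \<tau> F G n - I) \<in> O(\<lambda>n. 1 / real n ^ q)"
  shows "(\<lambda>n. T_hat s m P \<tau> F G n - I) \<in> O(\<lambda>n. 1 / real n ^ q)"
proof (induction s)
  case (Suc s)
  define c :: real where "c = 2 powi (2 * int (Suc s) - 3)"
  \<comment> \<open>The exponent is odd: -1 at the first step, giving 1/2, and positive
    afterwards.\<close>
  have c: "c \<noteq> 1"
  proof (cases s)
    case 0
    then show ?thesis
      by (simp add: c_def power_int_minus)
  next
    case (Suc r)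
    then have "2 * int (Suc s) - 3 = int (2 * r + 1)"
      by simp
    then have "c = 2 ^ (2 * r + 1)"
      unfolding c_def by (simp only: power_int_of_nat)
    then show ?thesis
      using one_less_power[of "2 :: real" "2 * r + 1"] by simp
  qed
  have "(\<lambda>n. T_hat s m P \<tau> F G (2 * n) - I) \<in> O(\<lambda>n. 1 / real (2 * n) ^ q)"
    by (rule landau_o.big.compose[OF Suc]) (auto intro: filterlim_subseq simp: strict_mono_def)
  also have "(\<lambda>n. 1 / real (2 * n) ^ q) \<in> O(\<lambda>n. 1 / real n ^ q)"
    by (rule bigoI[of _ "1 / 2 ^ q"]) (simp add: power_mult_distrib)
  finally have "(\<lambda>n. c / (c - 1) * (T_hat s m P \<tau> F G n - I) - 1 / (c - 1) * (T_hat s m P \<tau> F G (2 * n) - I))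
      \<in> O(\<lambda>n. 1 / real n ^ q)"
    using landau_o.big.mult[OF bigo_const[of "c / (c - 1)"] Suc]
      landau_o.big.mult[OF bigo_const[of "1 / (c - 1)"], of "\<lambda>n. T_hat s m P \<tau> F G (2 * n) - I"]
    by (intro sum_in_bigo) simp_all
  moreover have "c / (c - 1) * (x - I) - 1 / (c - 1) * (y - I) = (c * x - y) / (c - 1) - I" for x y
    using c by (simp add: divide_simps) (simp add: algebra_simps)
  moreover have "T_hat (Suc s) m P \<tau> F G n = (c * T_hat s m P \<tau> F G n - T_hat s m P \<tau> F G (2 * n)) / (c - 1)" for n
    by (simp only: T_hat.simps c_def)
  ultimately show ?case
    by (simp only:)
qed (use assms in simp)

section \<open>The quadrature formula as a rectangle sum\<close>

context pole_integrand
begin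

text \<open>Removes the case distinction on m: with k = 2 r - 2 i, the derivative order m - k is 2 i
  for even m and 2 i + 1 for odd m, so in both cases the corrections run over the Laurent
  coefficients of even order k \<le> m.\<close>

lemma T_hat0_eq_even_sum:
  assumes "n > 0"
  shows "T_hat0 m T \<tau> \<F> G n = T / real n * (\<Sum>j=1..n-1. \<F> (\<tau> + real j * (T / real n)))
    - (\<Sum>k | k \<le> m \<and> even k. 2 * pole_coeff k * zeta_nat k * (T / real n) powi (1 - int k))"
proof -
  define r where "r = m div 2"
  define h where "h = T / real n"
  have reindex: "(\<Sum>k | k \<le> m \<and> even k. f k) = (\<Sum>i=0..r. f (2 * r - 2 * i))" for f :: "nat \<Rightarrow> real"
    by (rule sum.reindex_bij_witness[of _ "\<lambda>i. 2 * r - 2 * i" "\<lambda>k. r - k div 2"])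
      (auto simp: r_def elim!: evenE intro!: arg_cong[of _ _ f])
  have powi: "1 - int (2 * r - 2 * i) = - 2 * int r + 2 * int i + 1" if "i \<le> r" for i
    using that by (simp add: of_nat_diff)
  show ?thesis
  proof (cases "even m")
    case True
    then have order: "m - (2 * r - 2 * i) = 2 * i" if "i \<le> r" for i
      using that by (auto simp: r_def elim!: evenE)
    then have "(\<Sum>k | k \<le> m \<and> even k. 2 * pole_coeff k * zeta_nat k * h powi (1 - int k))
        = 2 * (\<Sum>i=0..r. (deriv ^^ (2 * i)) G \<tau> / fact (2 * i) * zeta_nat (2 * r - 2 * i)
                              * h powi (- 2 * int r + 2 * int i + 1))"
      unfolding reindex sum_distrib_left
    proof (intro sum.cong refl)
      fix i assume "i \<in> {0..r}"
      then have i: "i \<le> r"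
        by simp
      show "2 * pole_coeff (2 * r - 2 * i) * zeta_nat (2 * r - 2 * i) * h powi (1 - int (2 * r - 2 * i))
          = 2 * ((deriv ^^ (2 * i)) G \<tau> / fact (2 * i) * zeta_nat (2 * r - 2 * i)
                              * h powi (- 2 * int r + 2 * int i + 1))"
        unfolding pole_coeff_eq order[OF i] powi[OF i] by (simp only: mult.assoc)
    qed
    then show ?thesis
      using True by (simp add: T_hat0_def Let_def r_def h_def)
  next
    case False
    then have order: "m - (2 * r - 2 * i) = 2 * i + 1" if "i \<le> r" for i
      using that by (auto simp: r_def elim!: oddE)
    then have "(\<Sum>k | k \<le> m \<and> even k. 2 * pole_coeff k * zeta_nat k * h powi (1 - int k))
        = 2 * (\<Sum>i=0..r. (deriv ^^ (2 * i + 1)) G \<tau> / fact (2 * i + 1) * zeta_nat (2 * r - 2 * i)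
                              * h powi (- 2 * int r + 2 * int i + 1))"
      unfolding reindex sum_distrib_left
    proof (intro sum.cong refl)
      fix i assume "i \<in> {0..r}"
      then have i: "i \<le> r"
        by simp
      show "2 * pole_coeff (2 * r - 2 * i) * zeta_nat (2 * r - 2 * i) * h powi (1 - int (2 * r - 2 * i))
          = 2 * ((deriv ^^ (2 * i + 1)) G \<tau> / fact (2 * i + 1) * zeta_nat (2 * r - 2 * i)
                              * h powi (- 2 * int r + 2 * int i + 1))"
        unfolding pole_coeff_eq order[OF i] powi[OF i] by (simp only: mult.assoc)
    qed
    then show ?thesis
      using False by (simp add: T_hat0_def Let_def r_def h_def)
  qed
qed

text \<open>The zeta terms of the quadrature formula are exactly the lattice sums over the grid; the missing node
  \<open>\<tau>\<close> is accounted for by \<open>\<zeta>(0) = -1/2\<close>.\<close>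

lemma T_hat0_eq_rectangle_sum:
  assumes n: "n > 0"
  shows "T_hat0 m T \<tau> \<F> G n = T / real n * (\<Sum>j<n. reg_part (\<tau> + real j * (T / real n)))"
proof -
  define h where "h = T / real n"
  define E where "E = {k. 1 \<le> k \<and> k \<le> m \<and> even k}"
  have h: "h > 0" "real n * h = T"
    using n T_pos by (auto simp: h_def)
  have nodes: "\<tau> + real j * h \<in> {\<tau><..<\<tau> + T}" if "j \<in> {1..n-1}" for j
  proof -
    have "real j * h < real n * h" "0 < real j * h"
      using that n h by (auto intro!: mult_strict_right_mono)
    then show "\<tau> + real j * h \<in> {\<tau><..<\<tau> + T}"
      using h by simp
  qed
  have node_scaled: "real j * h / T = real j / real n" for j
    using T_pos n by (simp add: h_def)
  have E_sum: "(\<Sum>k=1..m. if even k then f k else 0) = sum f E" for f :: "nat \<Rightarrow> real"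
  proof -
    have "E = {1..m} \<inter> {k. even k}"
      by (auto simp: E_def)
    then show ?thesis
      by (simp add: sum.inter_restrict)
  qed
  have poles: "(\<Sum>j=1..n-1. pole_part (\<tau> + real j * h))
      = (\<Sum>k\<in>E. 2 * pole_coeff k * zeta_nat k * (real n ^ k - 1) / T ^ k)"
  proof -
    have "(\<Sum>j=1..n-1. pole_part (\<tau> + real j * h))
        = (\<Sum>j=1..n-1. \<Sum>k=1..m. pole_coeff k * (lattice_pole k (real j / real n) / T ^ k))"
      unfolding pole_part_def by (intro sum.cong refl) (simp add: node_scaled)
    also have "\<dots> = (\<Sum>k=1..m. pole_coeff k * ((\<Sum>j=1..n-1. lattice_pole k (real j / real n)) / T ^ k))"
      by (subst sum.swap) (simp add: sum_distrib_left sum_divide_distrib)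
    also have "\<dots> = (\<Sum>k=1..m. if even k then 2 * pole_coeff k * zeta_nat k * (real n ^ k - 1) / T ^ k else 0)"
    proof (intro sum.cong refl)
      fix k assume "k \<in> {1..m}"
      then have "k \<ge> 1"
        by simp
      show "pole_coeff k * ((\<Sum>j=1..n-1. lattice_pole k (real j / real n)) / T ^ k)
          = (if even k then 2 * pole_coeff k * zeta_nat k * (real n ^ k - 1) / T ^ k else 0)"
        by (simp only: sum_lattice_pole[OF \<open>k \<ge> 1\<close> n]) simp
    qed
    finally show ?thesis
      by (simp only: E_sum)
  qed
  have center: "reg_part \<tau> = pole_coeff 0 - (\<Sum>k\<in>E. 2 * pole_coeff k * zeta_nat k / T ^ k)"
  proof -
    have "reg_part \<tau> = pole_coeff 0 - (\<Sum>k=1..m. pole_coeff k * (lattice_pole_reg k 0 / T ^ k))"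
      by (simp add: reg_part_def reg_center_def pole_coeff_def)
    also have "(\<Sum>k=1..m. pole_coeff k * (lattice_pole_reg k 0 / T ^ k))
        = (\<Sum>k=1..m. if even k then 2 * pole_coeff k * zeta_nat k / T ^ k else 0)"
    proof (intro sum.cong refl)
      fix k assume "k \<in> {1..m}"
      then have "k \<ge> 2" if "even k"
        using that by (cases "k = 1") auto
      then show "pole_coeff k * (lattice_pole_reg k 0 / T ^ k)
          = (if even k then 2 * pole_coeff k * zeta_nat k / T ^ k else 0)"
        by (simp add: lattice_pole_reg_0 lattice_pole_reg_0_even)
    qed
    finally show ?thesis
      by (simp only: E_sum)
  qed
  have "(\<Sum>j<n. reg_part (\<tau> + real j * h)) = reg_part \<tau> + (\<Sum>j=1..n-1. reg_part (\<tau> + real j * h))"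
  proof -
    have "{..<n} = insert 0 {1..n-1}"
      using n by auto
    then show ?thesis
      by simp
  qed
  also have "(\<Sum>j=1..n-1. reg_part (\<tau> + real j * h))
      = (\<Sum>j=1..n-1. \<F> (\<tau> + real j * h)) - (\<Sum>j=1..n-1. pole_part (\<tau> + real j * h))"
    unfolding sum_subtractf[symmetric] by (intro sum.cong refl reg_part_eq nodes)
  finally have "(\<Sum>j<n. reg_part (\<tau> + real j * h)) = (\<Sum>j=1..n-1. \<F> (\<tau> + real j * h)) + pole_coeff 0
      - ((\<Sum>k\<in>E. 2 * pole_coeff k * zeta_nat k / T ^ k)
        + (\<Sum>k\<in>E. 2 * pole_coeff k * zeta_nat k * (real n ^ k - 1) / T ^ k))"
    unfolding poles center by simp
  \<comment> \<open>The value at the node \<tau> cancels the -1 in n^k - 1, leaving n^k / T^k, which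
    is a pure power of h.\<close>
  also have "(\<Sum>k\<in>E. 2 * pole_coeff k * zeta_nat k / T ^ k)
        + (\<Sum>k\<in>E. 2 * pole_coeff k * zeta_nat k * (real n ^ k - 1) / T ^ k)
      = (\<Sum>k\<in>E. 2 * pole_coeff k * zeta_nat k / h ^ k)"
    unfolding sum.distrib[symmetric]
  proof (intro sum.cong refl)
    fix k
    have "1 / h ^ k = real n ^ k / T ^ k"
      by (simp add: h_def power_divide)
    then show "2 * pole_coeff k * zeta_nat k / T ^ k + 2 * pole_coeff k * zeta_nat k * (real n ^ k - 1) / T ^ k
        = 2 * pole_coeff k * zeta_nat k / h ^ k"
      by (simp add: h_def power_divide algebra_simps diff_divide_distrib)
  qed
  finally have sum_reg: "(\<Sum>j<n. reg_part (\<tau> + real j * h)) = (\<Sum>j=1..n-1. \<F> (\<tau> + real j * h)) + pole_coeff 0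
      - (\<Sum>k\<in>E. 2 * pole_coeff k * zeta_nat k / h ^ k)" .
  have sum_eq: "h * (\<Sum>j<n. reg_part (\<tau> + real j * h)) = h * (\<Sum>j=1..n-1. \<F> (\<tau> + real j * h))
      - (- h * pole_coeff 0 + h * (\<Sum>k\<in>E. 2 * pole_coeff k * zeta_nat k / h ^ k))"
    unfolding sum_reg by (simp add: algebra_simps)
  have "- h * pole_coeff 0 + h * (\<Sum>k\<in>E. 2 * pole_coeff k * zeta_nat k / h ^ k)
      = (\<Sum>k\<in>insert 0 E. 2 * pole_coeff k * zeta_nat k * h powi (1 - int k))"
  proof -
    have "finite E" "0 \<notin> E"
      by (auto simp: E_def)
    moreover have "h * (2 * pole_coeff k * zeta_nat k / h ^ k) = 2 * pole_coeff k * zeta_nat k * h powi (1 - int k)" for k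
      using h by (simp add: power_int_diff)
    ultimately show ?thesis
      by (simp add: zeta_nat_0 sum_distrib_left)
  qed
  also have "insert 0 E = {k. k \<le> m \<and> even k}"
    by (auto simp: E_def)
  finally show ?thesis
    using sum_eq by (simp add: T_hat0_eq_even_sum[OF n] h_def)
qed

lemma T_hat0_bigo:
  "(\<lambda>n. T_hat0 m T \<tau> \<F> G n - integral {\<tau>..\<tau> + T} reg_part) \<in> O(\<lambda>n. 1 / real n ^ q)"
proof -
  have ev: "\<forall>\<^sub>F n in sequentially. T_hat0 m T \<tau> \<F> G n - integral {\<tau>..\<tau> + T} reg_part
      = T / real n * (\<Sum>j<n. reg_part (\<tau> + real j * (T / real n))) - integral {\<tau>..\<tau> + T} reg_part"
    by (rule eventually_mono[OF eventually_gt_at_top[of 0]]) (simp only: T_hat0_eq_rectangle_sum)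
  show ?thesis
    unfolding landau_o.big.in_cong[OF ev] by (rule reg_part_rectangle_rule)
qed

section \<open>The finite part as the integral of the regular remainder\<close>

lemma reg_part_integrable: "reg_part integrable_on {\<tau>..\<tau> + T}"
proof (rule integrable_continuous_real)
  have "continuous_on {\<alpha><..<\<beta> + T} reg_part"
    using continuous_on_reg_part[of 0] q by simp
  then show "continuous_on {\<tau>..\<tau> + T} reg_part"
    by (rule continuous_on_subset) (use \<tau> in \<open>auto simp: \<beta>_eq\<close>)
qed

lemma integral_reg_part_tendsto:
  "((\<lambda>\<epsilon>. integral {\<tau> + \<epsilon>..\<tau> + T - \<epsilon>} reg_part) \<longlongrightarrow> integral {\<tau>..\<tau> + T} reg_part) (at_right 0)"
proof -
  define \<Phi> where "\<Phi> x = integral {\<tau>..x} reg_part" for x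
  have cont: "continuous_on {\<tau>..\<tau> + T} \<Phi>"
    unfolding \<Phi>_def by (rule indefinite_integral_continuous_1[OF reg_part_integrable])
  have small: "\<forall>\<^sub>F \<epsilon> in at_right 0. \<epsilon> \<in> {0<..<T / 2}"
    using T_pos by (intro eventually_at_right_real) simp
  have "((\<lambda>\<epsilon>. \<Phi> (\<tau> + T - \<epsilon>)) \<longlongrightarrow> \<Phi> (\<tau> + T)) (at_right 0)"
  proof (rule continuous_on_tendsto_compose[OF cont])
    show "((\<lambda>\<epsilon>. \<tau> + T - \<epsilon>) \<longlongrightarrow> \<tau> + T) (at_right 0)"
      by (auto intro!: tendsto_eq_intros)
    show "\<forall>\<^sub>F \<epsilon> in at_right 0. \<tau> + T - \<epsilon> \<in> {\<tau>..\<tau> + T}"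
      using small by eventually_elim auto
  qed (use T_pos in auto)
  moreover have "((\<lambda>\<epsilon>. \<Phi> (\<tau> + \<epsilon>)) \<longlongrightarrow> \<Phi> \<tau>) (at_right 0)"
  proof (rule continuous_on_tendsto_compose[OF cont])
    show "((\<lambda>\<epsilon>. \<tau> + \<epsilon>) \<longlongrightarrow> \<tau>) (at_right 0)"
      by (auto intro!: tendsto_eq_intros)
    show "\<forall>\<^sub>F \<epsilon> in at_right 0. \<tau> + \<epsilon> \<in> {\<tau>..\<tau> + T}"
      using small by eventually_elim auto
  qed (use T_pos in auto)
  ultimately have "((\<lambda>\<epsilon>. \<Phi> (\<tau> + T - \<epsilon>) - \<Phi> (\<tau> + \<epsilon>)) \<longlongrightarrow> \<Phi> (\<tau> + T) - \<Phi> \<tau>) (at_right 0)"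
    by (rule tendsto_diff)
  moreover have "\<forall>\<^sub>F \<epsilon> in at_right 0. \<Phi> (\<tau> + T - \<epsilon>) - \<Phi> (\<tau> + \<epsilon>) = integral {\<tau> + \<epsilon>..\<tau> + T - \<epsilon>} reg_part"
    using small
  proof eventually_elim
    case (elim \<epsilon>)
    have "integral {\<tau>..\<tau> + \<epsilon>} reg_part + integral {\<tau> + \<epsilon>..\<tau> + T - \<epsilon>} reg_part = integral {\<tau>..\<tau> + T - \<epsilon>} reg_part"
      using elim by (intro Henstock_Kurzweil_Integration.integral_combine
          integrable_on_subinterval[OF reg_part_integrable]) auto
    then show ?case
      by (simp add: \<Phi>_def)
  qed
  moreover have "\<Phi> \<tau> = 0"
    by (simp add: \<Phi>_def)
  ultimately show ?thesis
    by (simp add: tendsto_cong \<Phi>_def)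
qed

lemma \<F>_integrable:
  assumes "\<tau> < a" "b < \<tau> + T"
  shows "\<F> integrable_on {a..b}"
  by (intro integrable_continuous_real continuous_on_subset[OF continuous_on_\<F>]) (use assms in auto)

text \<open>Shifting the left piece by one period makes the two truncated pieces adjacent at
  \<beta>. F may take any values at \<alpha> and \<beta> while the extension is 0 there, so single
  points are discarded.\<close>

lemma F_integrals:
  assumes \<epsilon>: "\<epsilon> > 0"
  shows "F integrable_on {\<alpha>..\<tau> - \<epsilon>}" "F integrable_on {\<tau> + \<epsilon>..\<beta>}"
    "integral {\<alpha>..\<tau> - \<epsilon>} F = integral {\<beta>..\<tau> + T - \<epsilon>} \<F>"
    "integral {\<tau> + \<epsilon>..\<beta>} F = integral {\<tau> + \<epsilon>..\<beta>} \<F>"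
proof -
  have right: "\<F> x = F x" if "x \<in> {\<tau> + \<epsilon>..\<beta>} - {\<beta>}" for x
    using that \<epsilon> \<tau> by (intro \<F>_inside) auto
  have int: "\<F> integrable_on {\<tau> + \<epsilon>..\<beta>}"
    using \<epsilon> \<beta>_mem by (intro \<F>_integrable) auto
  show "F integrable_on {\<tau> + \<epsilon>..\<beta>}"
    by (rule integrable_spike_finite[of "{\<beta>}", OF _ _ int]) (simp_all add: right)
  show "integral {\<tau> + \<epsilon>..\<beta>} F = integral {\<tau> + \<epsilon>..\<beta>} \<F>"
    by (rule integral_spike[of "{\<beta>}"]) (use right in auto)
  have left: "\<F> (x + T) = F x" if "x \<in> {\<alpha>..\<tau> - \<epsilon>} - {\<alpha>}" for x
    using that \<epsilon> \<tau> \<F>_plus_T[of x] \<F>_inside[of x] by auto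
  have int': "(\<lambda>x. \<F> (x + T)) integrable_on {\<alpha>..\<tau> - \<epsilon>}"
    by (intro integrable_continuous_real continuous_on_compose2[OF continuous_on_\<F>] continuous_intros)
      (use \<epsilon> \<tau> in \<open>auto simp: T_def\<close>)
  show "F integrable_on {\<alpha>..\<tau> - \<epsilon>}"
    by (rule integrable_spike_finite[of "{\<alpha>}", OF _ _ int']) (simp_all add: left)
  have "integral {\<alpha>..\<tau> - \<epsilon>} F = integral {\<alpha>..\<tau> - \<epsilon>} (\<lambda>x. \<F> (x + T))"
    by (rule integral_spike[of "{\<alpha>}"]) (use left in auto)
  also have "\<dots> = integral {\<beta>..\<tau> + T - \<epsilon>} \<F>"
    using integral_shift_real_ivl[of \<beta> T "\<tau> + T - \<epsilon>" \<F>] by (simp add: \<beta>_eq)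
  finally show "integral {\<alpha>..\<tau> - \<epsilon>} F = integral {\<beta>..\<tau> + T - \<epsilon>} \<F>" .
qed

lemma integral_pole_part:
  assumes "0 < \<epsilon>" "\<epsilon> < T / 2"
  shows "(pole_part has_integral (\<Sum>k=1..m. pole_coeff k *
    (if even k then 2 * (lattice_pole (k - 1) (\<epsilon> / T) / T ^ (k - 1)) / (real k - 1) else 0)))
    {\<tau> + \<epsilon>..\<tau> + T - \<epsilon>}"
  unfolding pole_part_def[abs_def]
  by (intro has_integral_sum has_integral_mult_right lattice_pole_scaled_has_integral T_pos assms) auto

text \<open>Symmetric truncation leaves from \<open>pole_part\<close> only even k, hence pure powers
  \<epsilon>^(1-k) and no logarithm, plus terms in \<open>lattice_pole_reg (k - 1)\<close> at
  \<epsilon> / T. The latter tend to 0 because k - 1 is odd.\<close>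

lemma has_finite_part_F: "has_finite_part F \<alpha> \<beta> \<tau> (integral {\<tau>..\<tau> + T} reg_part)"
proof -
  define E where "E = {k. 1 \<le> k \<and> k \<le> m \<and> even k}"
  define S where "S = (\<lambda>k. (1 - real k, 0 :: nat)) ` E"
  \<comment> \<open>The scale is indexed by exponents p = 1 - k, so the pole order is recovered from
    p as \<open>nat \<lfloor>1 - p\<rfloor>\<close>.\<close>
  define c :: "real \<times> nat \<Rightarrow> real" where "c = (\<lambda>(p, _). 2 * pole_coeff (nat \<lfloor>1 - p\<rfloor>) / (real (nat \<lfloor>1 - p\<rfloor>) - 1))"
  have E2: "k \<ge> 2" "odd (k - 1)" if "k \<in> E" for k
    using that by (auto simp: E_def elim!: evenE)
  have finE: "finite E"
    by (simp add: E_def)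
  have E_sum: "(\<Sum>k=1..m. if even k then f k else 0) = sum f E" for f :: "nat \<Rightarrow> real"
  proof -
    have "E = {1..m} \<inter> {k. even k}"
      by (auto simp: E_def)
    then show ?thesis
      by (simp add: sum.inter_restrict)
  qed
  have S_sum: "(\<Sum>(p, k)\<in>S. c (p, k) * (\<epsilon> powr p * ln \<epsilon> ^ k))
      = (\<Sum>k\<in>E. 2 * pole_coeff k / (real k - 1) * \<epsilon> powr (1 - real k))" for \<epsilon>
    unfolding S_def by (subst sum.reindex) (auto simp: inj_on_def c_def)
  \<comment> \<open>What remains of the pole integrals after their divergent powers of \<epsilon>
    are discarded.\<close>
  define reg where "reg \<epsilon> = (\<Sum>k\<in>E. 2 * pole_coeff k / (real k - 1) * (lattice_pole_reg (k - 1) (\<epsilon> / T) / T ^ (k - 1)))" for \<epsilon>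
  define d where "d = min (T / 2) (min (\<beta> - \<tau>) (\<tau> - \<alpha>))"
  have d: "d > 0" "d \<le> T / 2" "d \<le> \<beta> - \<tau>" "d \<le> \<tau> - \<alpha>"
    using \<tau> T_pos unfolding d_def by (auto simp: min_def)
  have small: "\<forall>\<^sub>F \<epsilon> in at_right 0. \<epsilon> \<in> {0<..<d}"
    using d by (intro eventually_at_right_real) simp
  have eq: "\<forall>\<^sub>F \<epsilon> in at_right 0. integral {\<tau> + \<epsilon>..\<tau> + T - \<epsilon>} reg_part + reg \<epsilon>
      = integral {\<alpha>..\<tau> - \<epsilon>} F + integral {\<tau> + \<epsilon>..\<beta>} F - (\<Sum>(p, k)\<in>S. c (p, k) * (\<epsilon> powr p * ln \<epsilon> ^ k))"
    using small
  proof eventually_elim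
    case (elim \<epsilon>)
    have \<epsilon>: "0 < \<epsilon>" "\<epsilon> < T / 2" "\<tau> + \<epsilon> \<le> \<beta>" "\<beta> \<le> \<tau> + T - \<epsilon>"
      using elim d by (auto simp: \<beta>_eq)
    have "integral {\<alpha>..\<tau> - \<epsilon>} F + integral {\<tau> + \<epsilon>..\<beta>} F
        = integral {\<tau> + \<epsilon>..\<beta>} \<F> + integral {\<beta>..\<tau> + T - \<epsilon>} \<F>"
      using F_integrals[OF \<epsilon>(1)] by simp
    also have "\<dots> = integral {\<tau> + \<epsilon>..\<tau> + T - \<epsilon>} \<F>"
      using \<epsilon> by (intro Henstock_Kurzweil_Integration.integral_combine \<F>_integrable) auto
    also have "\<dots> = integral {\<tau> + \<epsilon>..\<tau> + T - \<epsilon>} (\<lambda>\<xi>. reg_part \<xi> + pole_part \<xi>)"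
      using \<epsilon> by (intro Henstock_Kurzweil_Integration.integral_cong) (auto simp: reg_part_eq)
    also have "\<dots> = integral {\<tau> + \<epsilon>..\<tau> + T - \<epsilon>} reg_part + integral {\<tau> + \<epsilon>..\<tau> + T - \<epsilon>} pole_part"
      using \<epsilon> integral_pole_part[OF \<epsilon>(1,2)]
      by (intro Henstock_Kurzweil_Integration.integral_add integrable_on_subinterval[OF reg_part_integrable]) auto
    also have "integral {\<tau> + \<epsilon>..\<tau> + T - \<epsilon>} pole_part
        = (\<Sum>k=1..m. if even k then 2 * pole_coeff k / (real k - 1) * (lattice_pole (k - 1) (\<epsilon> / T) / T ^ (k - 1)) else 0)"
      unfolding integral_unique[OF integral_pole_part[OF \<epsilon>(1,2)]]
      by (intro sum.cong refl) (simp add: mult_ac)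
    also have "\<dots> = (\<Sum>k\<in>E. 2 * pole_coeff k / (real k - 1) * (lattice_pole (k - 1) (\<epsilon> / T) / T ^ (k - 1)))"
      by (rule E_sum)
    also have "\<dots> = (\<Sum>k\<in>E. 2 * pole_coeff k / (real k - 1) * \<epsilon> powr (1 - real k)) + reg \<epsilon>"
      unfolding reg_def sum.distrib[symmetric]
    proof (intro sum.cong refl)
      fix k assume k: "k \<in> E"
      have "lattice_pole (k - 1) (\<epsilon> / T) / T ^ (k - 1) = 1 / \<epsilon> ^ (k - 1) + lattice_pole_reg (k - 1) (\<epsilon> / T) / T ^ (k - 1)"
        using E2[OF k] \<epsilon> T_pos by (subst lattice_pole_eq) (auto simp: power_divide add_divide_distrib)
      also have "1 / \<epsilon> ^ (k - 1) = \<epsilon> powr (1 - real k)"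
      proof -
        have "1 - real k = - real (k - 1)"
          using E2[OF k] by (simp add: of_nat_diff)
        then show ?thesis
          using \<epsilon>(1) by (simp only: powr_minus_divide powr_realpow)
      qed
      finally show "2 * pole_coeff k / (real k - 1) * (lattice_pole (k - 1) (\<epsilon> / T) / T ^ (k - 1))
          = 2 * pole_coeff k / (real k - 1) * \<epsilon> powr (1 - real k)
          + 2 * pole_coeff k / (real k - 1) * (lattice_pole_reg (k - 1) (\<epsilon> / T) / T ^ (k - 1))"
        by (simp add: distrib_left)
    qed
    finally show ?case
      by (simp add: S_sum)
  qed
  have "(reg \<longlongrightarrow> (\<Sum>k\<in>E. 2 * pole_coeff k / (real k - 1) * (0 / T ^ (k - 1)))) (at_right 0)"
    unfolding reg_def[abs_def]
  proof (intro tendsto_sum tendsto_mult tendsto_divide tendsto_const)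
    fix k assume k: "k \<in> E"
    have "isCont (lattice_pole_reg (k - 1)) 0"
      using DERIV_isCont[OF smooth_on_has_deriv[OF smooth_on_lattice_pole_reg, of 0 0]] by simp
    moreover have "((\<lambda>\<epsilon>. \<epsilon> / T) \<longlongrightarrow> 0) (at_right 0)"
      using T_pos by (auto intro!: tendsto_eq_intros)
    ultimately have "((\<lambda>\<epsilon>. lattice_pole_reg (k - 1) (\<epsilon> / T)) \<longlongrightarrow> lattice_pole_reg (k - 1) 0) (at_right 0)"
      by (rule isCont_tendsto_compose)
    then show "((\<lambda>\<epsilon>. lattice_pole_reg (k - 1) (\<epsilon> / T)) \<longlongrightarrow> 0) (at_right 0)"
      using E2(2)[OF k] by (simp add: lattice_pole_reg_0)
  next
    fix k assume "k \<in> E"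
    then show "real k - 1 \<noteq> 0"
      using E2(1) by fastforce
  qed (use T_pos in auto)
  from tendsto_add[OF integral_reg_part_tendsto this]
  have "((\<lambda>\<epsilon>. integral {\<tau> + \<epsilon>..\<tau> + T - \<epsilon>} reg_part + reg \<epsilon>) \<longlongrightarrow> integral {\<tau>..\<tau> + T} reg_part) (at_right 0)"
    by simp
  from Lim_transform_eventually[OF this eq]
  have lim: "((\<lambda>\<epsilon>. integral {\<alpha>..\<tau> - \<epsilon>} F + integral {\<tau> + \<epsilon>..\<beta>} F
      - (\<Sum>(p, k)\<in>S. c (p, k) * (\<epsilon> powr p * ln \<epsilon> ^ k))) \<longlongrightarrow> integral {\<tau>..\<tau> + T} reg_part) (at_right 0)" .
  have "finite S" "\<forall>(p, k)\<in>S. p < 0 \<or> p = 0 \<and> k \<ge> 1"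
    using finE E2(1) by (force simp: S_def)+
  with lim F_integrals(1,2) show ?thesis
    unfolding has_finite_part_def by blast
qed

lemma T_hat_finite_part_bigo:
  "(\<lambda>n. T_hat s m T \<tau> \<F> G n - finite_part F \<alpha> \<beta> \<tau>) \<in> O(\<lambda>n. 1 / real n ^ q)"
  unfolding finite_part_eq[OF has_finite_part_F] by (rule T_hat_bigo[OF T_hat0_bigo])

lemma T_hat_tendsto_finite_part: "(\<lambda>n. T_hat s m T \<tau> \<F> G n) \<longlonglongrightarrow> finite_part F \<alpha> \<beta> \<tau>"
proof -
  have "(\<lambda>n. inverse (real n) ^ q) \<longlonglongrightarrow> 0 ^ q"
    by (intro tendsto_power lim_inverse_n)
  then have "(\<lambda>n. 1 / real n ^ q) \<longlonglongrightarrow> 0"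
    using q by (simp add: power_inverse divide_inverse zero_power)
  from tendsto_mult_right_zero[OF tendsto_norm_zero[OF this]]
  have lim: "(\<lambda>n. C * norm (1 / real n ^ q)) \<longlonglongrightarrow> 0" for C :: real .
  obtain C where C: "\<forall>\<^sub>F n in sequentially.
      norm (T_hat s m T \<tau> \<F> G n - finite_part F \<alpha> \<beta> \<tau>) \<le> C * norm (1 / real n ^ q)"
    by (rule landau_o.bigE[OF T_hat_finite_part_bigo]) (rule that)
  have "(\<lambda>n. T_hat s m T \<tau> \<F> G n - finite_part F \<alpha> \<beta> \<tau>) \<longlonglongrightarrow> 0"
    by (rule Lim_null_comparison[OF C lim])
  then show ?thesis
    by (rule LIM_zero_cancel)
qed

end

section \<open>From the change of variable to a smooth numerator over a pole of order m\<close>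

theorem theorem5p2:
  fixes m q :: nat
    and a b t \<alpha> \<beta> \<tau> T :: real
    and f g \<psi> F G \<F> :: "real \<Rightarrow> real"
  assumes "m \<ge> 1"
    and "a < t" "t < b"
    and f: "f = (\<lambda>x. g x / (x - t) ^ m)"
    and g_smooth: "smooth_on {a<..<b} g"
    and g_int_a: "\<forall>\<^sub>F \<delta> in at_right 0. g integrable_on {a<..<a + \<delta>}"
    and g_int_b: "\<forall>\<^sub>F \<delta> in at_right 0. g integrable_on {b - \<delta><..<b}"
    and psi_cont: "continuous_on {\<alpha>..\<beta>} \<psi>"
    and psi_smooth: "smooth_on {\<alpha><..<\<beta>} \<psi>"
    and psi_ends: "\<psi> \<alpha> = a" "\<psi> \<beta> = b"
    and psi_deriv: "\<forall>\<xi>\<in>{\<alpha><..<\<beta>}. deriv \<psi> \<xi> > 0"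
    and F: "F = (\<lambda>\<xi>. f (\<psi> \<xi>) * deriv \<psi> \<xi>)"
    and T: "T = \<beta> - \<alpha>"
    and tau: "\<tau> \<in> {\<alpha><..<\<beta>}" "\<psi> \<tau> = t"
    and G: "G = (\<lambda>\<xi>. g (\<psi> \<xi>) * deriv \<psi> \<xi> / divided_diff \<psi> \<xi> \<tau> ^ m)"
    and F_per: "\<F> = periodic_ext \<alpha> \<beta> F"
    and "q \<ge> 1"
    and F_ends: "\<forall>i<q. ((deriv ^^ i) F \<longlongrightarrow> 0) (at_right \<alpha>) \<and> ((deriv ^^ i) F \<longlongrightarrow> 0) (at_left \<beta>)"
    and F_q: "\<exists>\<delta>>0. abs_continuous_on {\<beta> - \<delta>..\<beta> + \<delta>} ((deriv ^^ (q - 1)) \<F>) \<and>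
                (deriv ^^ q) \<F> absolutely_integrable_on {\<beta> - \<delta>..\<beta> + \<delta>}"
  shows "\<forall>s \<le> (m + 2) div 2.
           (\<lambda>n. T_hat s m T \<tau> \<F> G n) \<longlonglongrightarrow> finite_part F \<alpha> \<beta> \<tau> \<and>
           (\<lambda>n. T_hat s m T \<tau> \<F> G n - finite_part F \<alpha> \<beta> \<tau>) \<in> O(\<lambda>n. 1 / real n ^ q)"
proof -
  have \<alpha>\<beta>: "\<alpha> < \<tau>" "\<tau> < \<beta>"
    using tau by auto
  \<comment> \<open>Derivatives are known only inside; continuity on the closed interval carries
    strict monotonicity to the endpoints, which puts interior values strictly between a and
    b.\<close>
  have mono: "\<psi> x < \<psi> y" if "\<alpha> \<le> x" "x < y" "y \<le> \<beta>" for x y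
  proof (rule DERIV_pos_imp_increasing_open[OF that(2)])
    fix z assume "x < z" "z < y"
    then have "z \<in> {\<alpha><..<\<beta>}"
      using that by auto
    then show "\<exists>d. (\<psi> has_real_derivative d) (at z) \<and> d > 0"
      using smooth_on_has_deriv[OF psi_smooth, of z 0] psi_deriv by auto
  qed (rule continuous_on_subset[OF psi_cont], use that in auto)
  have psi_range: "\<psi> x \<in> {a<..<b}" if "x \<in> {\<alpha><..<\<beta>}" for x
    using mono[of \<alpha> x] mono[of x \<beta>] that psi_ends by auto
  \<comment> \<open>Off \<tau> this is monotonicity, at \<tau> it is \<psi>'(\<tau>) > 0. The
    denominator of G therefore never vanishes, and G is smooth across \<tau>.\<close>
  have dd_pos: "divided_diff \<psi> x \<tau> > 0" if "x \<in> {\<alpha><..<\<beta>}" for x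
  proof (cases x \<tau> rule: linorder_cases)
    case less
    then show ?thesis
      using mono[of x \<tau>] that tau(1) by (auto simp: divided_diff_def divide_neg_neg)
  next
    case equal
    then show ?thesis
      using that psi_deriv by (simp add: divided_diff_def)
  next
    case greater
    then show ?thesis
      using mono[of \<tau> x] that tau(1) by (auto simp: divided_diff_def)
  qed
  have dd_nz: "divided_diff \<psi> x \<tau> ^ m \<noteq> 0" if "x \<in> {\<alpha><..<\<beta>}" for x
    using dd_pos[OF that] by simp
  have dpsi: "smooth_on {\<alpha><..<\<beta>} (deriv \<psi>)"
    using smooth_on_deriv[OF psi_smooth, of 1] by simp
  have G_smooth: "smooth_on {\<alpha><..<\<beta>} G"
    unfolding G
    by (intro smooth_on_divide smooth_on_mult smooth_on_power smooth_on_compose[OF psi_smooth g_smooth]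
        psi_range dpsi smooth_on_divided_diff(1)[OF psi_smooth tau(1)] dd_nz)
  have F_eq: "F \<xi> = G \<xi> / (\<xi> - \<tau>) ^ m" if "\<xi> \<in> {\<alpha><..<\<beta>}" "\<xi> \<noteq> \<tau>" for \<xi>
  proof -
    have "\<psi> \<xi> - t = divided_diff \<psi> \<xi> \<tau> * (\<xi> - \<tau>)"
      using that(2) tau(2) by (simp add: divided_diff_def)
    then show ?thesis
      by (simp add: F f G power_mult_distrib)
  qed
  interpret pole_integrand m q \<alpha> \<beta> \<tau> T F G
    by unfold_locales (use assms(1) \<open>q \<ge> 1\<close> \<alpha>\<beta> T G_smooth F_eq F_ends F_q in \<open>auto simp: F_per\<close>)
  show ?thesis
    unfolding F_per using T_hat_tendsto_finite_part T_hat_finite_part_bigo by blast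
qed

end
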